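(* Let $p\ge1$, $\theta\in\mathbb{R}^p$, $|\rho|<1$, and consider the adaptively controlled ARX$(p,0)$ process with first-order autoregressive noise described in the context, with the estimator $\overline\rho_n$ of $\rho$ and the Durbin-Watson statistic $\widehat D_n$. Assume that $\rho\neq0$ and that $(V_n)$ has a finite conditional moment of order $>2$. Then $\overline\rho_n$ converges almost surely to $\rho$, and $$(\overline\rho_n-\rho)^2=\mathcal O\left(\frac{\log n}{n}\right)\quad\text{a.s.}$$ In addition, $\widehat D_n$ converges almost surely to $D=2(1-\rho)$. Moreover, if $(V_n)$ has a finite conditional moment of order $>4$, then also $$\bigl(\widehat D_n-D\bigr)^2=\mathcal O\left(\frac{\log n}{n}\right)\quad\text{a.s.}$$
   Context: Model. For all $n\ge 0$, $$X_{n+1}=\sum_{k=1}^p\theta_kX_{n-k+1}+U_n+\varepsilon_{n+1},\qquad \varepsilon_{n+1}=\rho\varepsilon_n+V_{n+1},$$ with $\theta=(\theta_1,\dots,\theta_p)^t\in\mathbb{R}^p$, $|\rho|<1$. Initial values ($X_k$ for $k\le 0$, $\varepsilon_0$, $U_0$, $U_{-1}$) are arbitrary ($\mathcal F_0$-measurable). $(V_n)$ is a martingale difference sequence adapted to a filtration $(\mathcal F_n)$ with $\mathbb{E}[V_{n+1}^2\mid\mathcal F_n]=\sigma^2$ a.s. for all $n\ge0$, where $\sigma^2>0$ is a constant. "Finite conditional moment of order $>c$" means: there is $a>c$ with $\sup_{n\ge0}\mathbb{E}[|V_{n+1}|^a\mid\mathcal F_n]<\infty$ a.s. Regression vectors and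 parameter. $\varphi_n=(X_n,X_{n-1},\dots,X_{n-p+1})^t\in\mathbb{R}^p$, $\Phi_n=(X_n,\dots,X_{n-p+1},X_{n-p},U_{n-1})^t\in\mathbb{R}^{p+2}$, and $\vartheta\in\mathbb{R}^{p+2}$ is $$\vartheta=\begin{pmatrix}\theta\\0\\0\end{pmatrix}-\rho\begin{pmatrix}-1\\ \theta\\ 1\end{pmatrix},$$ so that for $n\ge 1$, $X_{n+1}=\vartheta^t\Phi_n+U_n+V_{n+1}$. Estimator and control. $S_n=\sum_{k=0}^n\Phi_k\Phi_k^t+I_{p+2}$; the least squares estimator satisfies, for $n\ge0$, $$\widehat\vartheta_{n+1}=\widehat\vartheta_n+S_n^{-1}\Phi_n\bigl(X_{n+1}-U_n-\widehat\vartheta_n^{\,t}\Phi_n\bigr),$$ with $\widehat\vartheta_0$ arbitrary. The adaptive tracking control is $U_n=x_{n+1}-\widehat\vartheta_n^{\,t}\Phi_n$ (for $n\ge 1$; $U_0$ may be arbitrary), where $(x_n)$ is a predictable real reference trajectory ($x_{n+1}$ is $\mathcal F_n$-measurable) satisfying $\sum_{k=1}^n x_k^2=o(n)$ a.s. Estimators of $\theta$ and $\rho$. $\widehat\rho_n=-\widehat\vartheta_{n,p+2}$ (the opposite of the last coordinate of $\widehat\vartheta_n$), and $\widehat\theta_n=(\widehat\theta_{n,1},\dots,\widehat\theta_{n,p})^t$ with, for $1\le k\le p$, $$\widehat\theta_{n,k}=\sum_{i=1}^{k}\widehat\rho_n^{\,k-i}\,\widehat\vartheta_{n,i}+\widehat\rho_n^{\,k-1}\,\widehat\vartheta_{n,p+2}$$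 (convention $0^0=1$). Residuals and statistics. For fixed $n\ge1$, the residuals are $\widehat\varepsilon_k=X_k-U_{k-1}-\widehat\theta_n^{\,t}\varphi_{k-1}$ for $1\le k\le n$ (they depend on $n$ through $\widehat\theta_n$), and $\widehat\varepsilon_0=X_0$. Then $$\overline\rho_n=\frac{\sum_{k=1}^n\widehat\varepsilon_k\widehat\varepsilon_{k-1}}{\sum_{k=1}^n\widehat\varepsilon_{k-1}^{\,2}},\qquad \widehat D_n=\frac{\sum_{k=1}^n(\widehat\varepsilon_k-\widehat\varepsilon_{k-1})^2}{\sum_{k=0}^n\widehat\varepsilon_k^{\,2}}.$$ *)

theory Defs
  imports
    "HOL-Probability.Probability"
    "HOL-Library.Landau_Symbols"
    "Jordan_Normal_Form.Gauss_Jordan_Elimination"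
begin

text \<open>Free \<open>$\<close> and \<open>\<bullet>\<close> for the vectors of variable dimension.\<close>

unbundle no vec_syntax and no inner_syntax

text \<open>Only \<open>V 1, V 2, \<dots>\<close> drive the model, so nothing is required of \<open>V 0\<close>.\<close>

definition martingale_difference ::
    "'a measure \<Rightarrow> (nat \<Rightarrow> 'a measure) \<Rightarrow> (nat \<Rightarrow> 'a \<Rightarrow> real) \<Rightarrow> bool" where
  "martingale_difference M F V \<longleftrightarrow>
     (\<forall>n. V (Suc n) \<in> borel_measurable (F (Suc n))
        \<and> integrable M (V (Suc n))
        \<and> (AE \<omega> in M. real_cond_exp M (F n) (V (Suc n)) \<omega> = 0))"

text \<open>Moments of nonnegative quantities use \<^const>\<open>nn_cond_exp\<close>, since
  \<^const>\<open>real_cond_exp\<close> collapses an infinite conditional expectation to \<open>0\<close>.\<close>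

definition finite_cond_moment_gt ::
    "'a measure \<Rightarrow> (nat \<Rightarrow> 'a measure) \<Rightarrow> (nat \<Rightarrow> 'a \<Rightarrow> real) \<Rightarrow> real \<Rightarrow> bool" where
  "finite_cond_moment_gt M F V c \<longleftrightarrow>
     (\<exists>a>c. AE \<omega> in M.
        (SUP n. nn_cond_exp M (F n) (\<lambda>\<omega>. ennreal (\<bar>V (Suc n) \<omega>\<bar> powr a)) \<omega>) < \<infinity>)"

text \<open>Vector entries are numbered from \<open>0\<close>: the \<open>i\<close>-th coordinate of the usual notation is
  \<open>v $ (i - 1)\<close>. Processes are indexed by \<^typ>\<open>int\<close> where values before time \<open>0\<close> occur.\<close>

definition regressor :: "nat \<Rightarrow> (int \<Rightarrow> 'a \<Rightarrow> real) \<Rightarrow> nat \<Rightarrow> 'a \<Rightarrow> real vec" where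
  "regressor p X n \<omega> = vec p (\<lambda>i. X (int n - int i) \<omega>)"

definition ext_regressor ::
    "nat \<Rightarrow> (int \<Rightarrow> 'a \<Rightarrow> real) \<Rightarrow> (int \<Rightarrow> 'a \<Rightarrow> real) \<Rightarrow> nat \<Rightarrow> 'a \<Rightarrow> real vec" where
  "ext_regressor p X U n \<omega> =
     vec (p + 2) (\<lambda>i. if i \<le> p then X (int n - int i) \<omega> else U (int n - 1) \<omega>)"

definition gram_matrix ::
    "nat \<Rightarrow> (int \<Rightarrow> 'a \<Rightarrow> real) \<Rightarrow> (int \<Rightarrow> 'a \<Rightarrow> real) \<Rightarrow> nat \<Rightarrow> 'a \<Rightarrow> real mat" where
  "gram_matrix p X U n \<omega> =
     mat (p + 2) (p + 2)
       (\<lambda>(i, j). \<Sum>k=0..n. ext_regressor p X U k \<omega> $ i * ext_regressor p X U k \<omega> $ j)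
     + 1\<^sub>m (p + 2)"

text \<open>The Gram matrix is positive definite, so \<^const>\<open>the\<close> never meets \<^const>\<open>None\<close>.\<close>

definition ls_gain ::
    "nat \<Rightarrow> (int \<Rightarrow> 'a \<Rightarrow> real) \<Rightarrow> (int \<Rightarrow> 'a \<Rightarrow> real) \<Rightarrow> nat \<Rightarrow> 'a \<Rightarrow> real vec" where
  "ls_gain p X U n \<omega> =
     the (mat_inverse (gram_matrix p X U n \<omega>)) *\<^sub>v ext_regressor p X U n \<omega>"

text \<open>Here \<open>T n \<omega>\<close> is the least squares estimate at time \<open>n\<close>, a vector of dimension \<open>p + 2\<close>.\<close>

definition rho_hat :: "nat \<Rightarrow> (nat \<Rightarrow> 'a \<Rightarrow> real vec) \<Rightarrow> nat \<Rightarrow> 'a \<Rightarrow> real" where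
  "rho_hat p T n \<omega> = - (T n \<omega> $ (p + 1))"

definition theta_hat :: "nat \<Rightarrow> (nat \<Rightarrow> 'a \<Rightarrow> real vec) \<Rightarrow> nat \<Rightarrow> 'a \<Rightarrow> real vec" where
  "theta_hat p T n \<omega> =
     vec p (\<lambda>j. (\<Sum>i=0..j. rho_hat p T n \<omega> ^ (j - i) * T n \<omega> $ i)
                 + rho_hat p T n \<omega> ^ j * T n \<omega> $ (p + 1))"

text \<open>\<open>residual p X U T n k\<close> is the \<open>k\<close>-th residual computed from the estimate at time \<open>n\<close>.\<close>

definition residual ::
    "nat \<Rightarrow> (int \<Rightarrow> 'a \<Rightarrow> real) \<Rightarrow> (int \<Rightarrow> 'a \<Rightarrow> real) \<Rightarrow> (nat \<Rightarrow> 'a \<Rightarrow> real vec)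
      \<Rightarrow> nat \<Rightarrow> nat \<Rightarrow> 'a \<Rightarrow> real" where
  "residual p X U T n k \<omega> =
     (if k = 0 then X 0 \<omega>
      else X (int k) \<omega> - U (int k - 1) \<omega> - theta_hat p T n \<omega> \<bullet> regressor p X (k - 1) \<omega>)"

definition rho_bar ::
    "nat \<Rightarrow> (int \<Rightarrow> 'a \<Rightarrow> real) \<Rightarrow> (int \<Rightarrow> 'a \<Rightarrow> real) \<Rightarrow> (nat \<Rightarrow> 'a \<Rightarrow> real vec)
      \<Rightarrow> nat \<Rightarrow> 'a \<Rightarrow> real" where
  "rho_bar p X U T n \<omega> =
     (\<Sum>k=1..n. residual p X U T n k \<omega> * residual p X U T n (k - 1) \<omega>)
     / (\<Sum>k=1..n. (residual p X U T n (k - 1) \<omega>)\<^sup>2)"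

definition durbin_watson ::
    "nat \<Rightarrow> (int \<Rightarrow> 'a \<Rightarrow> real) \<Rightarrow> (int \<Rightarrow> 'a \<Rightarrow> real) \<Rightarrow> (nat \<Rightarrow> 'a \<Rightarrow> real vec)
      \<Rightarrow> nat \<Rightarrow> 'a \<Rightarrow> real" where
  "durbin_watson p X U T n \<omega> =
     (\<Sum>k=1..n. (residual p X U T n k \<omega> - residual p X U T n (k - 1) \<omega>)\<^sup>2)
     / (\<Sum>k=0..n. (residual p X U T n k \<omega>)\<^sup>2)"

end

theory Submission
  imports Defs "Jordan_Normal_Form.Determinant" "HOL-Real_Asymp.Real_Asymp"
begin

text \<open>
  Writing \<open>T\<close> for the least squares estimate and \<open>S\<close> for the Gram matrix, the quadratic form of \<open>S\<close> at
  the estimation error plus the sum of the normalized squared prediction errors equals, up to a martingale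
  transform, the noise energy weighted by the leverages. The leverages sum to at most \<open>ln (det S)\<close>, so both
  quantities are \<open>O(ln (trace S))\<close>.

  The trace of \<open>S\<close> is first bounded polynomially, by a Gronwall argument for the closed loop in which the
  decrements of the trace of \<open>S\<^sup>-\<^sup>1\<close> act as small gains. Hence all but \<open>O(ln n)\<close> regressors are close to the
  regressors of perfect tracking, which are linear in the noises \<open>V\<close> at the current and the \<open>p\<close> preceding
  times and in one older value of \<open>\<epsilon>\<close>; these are asymptotically uncorrelated, and \<open>\<rho> \<noteq> 0\<close> makes the linear
  map injective. So \<open>S\<close> grows at least linearly in every direction, and the Gronwall argument applied again
  with gains of order \<open>1 / n\<close> shows that its trace grows linearly.

  The squared estimation error is therefore \<open>O(ln n / n)\<close>. The residuals differ from \<open>\<epsilon>\<close> by a sequence with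
  square sum \<open>O(ln n)\<close>, and the sum of \<open>\<epsilon>\<close> times the next \<open>V\<close> is \<open>O(sqrt (n ln n))\<close> by the normal equations,
  which gives the rate for the serial correlation. The Durbin-Watson statistic differs from twice one minus
  the serial correlation only by boundary terms, controlled by the growth of single noise values.
\<close>

text \<open>The obstacle is a circularity. The logarithmic bound on the prediction errors is
  expressed through the energy of the regressors, while in the closed loop that energy is driven by
  these very errors, and stability is not known beforehand. Only the logarithm of the energy enters
  the first bound, so any polynomial bound breaks the circle. It is available because the decrements
  of the trace tend to 0: the errors weighted by them sum to a small multiple of the log energy,
  hence their exponential is a small power of the energy. Randomness is confined to one notion:
  \<open>small_sums\<close> says pathwise that a noise sum is negligible against its own normalizer,
  up to a constant. After the martingale limit theorems, everything is deterministic on a single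
  trajectory. The cross sum of \<epsilon> and V is read off from the estimation error, in place of a
  law of the iterated logarithm. The moment of order above 4 makes the squared noise at time n of
  order at most sqrt n; divided by n, this is the boundary term of the Durbin-Watson
  statistic.\<close>

lemma square_add_le: "(a + b)\<^sup>2 \<le> 2 * a\<^sup>2 + 2 * (b::real)\<^sup>2"
  using zero_le_power2[of "a - b"] by (simp add: power2_eq_square algebra_simps)

lemma square_diff_le: "(a - b)\<^sup>2 \<le> 2 * a\<^sup>2 + 2 * (b::real)\<^sup>2"
  using square_add_le[of a "-b"] by simp

lemma square_add3_le: "(a + b + c)\<^sup>2 \<le> 3 * (a\<^sup>2 + b\<^sup>2 + (c::real)\<^sup>2)"
  using sum_squares_ge_zero[of "a - b" "a - c"] zero_le_power2[of "b - c"]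
  by (simp add: power2_eq_square algebra_simps)

lemma square_diff3_le: "(a - b - c)\<^sup>2 \<le> 3 * (a\<^sup>2 + b\<^sup>2 + (c::real)\<^sup>2)"
  using square_add3_le[of a "-b" "-c"] by simp

lemma abs_mult_le_squares: "2 * \<bar>a * b\<bar> \<le> a\<^sup>2 + (b::real)\<^sup>2"
  using zero_le_power2[of "\<bar>a\<bar> - \<bar>b\<bar>"] by (simp add: power2_eq_square abs_mult algebra_simps)

subsection \<open>Almost sure convergence of square integrable martingales\<close>

locale filtered_prob_space = prob_space M for M :: "'a measure" +
  fixes F :: "nat \<Rightarrow> 'a measure"
  assumes filt: "filtration (space M) F" and subalg: "\<And>n. subalgebra M (F n)"
begin

lemma space_F_eq: "space (F n) = space M"
  using filt by (simp add: filtration.space_F)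

lemma measurable_F_mono: "m \<le> n \<Longrightarrow> f \<in> measurable (F m) N \<Longrightarrow> f \<in> measurable (F n) N"
  using filtration.sets_F_mono[OF filt, of m n] space_F_eq
  by (auto simp: measurable_def)

lemma measurable_M: "f \<in> measurable (F n) N \<Longrightarrow> f \<in> measurable M N"
  using measurable_from_subalg[OF subalg] .

text \<open>The conditional mean is tested against \<open>F k\<close>-measurable \<open>g\<close>
  instead of being written as a conditional expectation, so that a predictable bounded factor can
  simply be moved into \<open>g\<close>. The k-th increment is known at time k + 1.\<close>

definition square_mart_diff :: "(nat \<Rightarrow> 'a \<Rightarrow> real) \<Rightarrow> bool" where
  "square_mart_diff \<xi> \<longleftrightarrow> (\<forall>k. \<xi> k \<in> borel_measurable (F (Suc k)) \<and> integrable M (\<lambda>\<omega>. (\<xi> k \<omega>)\<^sup>2)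
     \<and> (\<forall>g\<in>borel_measurable (F k). integrable M (\<lambda>\<omega>. g \<omega> * \<xi> k \<omega>) \<longrightarrow> expectation (\<lambda>\<omega>. g \<omega> * \<xi> k \<omega>) = 0))"

lemma square_mart_diffD:
  assumes "square_mart_diff \<xi>"
  shows "\<xi> k \<in> borel_measurable (F (Suc k))" "integrable M (\<lambda>\<omega>. (\<xi> k \<omega>)\<^sup>2)"
    "g \<in> borel_measurable (F k) \<Longrightarrow> integrable M (\<lambda>\<omega>. g \<omega> * \<xi> k \<omega>) \<Longrightarrow> expectation (\<lambda>\<omega>. g \<omega> * \<xi> k \<omega>) = 0"
  using assms unfolding square_mart_diff_def by auto

lemma integrable_mult_of_squares:
  assumes [measurable]: "f \<in> borel_measurable M" "g \<in> borel_measurable M"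
    and "integrable M (\<lambda>\<omega>. (f \<omega>)\<^sup>2)" "integrable M (\<lambda>\<omega>. (g \<omega> :: real)\<^sup>2)"
  shows "integrable M (\<lambda>\<omega>. f \<omega> * g \<omega>)"
proof (rule Bochner_Integration.integrable_bound[OF Bochner_Integration.integrable_add[OF assms(3,4)]])
  have "\<bar>a * b\<bar> \<le> a\<^sup>2 + b\<^sup>2" for a b :: real
    using abs_mult_le_squares[of a b] by linarith
  thus "AE x in M. norm (f x * g x) \<le> norm ((f x)\<^sup>2 + (g x)\<^sup>2)" by (auto simp: abs_mult)
qed simp

lemma partial_sum_measurable:
  assumes "square_mart_diff \<xi>" "j \<le> n"
  shows "(\<lambda>\<omega>. \<Sum>k<j. \<xi> k \<omega>) \<in> borel_measurable (F n)"
  using square_mart_diffD(1)[OF assms(1)] assms(2)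
  by (intro borel_measurable_sum measurable_F_mono[of "Suc _" n]) auto

text \<open>Orthogonality of increments: the partial sum up to n serves as the test function for the
  n-th increment, so the cross term vanishes.\<close>

lemma square_mart_diff_sum:
  assumes \<xi>: "square_mart_diff \<xi>"
  shows "integrable M (\<lambda>\<omega>. (\<Sum>k<n. \<xi> k \<omega>)\<^sup>2) \<and>
    expectation (\<lambda>\<omega>. (\<Sum>k<n. \<xi> k \<omega>)\<^sup>2) = (\<Sum>k<n. expectation (\<lambda>\<omega>. (\<xi> k \<omega>)\<^sup>2))"
proof (induction n)
  case (Suc n)
  let ?S = "\<lambda>\<omega>. \<Sum>k<n. \<xi> k \<omega>"
  have m: "?S \<in> borel_measurable (F n)"
    using partial_sum_measurable[OF \<xi>, of n n] by simp
  note [measurable] = measurable_M[OF m] measurable_M[OF square_mart_diffD(1)[OF \<xi>]]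
  have i: "integrable M (\<lambda>\<omega>. ?S \<omega> * \<xi> n \<omega>)"
    using Suc square_mart_diffD(2)[OF \<xi>] by (intro integrable_mult_of_squares) auto
  have z: "expectation (\<lambda>\<omega>. ?S \<omega> * \<xi> n \<omega>) = 0"
    by (rule square_mart_diffD(3)[OF \<xi> m i])
  have e: "(\<Sum>k<Suc n. \<xi> k \<omega>)\<^sup>2 = (?S \<omega>)\<^sup>2 + 2 * (?S \<omega> * \<xi> n \<omega>) + (\<xi> n \<omega>)\<^sup>2" for \<omega>
    by (simp add: power2_eq_square algebra_simps)
  show ?case unfolding e
    using Suc i z square_mart_diffD(2)[OF \<xi>, of n] by auto
qed simp

lemma square_mart_diff_stopped:
  assumes \<xi>: "square_mart_diff \<xi>" and c: "\<And>k. c k \<in> borel_measurable (F k)"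
    and b: "\<And>k \<omega>. c k \<omega> \<in> {0, 1}"
  shows "square_mart_diff (\<lambda>k \<omega>. c k \<omega> * \<xi> k \<omega>)"
    "expectation (\<lambda>\<omega>. (c k \<omega> * \<xi> k \<omega>)\<^sup>2) \<le> expectation (\<lambda>\<omega>. (\<xi> k \<omega>)\<^sup>2)"
proof -
  note [measurable] = measurable_M[OF c] measurable_M[OF square_mart_diffD(1)[OF \<xi>]]
  have le: "(c k \<omega> * \<xi> k \<omega>)\<^sup>2 \<le> (\<xi> k \<omega>)\<^sup>2" for k \<omega>
    using b[of k \<omega>] by auto
  have i: "integrable M (\<lambda>\<omega>. (c k \<omega> * \<xi> k \<omega>)\<^sup>2)" for k
    using le by (intro Bochner_Integration.integrable_bound[OF square_mart_diffD(2)[OF \<xi>, of k]]) auto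
  show "square_mart_diff (\<lambda>k \<omega>. c k \<omega> * \<xi> k \<omega>)"
    unfolding square_mart_diff_def
  proof (intro allI conjI ballI impI i)
    fix k show "(\<lambda>\<omega>. c k \<omega> * \<xi> k \<omega>) \<in> borel_measurable (F (Suc k))"
      by (intro borel_measurable_times measurable_F_mono[OF _ c[of k]] square_mart_diffD(1)[OF \<xi>]) simp
    fix g assume g: "g \<in> borel_measurable (F k)" "integrable M (\<lambda>\<omega>. g \<omega> * (c k \<omega> * \<xi> k \<omega>))"
    show "expectation (\<lambda>\<omega>. g \<omega> * (c k \<omega> * \<xi> k \<omega>)) = 0"
      using square_mart_diffD(3)[OF \<xi>, of "\<lambda>\<omega>. g \<omega> * c k \<omega>" k] g c by (simp add: mult.assoc)
  qed
  show "expectation (\<lambda>\<omega>. (c k \<omega> * \<xi> k \<omega>)\<^sup>2) \<le> expectation (\<lambda>\<omega>. (\<xi> k \<omega>)\<^sup>2)"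
    using le i square_mart_diffD(2)[OF \<xi>] by (intro integral_mono) auto
qed

text \<open>Stopping the partial sums when they leave \<open>(-e, e)\<close> gives again a square integrable
  martingale, to which Chebyshev's inequality applies.\<close>

lemma kolmogorov_maximal:
  assumes \<xi>: "square_mart_diff \<xi>" and e: "e > 0"
  shows "prob {\<omega> \<in> space M. \<exists>j\<le>n. e \<le> \<bar>\<Sum>k<j. \<xi> k \<omega>\<bar>} \<le> (\<Sum>k<n. expectation (\<lambda>\<omega>. (\<xi> k \<omega>)\<^sup>2)) / e\<^sup>2"
proof -
  define S where "S j \<omega> = (\<Sum>k<j. \<xi> k \<omega>)" for j \<omega>
  define c :: "nat \<Rightarrow> 'a \<Rightarrow> real" where "c k \<omega> = (if \<forall>j\<in>{..k}. \<bar>S j \<omega>\<bar> < e then 1 else 0)" for k \<omega>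
  have S: "S j \<in> borel_measurable (F k)" if "j \<le> k" for j k
    using partial_sum_measurable[OF \<xi>, of j k] that unfolding S_def by simp
  have c: "c k \<in> borel_measurable (F k)" for k
    unfolding c_def
  proof (rule measurable_If)
    have "Measurable.pred (F k) (\<lambda>\<omega>. \<bar>S j \<omega>\<bar> < e)" if "j \<le> k" for j
      using S[OF that] by measurable
    hence "Measurable.pred (F k) (\<lambda>\<omega>. \<forall>j\<in>{..k}. \<bar>S j \<omega>\<bar> < e)"
      by (intro pred_intros_finite) auto
    thus "{\<omega> \<in> space (F k). \<forall>j\<in>{..k}. \<bar>S j \<omega>\<bar> < e} \<in> sets (F k)" by (rule predE)
  qed auto
  have b: "c k \<omega> \<in> {0, 1}" for k \<omega> by (simp add: c_def)
  note st = square_mart_diff_stopped[OF \<xi> c b]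
  define N where "N \<omega> = (\<Sum>k<n. c k \<omega> * \<xi> k \<omega>)" for \<omega>
  note sm = square_mart_diff_sum[OF st(1), of n, folded N_def]
  have [measurable]: "N \<in> borel_measurable M"
    unfolding N_def using measurable_M[OF c] measurable_M[OF square_mart_diffD(1)[OF \<xi>]] by measurable
  have [measurable]: "S j \<in> borel_measurable M" for j using measurable_M[OF S[of j j]] by simp
  have "e \<le> \<bar>N \<omega>\<bar>" if ex: "\<exists>j\<le>n. e \<le> \<bar>S j \<omega>\<bar>" for \<omega>
  proof -
    define j where "j = (LEAST j. e \<le> \<bar>S j \<omega>\<bar>)"
    have j: "e \<le> \<bar>S j \<omega>\<bar>" "j \<le> n"
      using ex LeastI_ex[of "\<lambda>j. e \<le> \<bar>S j \<omega>\<bar>"] Least_le[of "\<lambda>j. e \<le> \<bar>S j \<omega>\<bar>"] unfolding j_def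
      by (auto intro: order_trans)
    have l: "\<bar>S i \<omega>\<bar> < e" if "i < j" for i
      using not_less_Least[of i "\<lambda>j. e \<le> \<bar>S j \<omega>\<bar>"] that unfolding j_def by auto
    \<comment> \<open>\<open>j\<close> is the first exit time. The weights are 1 before it and 0
      from it on, so the stopped sum is frozen at \<open>S j\<close>.\<close>
    have "c k \<omega> = (if k < j then 1 else 0)" for k
      using l j(1) by (auto simp: c_def) (meson atMost_iff leI linorder_not_le order_less_le_trans)
    hence "N \<omega> = (\<Sum>k<n. if k < j then \<xi> k \<omega> else 0)" unfolding N_def by (intro sum.cong) auto
    also have "\<dots> = (\<Sum>k\<in>{..<n} \<inter> {k. k < j}. \<xi> k \<omega>)" by (subst sum.inter_restrict) auto
    also have "{..<n} \<inter> {k. k < j} = {..<j}" using j(2) by auto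
    finally show ?thesis using j(1) by (simp add: S_def)
  qed
  hence "prob {\<omega> \<in> space M. \<exists>j\<le>n. e \<le> \<bar>S j \<omega>\<bar>} \<le> prob {\<omega> \<in> space M. e\<^sup>2 \<le> (N \<omega>)\<^sup>2}"
    using e by (intro finite_measure_mono) (auto simp: abs_le_square_iff[symmetric])
  also have "\<dots> \<le> expectation (\<lambda>\<omega>. (N \<omega>)\<^sup>2) / e\<^sup>2"
    using sm e by (intro integral_Markov_inequality_measure[where A="{}"]) (auto simp: zero_less_power2)
  also have "\<dots> \<le> (\<Sum>k<n. expectation (\<lambda>\<omega>. (\<xi> k \<omega>)\<^sup>2)) / e\<^sup>2"
    using sm st(2) by (intro divide_right_mono) (auto intro: sum_mono)
  finally show ?thesis unfolding S_def .
qed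

text \<open>The maximal inequality, applied to the increments from m on, bounds the oscillation
  after time m by a tail of the convergent series of variances. Letting m grow makes almost every
  path Cauchy.\<close>

lemma square_mart_diff_convergent:
  assumes \<xi>: "square_mart_diff \<xi>" and B: "\<And>n. (\<Sum>k<n. expectation (\<lambda>\<omega>. (\<xi> k \<omega>)\<^sup>2)) \<le> B"
  shows "AE \<omega> in M. convergent (\<lambda>n. \<Sum>k<n. \<xi> k \<omega>)"
proof -
  note [measurable] = measurable_M[OF square_mart_diffD(1)[OF \<xi>]]
  define s where "s k = expectation (\<lambda>\<omega>. (\<xi> k \<omega>)\<^sup>2)" for k
  have s0: "s k \<ge> 0" for k by (simp add: s_def)
  have sums: "summable s" using B s0 by (intro summableI_nonneg_bounded[where x=B]) (auto simp: s_def)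
  \<comment> \<open>The first m increments are replaced by 0, so that the partial sums become the
    differences from the m-th one without any shift of the filtration.\<close>
  define E where "E e m n = {\<omega> \<in> space M. \<exists>j\<le>n. e \<le> \<bar>\<Sum>k<j. if k < m then 0 else \<xi> k \<omega>\<bar>}" for e :: real and m n
  have Em[measurable]: "E e m n \<in> sets M" for e m n unfolding E_def by measurable
  have bound: "prob (\<Union>n. E e m n) \<le> (\<Sum>k. s (k + m)) / e\<^sup>2" if e: "e > 0" for e m
  proof (rule LIMSEQ_le_const2)
    show "(\<lambda>n. prob (E e m n)) \<longlonglongrightarrow> prob (\<Union>n. E e m n)"
      by (rule finite_Lim_measure_incseq) (auto simp: E_def incseq_def intro: order_trans)
    have c: "(\<lambda>\<omega>. if k < m then 0 else (1::real)) \<in> borel_measurable (F k)" for k by simp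
    have eq: "(\<lambda>k \<omega>. (if k < m then 0 else 1) * \<xi> k \<omega>) = (\<lambda>k \<omega>. if k < m then 0 else \<xi> k \<omega>)" by (auto simp: fun_eq_iff)
    have md: "square_mart_diff (\<lambda>k \<omega>. if k < m then 0 else \<xi> k \<omega>)"
      using square_mart_diff_stopped(1)[OF \<xi> c] unfolding eq by simp
    have "(\<Sum>k<n. expectation (\<lambda>\<omega>. (if k < m then 0 else \<xi> k \<omega>)\<^sup>2)) \<le> (\<Sum>k. s (k + m))" for n
    proof -
      have "(\<Sum>k<n. expectation (\<lambda>\<omega>. (if k < m then 0 else \<xi> k \<omega>)\<^sup>2)) = (\<Sum>k<n. if k < m then 0 else s k)"
        by (intro sum.cong) (auto simp: s_def)
      also have "\<dots> \<le> (\<Sum>k<n+m. if k < m then 0 else s k)" using s0 by (intro sum_mono2) auto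
      also have "\<dots> = (\<Sum>k<n. s (k + m))"
        by (induction n) (auto)
      also have "\<dots> \<le> (\<Sum>k. s (k + m))" using sums s0 by (intro sum_le_suminf) (auto simp: summable_iff_shift)
      finally show ?thesis .
    qed
    thus "\<exists>N. \<forall>n\<ge>N. prob (E e m n) \<le> (\<Sum>k. s (k + m)) / e\<^sup>2"
      using kolmogorov_maximal[OF md e] unfolding E_def
      by (intro exI allI impI order_trans[OF kolmogorov_maximal[OF md e]] divide_right_mono) auto
  qed
  have null: "prob (\<Inter>m. \<Union>n. E e m n) = 0" if e: "e > 0" for e
  proof -
    have "(\<lambda>m. (\<Sum>k. s (k + m)) / e\<^sup>2) \<longlonglongrightarrow> 0 / e\<^sup>2"
      by (intro tendsto_divide suminf_exist_split2 sums) (use e in auto)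
    hence "prob (\<Inter>m. \<Union>n. E e m n) \<le> 0"
      using bound[OF e]
      by (intro LIMSEQ_le_const[where X="\<lambda>m. (\<Sum>k. s (k + m)) / e\<^sup>2"])
        (auto intro!: exI order_trans[OF finite_measure_mono bound[OF e]])
    thus ?thesis by (simp add: measure_le_0_iff)
  qed
  have "AE \<omega> in M. \<omega> \<notin> (\<Inter>m. \<Union>n. E (1 / Suc N) m n)" for N :: nat
    by (rule AE_not_in) (use null[of "1 / Suc N"] in \<open>auto simp: null_sets_def emeasure_eq_measure\<close>)
  hence "AE \<omega> in M. \<forall>N. \<omega> \<notin> (\<Inter>m. \<Union>n. E (1 / Suc N) m n)" by (simp add: AE_all_countable)
  thus ?thesis
  proof (rule AE_mp, intro AE_I2 impI)
    fix \<omega> assume w: "\<omega> \<in> space M" "\<forall>N. \<omega> \<notin> (\<Inter>m. \<Union>n. E (1 / Suc N) m n)"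
    have "Cauchy (\<lambda>n. \<Sum>k<n. \<xi> k \<omega>)"
    proof (rule metric_CauchyI)
      fix e :: real assume "e > 0"
      then obtain N where N: "1 / Suc N < e / 2" using nat_approx_posE half_gt_zero by metis
      obtain m where m: "\<And>n. \<omega> \<notin> E (1 / Suc N) m n" using w(2) by blast
      have d: "\<bar>(\<Sum>k<j. \<xi> k \<omega>) - (\<Sum>k<m. \<xi> k \<omega>)\<bar> < e / 2" if "j \<ge> m" for j
      proof -
        have "(\<Sum>k<j. if k < m then 0 else \<xi> k \<omega>) = (\<Sum>k<j. \<xi> k \<omega>) - (\<Sum>k<m. \<xi> k \<omega>)"
          using that by (induction j rule: dec_induct) auto
        thus ?thesis using m[of j] w(1) N unfolding E_def by (force simp: not_le)
      qed
      show "\<exists>M. \<forall>m\<ge>M. \<forall>n\<ge>M. dist (\<Sum>k<m. \<xi> k \<omega>) (\<Sum>k<n. \<xi> k \<omega>) < e"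
      proof (intro exI[of _ m] allI impI)
        fix i j assume "i \<ge> m" "j \<ge> m"
        thus "dist (\<Sum>k<i. \<xi> k \<omega>) (\<Sum>k<j. \<xi> k \<omega>) < e"
          using d[of i] d[of j] unfolding dist_real_def by linarith
      qed
    qed
    thus "convergent (\<lambda>n. \<Sum>k<n. \<xi> k \<omega>)" by (rule Cauchy_convergent)
  qed
qed

end

section \<open>Kronecker's lemma\<close>

text \<open>This covers both cases of the strong law for martingales at once: the sum of
  \<open>s\<close> is bounded where the sum of \<open>b\<close> is, and of smaller order where the
  latter diverges.\<close>

definition small_sums :: "(nat \<Rightarrow> real) \<Rightarrow> (nat \<Rightarrow> real) \<Rightarrow> bool" where
  "small_sums s b \<longleftrightarrow> (\<forall>\<eta>>0. \<exists>C. \<forall>n. \<bar>\<Sum>k<n. s k\<bar> \<le> \<eta> * (\<Sum>k<n. b k) + C)"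

lemma small_sumsD: "small_sums s b \<Longrightarrow> \<eta> > 0 \<Longrightarrow> \<exists>C. \<forall>n. \<bar>\<Sum>k<n. s k\<bar> \<le> \<eta> * (\<Sum>k<n. b k) + C"
  by (simp add: small_sums_def)

text \<open>Summation by parts against the tails of the convergent normalized series: the tails are
  eventually below half of \<eta>, and the constant collects the finitely many earlier terms. The
  summand 1 keeps the normalizer positive.\<close>

lemma kronecker_small_sums:
  fixes b s :: "nat \<Rightarrow> real"
  assumes b: "\<And>k. b k \<ge> 0" and conv: "convergent (\<lambda>n. \<Sum>k<n. s k / (1 + (\<Sum>j\<le>k. b j)))"
  shows "small_sums s b"
  unfolding small_sums_def
proof (intro allI impI)
  fix \<eta> :: real assume \<eta>: "\<eta> > 0"
  define B where "B n = 1 + (\<Sum>j<n. b j)" for n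
  have B: "B n \<ge> 1" "B n > 0" for n using sum_nonneg[of "{..<n}" b] b by (simp_all add: B_def add_pos_nonneg)
  have BS: "1 + (\<Sum>j\<le>k. b j) = B (Suc k)" for k by (simp add: B_def lessThan_Suc_atMost)
  from conv obtain T where T: "(\<lambda>n. \<Sum>k<n. s k / B (Suc k)) \<longlonglongrightarrow> T"
    unfolding BS by (auto simp: convergent_def)
  define \<tau> where "\<tau> n = T - (\<Sum>k<n. s k / B (Suc k))" for n
  have "\<tau> \<longlonglongrightarrow> 0" unfolding \<tau>_def using tendsto_diff[OF tendsto_const[of T] T] by simp
  then obtain k0 where k0: "\<And>k. k \<ge> k0 \<Longrightarrow> \<bar>\<tau> k\<bar> \<le> \<eta> / 2"
  proof -
    obtain no where no: "\<forall>n\<ge>no. norm (\<tau> n - 0) < \<eta> / 2"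
      using LIMSEQ_D[OF \<open>\<tau> \<longlonglongrightarrow> 0\<close>, of "\<eta> / 2"] \<eta> by auto
    show thesis by (rule that[of no]) (use no in \<open>force simp: less_imp_le\<close>)
  qed
  \<comment> \<open>Abel summation: \<open>s n\<close> is \<open>B (Suc n)\<close> times the drop of
    \<tau>, and \<tau> then gets weighted by the increments \<open>b\<close> of
    \<open>B\<close>.\<close>
  have D: "(\<Sum>k<n. s k) + B n * \<tau> n = \<tau> 0 + (\<Sum>k<n. b k * \<tau> k)" for n
  proof (induction n)
    case (Suc n)
    have "\<tau> n - \<tau> (Suc n) = s n / B (Suc n)" by (simp add: \<tau>_def)
    hence "s n = B (Suc n) * (\<tau> n - \<tau> (Suc n))" using B(2)[of "Suc n"] by (simp add: field_simps)
    moreover have "B (Suc n) = B n + b n" by (simp add: B_def)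
    ultimately show ?case using Suc by (simp add: algebra_simps)
  qed (simp add: B_def)
  define C where "C = \<bar>\<tau> 0\<bar> + (\<Sum>k<k0. b k * \<bar>\<tau> k\<bar>) + (\<Sum>k<k0. B k * \<bar>\<tau> k\<bar>) + \<eta> / 2"
  show "\<exists>C. \<forall>n. \<bar>\<Sum>k<n. s k\<bar> \<le> \<eta> * (\<Sum>k<n. b k) + C"
  proof (intro exI[of _ C] allI)
    fix n
    have 1: "\<bar>\<Sum>k<n. b k * \<tau> k\<bar> \<le> (\<Sum>k<k0. b k * \<bar>\<tau> k\<bar>) + \<eta> / 2 * (\<Sum>k<n. b k)"
    proof -
      have "\<bar>\<Sum>k<n. b k * \<tau> k\<bar> \<le> (\<Sum>k<n. b k * \<bar>\<tau> k\<bar>)"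
        using b by (intro order_trans[OF sum_abs] sum_mono) (simp add: abs_mult)
      also have "\<dots> \<le> (\<Sum>k<n. (if k < k0 then b k * \<bar>\<tau> k\<bar> else 0) + \<eta> / 2 * b k)"
      proof (intro sum_mono)
        fix k
        show "b k * \<bar>\<tau> k\<bar> \<le> (if k < k0 then b k * \<bar>\<tau> k\<bar> else 0) + \<eta> / 2 * b k"
        proof (cases "k < k0")
          case False
          thus ?thesis using mult_left_mono[OF k0[of k] b[of k]] by (simp add: mult.commute)
        qed (use b[of k] \<eta> in simp)
      qed
      also have "\<dots> = (\<Sum>k<n. (if k < k0 then b k * \<bar>\<tau> k\<bar> else 0)) + \<eta> / 2 * (\<Sum>k<n. b k)"
        by (simp add: sum.distrib sum_distrib_left)
      also have "(\<Sum>k<n. (if k < k0 then b k * \<bar>\<tau> k\<bar> else 0)) = (\<Sum>k\<in>{..<n} \<inter> {k. k < k0}. b k * \<bar>\<tau> k\<bar>)"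
        by (subst sum.inter_restrict) auto
      also have "\<dots> \<le> (\<Sum>k<k0. b k * \<bar>\<tau> k\<bar>)" using b by (intro sum_mono2) auto
      finally show ?thesis by simp
    qed
    have 2: "B n * \<bar>\<tau> n\<bar> \<le> (\<Sum>k<k0. B k * \<bar>\<tau> k\<bar>) + \<eta> / 2 * B n"
    proof (cases "n < k0")
      case True
      have "B n * \<bar>\<tau> n\<bar> \<le> (\<Sum>k<k0. B k * \<bar>\<tau> k\<bar>)"
        using True by (intro member_le_sum[where f="\<lambda>k. B k * \<bar>\<tau> k\<bar>"])
          (auto intro!: mult_nonneg_nonneg less_imp_le[OF B(2)])
      moreover have "\<eta> / 2 * B n \<ge> 0" using \<eta> B(2)[of n] by simp
      ultimately show ?thesis by linarith
    next
      case False
      have "B n * \<bar>\<tau> n\<bar> \<le> B n * (\<eta> / 2)"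
        using False k0[of n] B(2)[of n] by (intro mult_left_mono) auto
      moreover have "(\<Sum>k<k0. B k * \<bar>\<tau> k\<bar>) \<ge> 0" using B(2) by (intro sum_nonneg) (simp add: less_imp_le)
      ultimately show ?thesis by (simp add: mult.commute)
    qed
    have "\<bar>B n * \<tau> n\<bar> = B n * \<bar>\<tau> n\<bar>" using B(2)[of n] by (simp add: abs_mult)
    moreover have "\<eta> / 2 * B n = \<eta> / 2 + \<eta> / 2 * (\<Sum>k<n. b k)" by (simp add: B_def algebra_simps)
    ultimately have "\<bar>\<Sum>k<n. s k\<bar> \<le> C + (\<eta> / 2 * (\<Sum>k<n. b k) + \<eta> / 2 * (\<Sum>k<n. b k))"
      using 1 2 D[of n] unfolding C_def by linarith
    also have "\<dots> = C + \<eta> * (\<Sum>k<n. b k)" by (simp add: field_simps)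
    finally show "\<bar>\<Sum>k<n. s k\<bar> \<le> \<eta> * (\<Sum>k<n. b k) + C" by simp
  qed
qed

text \<open>Comparison with the integral of t to the power -q over [a, b], carried out by the mean
  value theorem for its primitive.\<close>

lemma diff_times_powr_le:
  fixes a b q :: real
  assumes "0 < a" "a \<le> b" "q > 1"
  shows "(b - a) * b powr (-q) \<le> (a powr (1 - q) - b powr (1 - q)) / (q - 1)"
proof (cases "a = b")
  case False
  hence ab: "a < b" using assms by simp
  have "\<exists>z>a. z < b \<and> b powr (1-q) - a powr (1-q) = (b - a) * ((1 - q) * z powr (1 - q - 1))"
    using assms by (intro MVT2 ab) (auto intro!: derivative_eq_intros)
  then obtain z where z: "z > a" "z < b" "b powr (1-q) - a powr (1-q) = (b - a) * ((1 - q) * z powr (- q))" by auto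
  have "b powr (-q) \<le> z powr (-q)" using z assms by (intro powr_mono2') auto
  hence "(b - a) * b powr (-q) \<le> (b - a) * z powr (-q)" using ab by (intro mult_left_mono) auto
  also have "\<dots> = (a powr (1 - q) - b powr (1 - q)) / (q - 1)" using z(3) assms by (simp add: field_simps)
  finally show ?thesis .
qed simp

text \<open>The integral comparison telescopes. The bound depends neither on \<open>f\<close> nor on
  n, so it may be applied pathwise to random weights and integrated afterwards.\<close>

lemma sum_div_powr_partial_sums_le:
  fixes f :: "nat \<Rightarrow> real"
  assumes f: "\<And>k. f k \<ge> 0" and q: "q > 1"
  shows "(\<Sum>k<n. f k * (1 + (\<Sum>j\<le>k. f j)) powr (-q)) \<le> 1 / (q - 1)"
proof -
  define H where "H n = 1 + (\<Sum>j<n. f j)" for n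
  have H: "H n \<ge> 1" for n using sum_nonneg[of "{..<n}" f] f by (simp add: H_def)
  have "(\<Sum>k<n. f k * (1 + (\<Sum>j\<le>k. f j)) powr (-q)) = (\<Sum>k<n. (H (Suc k) - H k) * H (Suc k) powr (-q))"
    by (simp add: H_def flip: lessThan_Suc_atMost)
  also have "\<dots> \<le> (\<Sum>k<n. (H k powr (1 - q) - H (Suc k) powr (1 - q)) / (q - 1))"
  proof (intro sum_mono diff_times_powr_le q)
    fix k show "0 < H k" using H[of k] by simp
    show "H k \<le> H (Suc k)" using f by (simp add: H_def)
  qed
  also have "\<dots> = (\<Sum>k<n. H k powr (1 - q) - H (Suc k) powr (1 - q)) / (q - 1)"
    by (simp add: sum_divide_distrib)
  also have "(\<Sum>k<n. H k powr (1 - q) - H (Suc k) powr (1 - q)) = H 0 powr (1 - q) - H n powr (1 - q)"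
    by (induction n) auto
  also have "\<dots> / (q - 1) \<le> 1 / (q - 1)"
    using q by (intro divide_right_mono) (auto simp: H_def)
  finally show ?thesis .
qed

section \<open>Criteria through conditional expectations\<close>

context filtered_prob_space
begin

lemma sigma_finite_subalgebra_F: "sigma_finite_subalgebra M (F n)"
proof -
  interpret finite_measure_subalgebra M "F n"
    by unfold_locales (rule subalg)
  show ?thesis by unfold_locales
qed

lemma square_mart_diffI:
  assumes "\<And>k. \<xi> k \<in> borel_measurable (F (Suc k))" "\<And>k. integrable M (\<lambda>\<omega>. (\<xi> k \<omega>)\<^sup>2)"
    and z: "\<And>k. AE \<omega> in M. real_cond_exp M (F k) (\<xi> k) \<omega> = 0"
  shows "square_mart_diff \<xi>"
  unfolding square_mart_diff_def
proof (intro allI conjI ballI impI assms)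
  fix k g assume g: "g \<in> borel_measurable (F k)" "integrable M (\<lambda>\<omega>. g \<omega> * \<xi> k \<omega>)"
  interpret sigma_finite_subalgebra M "F k" by (rule sigma_finite_subalgebra_F)
  have m: "\<xi> k \<in> borel_measurable M" by (rule measurable_M[OF assms(1)])
  have [measurable]: "g \<in> borel_measurable M" by (rule measurable_M[OF g(1)])
  have "expectation (\<lambda>\<omega>. g \<omega> * \<xi> k \<omega>) = expectation (\<lambda>\<omega>. g \<omega> * real_cond_exp M (F k) (\<xi> k) \<omega>)"
    using real_cond_exp_intg(2)[OF g(2) g(1) m] by simp
  also have "\<dots> = expectation (\<lambda>\<omega>. 0)"
    using z[of k] by (intro integral_cong_AE) auto
  finally show "expectation (\<lambda>\<omega>. g \<omega> * \<xi> k \<omega>) = 0" by simp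
qed

text \<open>Monotone convergence gives the sum of the series a finite expectation, hence a finite
  value almost surely.\<close>

lemma nonneg_series_AE_convergent:
  assumes t: "\<And>k. integrable M (t k)" and nn: "\<And>k. AE \<omega> in M. t k \<omega> \<ge> (0::real)"
    and B: "\<And>n. (\<Sum>k<n. expectation (t k)) \<le> B"
  shows "AE \<omega> in M. convergent (\<lambda>n. \<Sum>k<n. t k \<omega>)"
proof -
  have [measurable]: "t k \<in> borel_measurable M" for k using t by auto
  have e: "(\<integral>\<^sup>+\<omega>. ennreal (t k \<omega>) \<partial>M) = ennreal (expectation (t k))" for k
    using nn_integral_eq_integral[OF t nn] .
  have e0: "expectation (t k) \<ge> 0" for k by (rule integral_nonneg_AE[OF nn])
  have sm: "summable (\<lambda>k. expectation (t k))"
    using B e0 by (intro summableI_nonneg_bounded[where x=B]) auto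
  have "(\<integral>\<^sup>+\<omega>. (\<Sum>k. ennreal (t k \<omega>)) \<partial>M) = (\<Sum>k. ennreal (expectation (t k)))"
    by (simp add: nn_integral_suminf e)
  also have "\<dots> = ennreal (\<Sum>k. expectation (t k))"
    by (rule suminf_ennreal2[OF e0 sm])
  also have "\<dots> < \<infinity>" by simp
  finally have "(\<integral>\<^sup>+\<omega>. (\<Sum>k. ennreal (t k \<omega>)) \<partial>M) \<noteq> \<infinity>" by simp
  hence "AE \<omega> in M. (\<Sum>k. ennreal (t k \<omega>)) \<noteq> \<infinity>"
    by (intro nn_integral_noteq_infinite) auto
  moreover have "AE \<omega> in M. \<forall>k. t k \<omega> \<ge> 0" using nn by (simp add: AE_all_countable)
  ultimately show ?thesis
  proof eventually_elim
    case (elim \<omega>)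
    have "summable (\<lambda>k. t k \<omega>)"
      using elim by (intro summable_suminf_not_top) auto
    thus ?case by (simp add: summable_iff_convergent)
  qed
qed

text \<open>The conditional bound is required only where the weight is positive. This permits
  localization to the \<open>F k\<close>-event on which a random conditional moment stays below a
  fixed constant, and integrability of the product comes out as a conclusion.\<close>

lemma integral_mult_le_cond_bound:
  assumes w: "w \<in> borel_measurable (F k)" "\<And>\<omega>. w \<omega> \<ge> 0" "integrable M w"
    and z[measurable]: "z \<in> borel_measurable M" and z0: "\<And>\<omega>. z \<omega> \<ge> (0::real)" and c: "c \<ge> 0"
    and bd: "AE \<omega> in M. w \<omega> > 0 \<longrightarrow> nn_cond_exp M (F k) (\<lambda>\<omega>. ennreal (z \<omega>)) \<omega> \<le> ennreal c"
  shows "integrable M (\<lambda>\<omega>. w \<omega> * z \<omega>)" "expectation (\<lambda>\<omega>. w \<omega> * z \<omega>) \<le> c * expectation w"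
proof -
  interpret sigma_finite_subalgebra M "F k" by (rule sigma_finite_subalgebra_F)
  have [measurable]: "w \<in> borel_measurable M" by (rule measurable_M[OF w(1)])
  have wm: "(\<lambda>\<omega>. ennreal (w \<omega>)) \<in> borel_measurable (F k)" using w(1) by measurable
  have "(\<integral>\<^sup>+\<omega>. ennreal (w \<omega> * z \<omega>) \<partial>M) = (\<integral>\<^sup>+\<omega>. ennreal (w \<omega>) * ennreal (z \<omega>) \<partial>M)"
    using w(2) z0 by (simp add: ennreal_mult)
  also have "\<dots> = (\<integral>\<^sup>+\<omega>. ennreal (w \<omega>) * nn_cond_exp M (F k) (\<lambda>\<omega>. ennreal (z \<omega>)) \<omega> \<partial>M)"
    by (rule nn_cond_exp_intg[symmetric, OF wm]) simp
  also have "\<dots> \<le> (\<integral>\<^sup>+\<omega>. ennreal c * ennreal (w \<omega>) \<partial>M)"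
  proof (rule nn_integral_mono_AE, use bd in eventually_elim)
    case (elim \<omega>)
    show ?case
    proof (cases "w \<omega> > 0")
      case True
      thus ?thesis using elim by (subst mult.commute) (auto intro: mult_right_mono)
    next
      case False
      hence "w \<omega> = 0" using w(2)[of \<omega>] by simp
      thus ?thesis by simp
    qed
  qed
  also have "\<dots> = ennreal (c * expectation w)"
    using nn_integral_eq_integral[OF w(3)] w(2) c by (simp add: nn_integral_cmult ennreal_mult integral_nonneg)
  finally have le: "(\<integral>\<^sup>+\<omega>. ennreal (w \<omega> * z \<omega>) \<partial>M) \<le> ennreal (c * expectation w)" .
  show i: "integrable M (\<lambda>\<omega>. w \<omega> * z \<omega>)"
    using w(2) z0 le by (intro integrableI_nonneg) (auto intro: le_less_trans)
  have "ennreal (expectation (\<lambda>\<omega>. w \<omega> * z \<omega>)) \<le> ennreal (c * expectation w)"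
    using nn_integral_eq_integral[OF i] w(2) z0 le by simp
  thus "expectation (\<lambda>\<omega>. w \<omega> * z \<omega>) \<le> c * expectation w"
    using c w(2) by (simp add: ennreal_le_iff integral_nonneg)
qed

lemma integrable_of_bounded:
  assumes "f \<in> borel_measurable M" "\<And>\<omega>. \<bar>f \<omega>\<bar> \<le> (B::real)"
  shows "integrable M f"
  using assms by (intro integrable_const_bound[where B=B]) auto

end

subsection \<open>Weighted sums of the noise\<close>

locale mart_diff_noise = filtered_prob_space +
  fixes V :: "nat \<Rightarrow> 'a \<Rightarrow> real" and \<sigma> :: real
  assumes mart: "martingale_difference M F V" and \<sigma>: "\<sigma> > 0"
    and var: "\<And>n. AE \<omega> in M. nn_cond_exp M (F n) (\<lambda>\<omega>. ennreal ((V (Suc n) \<omega>)\<^sup>2)) \<omega> = ennreal (\<sigma>\<^sup>2)"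
begin

lemma V_measurable: "V (Suc k) \<in> borel_measurable (F (Suc k))"
  and V_integrable: "integrable M (V (Suc k))"
  and V_cond: "AE \<omega> in M. real_cond_exp M (F k) (V (Suc k)) \<omega> = 0"
  using mart unfolding martingale_difference_def by auto

lemma V_measurable_M[measurable]: "V (Suc k) \<in> borel_measurable M"
  by (rule measurable_M[OF V_measurable])

lemma V_square_bound:
  assumes "w \<in> borel_measurable (F k)" "\<And>\<omega>. w \<omega> \<ge> 0" "integrable M w"
  shows "integrable M (\<lambda>\<omega>. w \<omega> * (V (Suc k) \<omega>)\<^sup>2)"
    "expectation (\<lambda>\<omega>. w \<omega> * (V (Suc k) \<omega>)\<^sup>2) \<le> \<sigma>\<^sup>2 * expectation w"
proof -
  have bd: "AE \<omega> in M. w \<omega> > 0 \<longrightarrow> nn_cond_exp M (F k) (\<lambda>\<omega>. ennreal ((V (Suc k) \<omega>)\<^sup>2)) \<omega> \<le> ennreal (\<sigma>\<^sup>2)"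
    using var[of k] by eventually_elim simp
  show "integrable M (\<lambda>\<omega>. w \<omega> * (V (Suc k) \<omega>)\<^sup>2)"
    "expectation (\<lambda>\<omega>. w \<omega> * (V (Suc k) \<omega>)\<^sup>2) \<le> \<sigma>\<^sup>2 * expectation w"
    using integral_mult_le_cond_bound[OF assms _ _ _ bd] by auto
qed

lemma V_square_cond: "AE \<omega> in M. real_cond_exp M (F k) (\<lambda>\<omega>. (V (Suc k) \<omega>)\<^sup>2) \<omega> = \<sigma>\<^sup>2"
proof -
  interpret sigma_finite_subalgebra M "F k" by (rule sigma_finite_subalgebra_F)
  \<comment> \<open>The real conditional expectation is a difference of two nonnegative ones; the
    one belonging to the negative part of the square is that of 0.\<close>
  have z: "AE \<omega> in M. (0::ennreal) = nn_cond_exp M (F k) (\<lambda>_. 0) \<omega>"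
    by (rule nn_cond_exp_F_meas) simp
  have e: "(\<lambda>\<omega>. ennreal (- (V (Suc k) \<omega>)\<^sup>2)) = (\<lambda>_. 0)" by (simp add: ennreal_neg)
  show ?thesis using z var[of k] unfolding real_cond_exp_def e
    by eventually_elim (simp add: flip: zero_ennreal_def)
qed

text \<open>Division by one plus the running sum of squares makes the squared weights sum to at most
  1 on every path (the power sum bound with exponent 2). The variances are then summable without any
  moment condition on \<open>h\<close>, and Kronecker's lemma removes the normalization.\<close>

lemma martingale_transform_small_sums:
  assumes h: "\<And>k. h k \<in> borel_measurable (F k)"
  shows "AE \<omega> in M. small_sums (\<lambda>k. h k \<omega> * V (Suc k) \<omega>) (\<lambda>k. (h k \<omega>)\<^sup>2)"
proof -
  define G where "G k \<omega> = 1 + (\<Sum>j\<le>k. (h j \<omega>)\<^sup>2)" for k \<omega>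
  have Gm: "G k \<in> borel_measurable (F k)" for k
    unfolding G_def by (intro borel_measurable_add borel_measurable_const borel_measurable_sum
        borel_measurable_power measurable_F_mono[OF _ h]) auto
  have G1: "G k \<omega> \<ge> 1" for k \<omega> by (simp add: G_def sum_nonneg)
  have Gh: "1 + (h k \<omega>)\<^sup>2 \<le> G k \<omega>" for k \<omega>
    unfolding G_def by (intro add_left_mono member_le_sum) auto
  define w where "w k \<omega> = h k \<omega> / G k \<omega>" for k \<omega>
  have wm: "w k \<in> borel_measurable (F k)" for k unfolding w_def using h Gm by measurable
  note [measurable] = measurable_M[OF wm]
  have w2: "(w k \<omega>)\<^sup>2 = (h k \<omega>)\<^sup>2 * G k \<omega> powr (-2)" for k \<omega>
    using G1[of k \<omega>] by (simp add: w_def power_divide powr_minus_divide powr_numeral)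
  have wsum: "(\<Sum>k<n. (w k \<omega>)\<^sup>2) \<le> 1" for n \<omega>
    using sum_div_powr_partial_sums_le[of "\<lambda>k. (h k \<omega>)\<^sup>2" 2 n] by (simp add: w2 G_def)
  have w1: "(w k \<omega>)\<^sup>2 \<le> 1" for k \<omega>
    using wsum[of \<omega> "Suc k"] sum_nonneg[of "{..<k}" "\<lambda>k. (w k \<omega>)\<^sup>2"] by auto
  have wa: "\<bar>w k \<omega>\<bar> \<le> 1" for k \<omega> using w1[of k \<omega>] by (simp add: abs_square_le_1)
  have wi: "integrable M (\<lambda>\<omega>. (w k \<omega>)\<^sup>2)" for k
    using w1 by (intro integrable_of_bounded[where B=1]) auto
  define \<xi> where "\<xi> k \<omega> = w k \<omega> * V (Suc k) \<omega>" for k \<omega>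
  have sq: "(\<xi> k \<omega>)\<^sup>2 = (w k \<omega>)\<^sup>2 * (V (Suc k) \<omega>)\<^sup>2" for k \<omega> by (simp add: \<xi>_def power_mult_distrib)
  have ew: "(\<lambda>\<omega>. (w k \<omega>)\<^sup>2) \<in> borel_measurable (F k)" for k using wm by measurable
  note sb = V_square_bound[OF ew _ wi, folded sq, simplified]
  have \<xi>: "square_mart_diff \<xi>"
  proof (rule square_mart_diffI)
    fix k
    show "\<xi> k \<in> borel_measurable (F (Suc k))" unfolding \<xi>_def
      by (intro borel_measurable_times V_measurable measurable_F_mono[OF _ wm]) simp
    show "integrable M (\<lambda>\<omega>. (\<xi> k \<omega>)\<^sup>2)" by (rule sb)
    interpret sigma_finite_subalgebra M "F k" by (rule sigma_finite_subalgebra_F)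
    have "integrable M (\<lambda>\<omega>. w k \<omega> * V (Suc k) \<omega>)"
      using wa by (intro Bochner_Integration.integrable_bound[OF V_integrable[of k]])
        (auto simp: abs_mult intro!: mult_left_le_one_le)
    from real_cond_exp_mult[OF wm _ this] V_cond[of k]
    show "AE \<omega> in M. real_cond_exp M (F k) (\<xi> k) \<omega> = 0"
      unfolding \<xi>_def by (auto elim: eventually_elim2)
  qed
  have "(\<Sum>k<n. expectation (\<lambda>\<omega>. (\<xi> k \<omega>)\<^sup>2)) \<le> \<sigma>\<^sup>2" for n
  proof -
    have "(\<Sum>k<n. expectation (\<lambda>\<omega>. (\<xi> k \<omega>)\<^sup>2)) \<le> (\<Sum>k<n. \<sigma>\<^sup>2 * expectation (\<lambda>\<omega>. (w k \<omega>)\<^sup>2))"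
      by (intro sum_mono sb)
    also have "\<dots> = \<sigma>\<^sup>2 * expectation (\<lambda>\<omega>. \<Sum>k<n. (w k \<omega>)\<^sup>2)"
      using wi by (simp add: sum_distrib_left)
    also have "\<dots> \<le> \<sigma>\<^sup>2 * expectation (\<lambda>\<omega>. 1)"
      using wi wsum by (intro mult_left_mono integral_mono) auto
    finally show ?thesis by (simp add: prob_space)
  qed
  from square_mart_diff_convergent[OF \<xi> this]
  show ?thesis
  proof eventually_elim
    case (elim \<omega>)
    thus ?case by (intro kronecker_small_sums) (auto simp: \<xi>_def w_def G_def)
  qed
qed

definition cond_moment :: "real \<Rightarrow> nat \<Rightarrow> 'a \<Rightarrow> ennreal" where
  "cond_moment a k = nn_cond_exp M (F k) (\<lambda>\<omega>. ennreal (\<bar>V (Suc k) \<omega>\<bar> powr a))"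

lemma cond_moment_measurable[measurable]: "cond_moment a k \<in> borel_measurable (F k)"
  unfolding cond_moment_def by simp

lemma moment_bound:
  assumes "w \<in> borel_measurable (F k)" "\<And>\<omega>. w \<omega> \<ge> 0" "integrable M w" "c \<ge> 0"
    and "\<And>\<omega>. w \<omega> > 0 \<Longrightarrow> cond_moment a k \<omega> \<le> ennreal c"
  shows "integrable M (\<lambda>\<omega>. w \<omega> * \<bar>V (Suc k) \<omega>\<bar> powr a)"
    "expectation (\<lambda>\<omega>. w \<omega> * \<bar>V (Suc k) \<omega>\<bar> powr a) \<le> c * expectation w"
proof -
  have bd: "AE \<omega> in M. w \<omega> > 0 \<longrightarrow> nn_cond_exp M (F k) (\<lambda>\<omega>. ennreal (\<bar>V (Suc k) \<omega>\<bar> powr a)) \<omega> \<le> ennreal c"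
    using assms(5) unfolding cond_moment_def by simp
  show "integrable M (\<lambda>\<omega>. w \<omega> * \<bar>V (Suc k) \<omega>\<bar> powr a)"
    "expectation (\<lambda>\<omega>. w \<omega> * \<bar>V (Suc k) \<omega>\<bar> powr a) \<le> c * expectation w"
    using integral_mult_le_cond_bound[OF assms(1-3) _ _ assms(4) bd] by auto
qed

text \<open>An integer bound makes the possible values countable, so that each of them can be
  treated on its own and the null sets united.\<close>

lemma AE_uniform_moment:
  assumes "AE \<omega> in M. (SUP n. nn_cond_exp M (F n) (\<lambda>\<omega>. ennreal (\<bar>V (Suc n) \<omega>\<bar> powr a)) \<omega>) < \<infinity>"
  shows "AE \<omega> in M. \<exists>K::nat. \<forall>n. cond_moment a n \<omega> \<le> ennreal (real K)"
  using assms
proof eventually_elim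
  case (elim \<omega>)
  then obtain K :: nat where "(SUP n. cond_moment a n \<omega>) < of_nat K"
    unfolding cond_moment_def infinity_ennreal_def using ennreal_Ex_less_of_nat by blast
  hence "(SUP n. cond_moment a n \<omega>) \<le> of_nat K" by simp
  thus ?case by (auto simp: SUP_le_iff ennreal_of_nat_eq_real_of_nat)
qed

end

context mart_diff_noise
begin

text \<open>Centering decreases the second moment because the conditional expectation is an
  orthogonal projection.\<close>

lemma centered_square_mart_diff:
  assumes Z: "\<And>k. Z k \<in> borel_measurable (F (Suc k))" and Z01: "\<And>k \<omega>. 0 \<le> Z k \<omega> \<and> Z k \<omega> \<le> (1::real)"
  defines "\<xi> \<equiv> (\<lambda>k \<omega>. Z k \<omega> - real_cond_exp M (F k) (Z k) \<omega>)"
  shows "square_mart_diff \<xi>" "expectation (\<lambda>\<omega>. (\<xi> k \<omega>)\<^sup>2) \<le> expectation (\<lambda>\<omega>. (Z k \<omega>)\<^sup>2)"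
proof -
  note [measurable] = measurable_M[OF Z]
  have Zi: "integrable M (Z k)" for k
    by (rule integrable_of_bounded[where B=1]) (use Z01 in \<open>auto simp: abs_le_iff intro: order_trans[of _ 0]\<close>)
  define Y where "Y k = real_cond_exp M (F k) (Z k)" for k
  have Ym: "Y k \<in> borel_measurable (F k)" for k by (simp add: Y_def)
  note [measurable] = measurable_M[OF Ym]
  have Y01: "AE \<omega> in M. 0 \<le> Y k \<omega> \<and> Y k \<omega> \<le> 1" for k
  proof -
    interpret sigma_finite_subalgebra M "F k" by (rule sigma_finite_subalgebra_F)
    show ?thesis unfolding Y_def
      using real_cond_exp_ge_c[OF Zi[of k], of 0] real_cond_exp_le_c[OF Zi[of k], of 1] Z01
      by (auto elim: eventually_elim2)
  qed
  have bd: "AE \<omega> in M. norm ((\<xi> k \<omega>)\<^sup>2) \<le> 1" for k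
    using Y01[of k]
  proof eventually_elim
    case (elim \<omega>)
    hence "\<bar>\<xi> k \<omega>\<bar> \<le> 1" using Z01[of k \<omega>] by (simp add: \<xi>_def Y_def abs_le_iff)
    thus ?case by (simp add: abs_square_le_1)
  qed
  have \<xi>m: "\<xi> k \<in> borel_measurable (F (Suc k))" for k
    unfolding \<xi>_def Y_def[symmetric]
    by (intro borel_measurable_diff Z measurable_F_mono[OF _ Ym]) simp
  note [measurable] = measurable_M[OF \<xi>m]
  have \<xi>i: "integrable M (\<lambda>\<omega>. (\<xi> k \<omega>)\<^sup>2)" for k
    by (rule integrable_const_bound[OF bd]) simp
  show "square_mart_diff \<xi>"
  proof (rule square_mart_diffI[OF \<xi>m \<xi>i])
    fix k
    interpret sigma_finite_subalgebra M "F k" by (rule sigma_finite_subalgebra_F)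
    have Yi: "integrable M (Y k)" unfolding Y_def by (rule real_cond_exp_int(1)[OF Zi])
    have "AE \<omega> in M. real_cond_exp M (F k) (Y k) \<omega> = Y k \<omega>"
      by (rule real_cond_exp_F_meas[OF Yi Ym])
    with real_cond_exp_diff[OF Zi[of k] Yi]
    show "AE \<omega> in M. real_cond_exp M (F k) (\<xi> k) \<omega> = 0"
      unfolding \<xi>_def Y_def[symmetric]
      by eventually_elim (simp add: Y_def)
  qed
  interpret sigma_finite_subalgebra M "F k" by (rule sigma_finite_subalgebra_F)
  have YZ: "integrable M (\<lambda>\<omega>. Y k \<omega> * Z k \<omega>)"
    by (rule integrable_const_bound[where B=1], use Y01[of k] in eventually_elim)
       (use Z01 in \<open>auto simp: abs_mult intro: mult_le_one\<close>)
  have YY: "integrable M (\<lambda>\<omega>. Y k \<omega> * Y k \<omega>)"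
    by (rule integrable_const_bound[where B=1], use Y01[of k] in eventually_elim)
       (auto simp: abs_mult intro: mult_le_one)
  have Z2: "integrable M (\<lambda>\<omega>. (Z k \<omega>)\<^sup>2)"
    by (rule integrable_of_bounded[where B=1]) (use Z01 in \<open>auto simp: power_le_one\<close>)
  have "expectation (\<lambda>\<omega>. Y k \<omega> * Y k \<omega>) = expectation (\<lambda>\<omega>. Y k \<omega> * Z k \<omega>)"
    using real_cond_exp_intg(2)[OF YZ Ym] by (simp add: Y_def)
  moreover have "(\<xi> k \<omega>)\<^sup>2 = (Z k \<omega>)\<^sup>2 - 2 * (Y k \<omega> * Z k \<omega>) + Y k \<omega> * Y k \<omega>" for \<omega>
    by (simp add: \<xi>_def Y_def power2_eq_square algebra_simps)
  ultimately have "expectation (\<lambda>\<omega>. (\<xi> k \<omega>)\<^sup>2)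
      = expectation (\<lambda>\<omega>. (Z k \<omega>)\<^sup>2) - expectation (\<lambda>\<omega>. Y k \<omega> * Y k \<omega>)"
    using YZ YY Z2 by simp
  thus "expectation (\<lambda>\<omega>. (\<xi> k \<omega>)\<^sup>2) \<le> expectation (\<lambda>\<omega>. (Z k \<omega>)\<^sup>2)"
    by (simp add: integral_nonneg)
qed

text \<open>Only moments of order slightly above two are available, so \<open>V\<^sup>2\<close> is truncated at the
  level of the normalization before the second moment method is applied.\<close>

lemma weighted_squares_bounded_moment:
  assumes f: "\<And>k. f k \<in> borel_measurable (F k)" and f01: "\<And>k \<omega>. 0 \<le> f k \<omega> \<and> f k \<omega> \<le> 1"
    and a: "a > 2" and fK: "\<And>k \<omega>. f k \<omega> > 0 \<Longrightarrow> cond_moment a k \<omega> \<le> ennreal (real K)"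
  shows "AE \<omega> in M. small_sums (\<lambda>k. f k \<omega> * ((V (Suc k) \<omega>)\<^sup>2 - \<sigma>\<^sup>2)) (\<lambda>k. f k \<omega>)"
proof -
  define H where "H k \<omega> = 1 + (\<Sum>j\<le>k. f j \<omega>)" for k \<omega>
  have Hm: "H k \<in> borel_measurable (F k)" for k
    unfolding H_def by (intro borel_measurable_add borel_measurable_const borel_measurable_sum
        measurable_F_mono[OF _ f]) auto
  have H1: "H k \<omega> \<ge> 1" for k \<omega> using f01 by (simp add: H_def sum_nonneg)
  \<comment> \<open>The exponent must exceed 1 for the weights to be summable, must not exceed 2 for
    the truncated part, and \<open>2 * q\<close> must stay within the available moment
    \<open>a\<close>.\<close>
  define q where "q = min a 4 / 2"
  have q: "q > 1" "q \<le> 2" "2 * q \<le> a" using a by (auto simp: q_def min_def)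
  define r where "r k \<omega> = f k \<omega> / H k \<omega>" for k \<omega>
  have rm: "r k \<in> borel_measurable (F k)" for k unfolding r_def using f Hm by measurable
  define v where "v k \<omega> = (V (Suc k) \<omega>)\<^sup>2" for k \<omega>
  have vm: "v k \<in> borel_measurable (F (Suc k))" for k unfolding v_def using V_measurable by measurable
  define Z where "Z k \<omega> = (if v k \<omega> \<le> H k \<omega> then r k \<omega> * v k \<omega> else 0)" for k \<omega>
  define B where "B k \<omega> = (if v k \<omega> \<le> H k \<omega> then 0 else r k \<omega> * v k \<omega>)" for k \<omega>
  note up = measurable_F_mono[OF le_SucI[OF order_refl]]
  have Zm: "Z k \<in> borel_measurable (F (Suc k))" for k
    unfolding Z_def using vm[of k] up[OF rm[of k]] up[OF Hm[of k]] by measurable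
  have Bm: "B k \<in> borel_measurable (F (Suc k))" for k
    unfolding B_def using vm[of k] up[OF rm[of k]] up[OF Hm[of k]] by measurable
  note [measurable] = measurable_M[OF Zm] measurable_M[OF Bm] measurable_M[OF rm] measurable_M[OF vm]
  \<comment> \<open>A common majorant: it dominates the discarded part \<open>B\<close> itself as
    well as the square of the truncated part \<open>Z\<close>. Its expectation is at most
    \<open>1 + real K\<close> times that of \<open>f k\<close> times \<open>H k\<close> to the power
    -q, which is summable.\<close>
  define t where "t k \<omega> = f k \<omega> * H k \<omega> powr (-q) * v k \<omega> powr q" for k \<omega>
  have v0: "v k \<omega> \<ge> 0" for k \<omega> by (simp add: v_def)
  have r0: "r k \<omega> \<ge> 0" for k \<omega> using f01[of k \<omega>] H1[of k \<omega>] by (simp add: r_def)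
  have r1: "r k \<omega> \<le> 1" for k \<omega> using f01[of k \<omega>] H1[of k \<omega>] by (simp add: r_def divide_le_eq)
  have Z01: "0 \<le> Z k \<omega> \<and> Z k \<omega> \<le> 1" for k \<omega>
  proof -
    have "f k \<omega> * v k \<omega> \<le> 1 * H k \<omega>" if "v k \<omega> \<le> H k \<omega>"
      using that f01[of k \<omega>] v0[of k \<omega>] by (intro mult_mono) auto
    moreover have "0 \<le> r k \<omega> * v k \<omega>" using r0 v0 by simp
    ultimately show ?thesis using H1[of k \<omega>] by (auto simp: Z_def r_def divide_le_eq)
  qed
  have Bt: "0 \<le> B k \<omega> \<and> B k \<omega> \<le> t k \<omega>" for k \<omega>
  proof (cases "v k \<omega> \<le> H k \<omega>")
    case True
    thus ?thesis using f01[of k \<omega>] by (simp add: B_def t_def)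
  next
    case False
    have h: "H k \<omega> > 0" using H1[of k \<omega>] by simp
    have "v k \<omega> * H k \<omega> powr (q - 1) \<le> v k \<omega> * v k \<omega> powr (q - 1)"
      using False q h by (intro mult_left_mono powr_mono2) (auto simp: v_def)
    also have "\<dots> = v k \<omega> powr q" using False h by (simp add: powr_mult_base)
    finally have "f k \<omega> * H k \<omega> powr (-q) * (v k \<omega> * H k \<omega> powr (q - 1)) \<le> t k \<omega>"
      unfolding t_def using f01[of k \<omega>] by (intro mult_left_mono) auto
    moreover have "f k \<omega> * H k \<omega> powr (-q) * (v k \<omega> * H k \<omega> powr (q - 1))
        = f k \<omega> * v k \<omega> * (H k \<omega> powr (-q) * H k \<omega> powr (q - 1))" by simp
    moreover have "H k \<omega> powr (-q) * H k \<omega> powr (q - 1) = 1 / H k \<omega>"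
      using h by (simp only: powr_add[symmetric]) (simp add: powr_minus_divide)
    moreover have "0 \<le> r k \<omega> * v k \<omega>" using r0 v0 by simp
    ultimately show ?thesis using False by (simp add: B_def r_def)
  qed
  have Zt: "(Z k \<omega>)\<^sup>2 \<le> t k \<omega>" for k \<omega>
  proof (cases "v k \<omega> \<le> H k \<omega> \<and> v k \<omega> > 0")
    case False
    hence "Z k \<omega> = 0" using v0[of k \<omega>] by (auto simp: Z_def)
    thus ?thesis using f01[of k \<omega>] by (simp add: t_def)
  next
    case True
    have h: "H k \<omega> > 0" using H1[of k \<omega>] by simp
    have "(v k \<omega>)\<^sup>2 = v k \<omega> powr q * v k \<omega> powr (2 - q)"
      using True by (simp only: powr_add[symmetric]) (simp add: powr_numeral)
    also have "\<dots> \<le> v k \<omega> powr q * H k \<omega> powr (2 - q)"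
      using True q by (intro mult_left_mono powr_mono2) auto
    finally have 1: "(v k \<omega>)\<^sup>2 \<le> v k \<omega> powr q * H k \<omega> powr (2 - q)" .
    have "(Z k \<omega>)\<^sup>2 = (f k \<omega>)\<^sup>2 * H k \<omega> powr (-2) * (v k \<omega>)\<^sup>2"
      using True h by (simp add: Z_def r_def power_mult_distrib power_divide powr_minus_divide powr_numeral)
    also have "\<dots> \<le> f k \<omega> * H k \<omega> powr (-2) * (v k \<omega> powr q * H k \<omega> powr (2 - q))"
      using 1 f01[of k \<omega>] by (intro mult_mono) (auto simp: power2_eq_square intro: mult_left_le_one_le)
    also have "\<dots> = f k \<omega> * v k \<omega> powr q * (H k \<omega> powr (-2) * H k \<omega> powr (2 - q))" by simp
    also have "H k \<omega> powr (-2) * H k \<omega> powr (2 - q) = H k \<omega> powr (-q)"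
      by (simp only: powr_add[symmetric]) simp
    finally show ?thesis by (simp add: t_def ac_simps)
  qed
  define u where "u k \<omega> = f k \<omega> * H k \<omega> powr (-q)" for k \<omega>
  have um: "u k \<in> borel_measurable (F k)" for k unfolding u_def using f Hm by measurable
  note [measurable] = measurable_M[OF um]
  have u0: "u k \<omega> \<ge> 0" for k \<omega> using f01[of k \<omega>] by (simp add: u_def)
  have u1: "u k \<omega> \<le> 1" for k \<omega>
  proof -
    have "H k \<omega> powr (-q) \<le> 1" using H1[of k \<omega>] q powr_mono[of "-q" 0 "H k \<omega>"] by simp
    thus ?thesis using f01[of k \<omega>] by (auto simp: u_def intro: mult_le_one)
  qed
  have ui: "integrable M (u k)" for k
    by (rule integrable_of_bounded[where B=1]) (use u0 u1 in \<open>auto simp: abs_le_iff intro: order_trans[of _ 0]\<close>)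
  have uK: "cond_moment a k \<omega> \<le> ennreal (real K)" if "u k \<omega> > 0" for k \<omega>
    using that f01[of k \<omega>] fK[of k \<omega>] by (cases "f k \<omega> = 0") (auto simp: u_def)
  note mb = moment_bound[OF um u0 ui _ uK, simplified]
  have tle: "t k \<omega> \<le> u k \<omega> + u k \<omega> * \<bar>V (Suc k) \<omega>\<bar> powr a" for k \<omega>
  proof -
    have "v k \<omega> powr q = \<bar>V (Suc k) \<omega>\<bar> powr (2 * q)"
      by (cases "V (Suc k) \<omega> = 0") (simp_all add: v_def powr_powr[symmetric] powr_numeral)
    also have "\<dots> \<le> 1 + \<bar>V (Suc k) \<omega>\<bar> powr a"
    proof (cases "\<bar>V (Suc k) \<omega>\<bar> \<le> 1")
      case True
      have "\<bar>V (Suc k) \<omega>\<bar> powr (2 * q) \<le> 1" using True q by (intro powr_le1) auto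
      thus ?thesis by (simp add: add_increasing2)
    next
      case False
      hence "\<bar>V (Suc k) \<omega>\<bar> powr (2 * q) \<le> \<bar>V (Suc k) \<omega>\<bar> powr a" using q by (intro powr_mono) auto
      thus ?thesis by simp
    qed
    finally have "u k \<omega> * v k \<omega> powr q \<le> u k \<omega> * (1 + \<bar>V (Suc k) \<omega>\<bar> powr a)"
      using u0 by (intro mult_left_mono)
    thus ?thesis by (simp add: t_def u_def algebra_simps)
  qed
  have t0: "t k \<omega> \<ge> 0" for k \<omega> using f01[of k \<omega>] by (simp add: t_def)
  have tm: "t k \<in> borel_measurable M" for k
    using measurable_M[OF f[of k]] measurable_M[OF Hm[of k]] unfolding t_def by measurable
  have ti: "integrable M (t k)" for k
    by (rule Bochner_Integration.integrable_bound[OF Bochner_Integration.integrable_add[OF ui[of k] mb(1)[of k]] tm])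
      (use tle t0 u0 in auto)
  have te: "expectation (t k) \<le> (1 + real K) * expectation (u k)" for k
  proof -
    have "expectation (t k) \<le> expectation (\<lambda>\<omega>. u k \<omega> + u k \<omega> * \<bar>V (Suc k) \<omega>\<bar> powr a)"
      by (intro integral_mono ti Bochner_Integration.integrable_add ui mb(1) tle)
    also have "\<dots> = expectation (u k) + expectation (\<lambda>\<omega>. u k \<omega> * \<bar>V (Suc k) \<omega>\<bar> powr a)"
      by (intro Bochner_Integration.integral_add ui mb(1))
    finally show ?thesis using mb(2)[of k] by (simp add: algebra_simps)
  qed
  define D where "D = (1 + real K) * (1 / (q - 1))"
  have tsum: "(\<Sum>k<n. expectation (t k)) \<le> D" for n
  proof -
    have "(\<Sum>k<n. expectation (t k)) \<le> (\<Sum>k<n. (1 + real K) * expectation (u k))"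
      by (intro sum_mono te)
    also have "\<dots> = (1 + real K) * expectation (\<lambda>\<omega>. \<Sum>k<n. u k \<omega>)"
      using ui by (simp add: sum_distrib_left)
    also have "\<dots> \<le> (1 + real K) * expectation (\<lambda>\<omega>. 1 / (q - 1))"
    proof (intro mult_left_mono integral_mono Bochner_Integration.integrable_sum ui)
      fix \<omega> show "(\<Sum>k<n. u k \<omega>) \<le> 1 / (q - 1)"
        using sum_div_powr_partial_sums_le[of "\<lambda>k. f k \<omega>" q n] f01 q by (simp add: u_def H_def)
    qed auto
    finally show ?thesis by (simp add: D_def prob_space)
  qed
  have Bi: "integrable M (B k)" for k
    by (rule Bochner_Integration.integrable_bound[OF ti]) (use Bt t0 in auto)
  have Bconv: "AE \<omega> in M. convergent (\<lambda>n. \<Sum>k<n. B k \<omega>)"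
  proof (rule nonneg_series_AE_convergent[OF Bi])
    fix n have "(\<Sum>k<n. expectation (B k)) \<le> (\<Sum>k<n. expectation (t k))"
      using Bt by (intro sum_mono integral_mono Bi ti) auto
    thus "(\<Sum>k<n. expectation (B k)) \<le> D" using tsum order_trans by blast
  qed (use Bt in auto)
  have Cconv: "AE \<omega> in M. convergent (\<lambda>n. \<Sum>k<n. real_cond_exp M (F k) (B k) \<omega>)"
  proof (rule nonneg_series_AE_convergent)
    fix k
    interpret sigma_finite_subalgebra M "F k" by (rule sigma_finite_subalgebra_F)
    show "integrable M (real_cond_exp M (F k) (B k))" by (rule real_cond_exp_int(1)[OF Bi])
    show "AE \<omega> in M. 0 \<le> real_cond_exp M (F k) (B k) \<omega>"
      using Bt by (intro real_cond_exp_pos) auto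
  next
    fix n
    have "expectation (real_cond_exp M (F k) (B k)) = expectation (B k)" for k
    proof -
      interpret sigma_finite_subalgebra M "F k" by (rule sigma_finite_subalgebra_F)
      show ?thesis by (rule real_cond_exp_int(2)[OF Bi])
    qed
    moreover have "(\<Sum>k<n. expectation (B k)) \<le> (\<Sum>k<n. expectation (t k))"
      using Bt by (intro sum_mono integral_mono Bi ti) auto
    ultimately show "(\<Sum>k<n. expectation (real_cond_exp M (F k) (B k))) \<le> D"
      using tsum[of n] by simp
  qed
  note cs = centered_square_mart_diff[OF Zm Z01]
  have Zi2: "integrable M (\<lambda>\<omega>. (Z k \<omega>)\<^sup>2)" for k
    by (rule integrable_of_bounded[where B=1]) (use Z01 in \<open>auto simp: power_le_one\<close>)
  have Zi: "integrable M (Z k)" for k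
    by (rule integrable_of_bounded[where B=1]) (use Z01 in \<open>auto simp: abs_le_iff intro: order_trans[of _ 0]\<close>)
  have Zconv: "AE \<omega> in M. convergent (\<lambda>n. \<Sum>k<n. Z k \<omega> - real_cond_exp M (F k) (Z k) \<omega>)"
  proof (rule square_mart_diff_convergent[OF cs(1)])
    fix n
    have "(\<Sum>k<n. expectation (\<lambda>\<omega>. (Z k \<omega> - real_cond_exp M (F k) (Z k) \<omega>)\<^sup>2))
       \<le> (\<Sum>k<n. expectation (t k))"
      by (intro sum_mono order_trans[OF cs(2) integral_mono] Zi2 ti Zt)
    thus "(\<Sum>k<n. expectation (\<lambda>\<omega>. (Z k \<omega> - real_cond_exp M (F k) (Z k) \<omega>)\<^sup>2)) \<le> D"
      using tsum order_trans by blast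
  qed
  \<comment> \<open>The compensators of the two parts add up to
    \<open>r k \<omega> * \<sigma>\<^sup>2\<close>. Hence the normalized series splits into the
    centered truncated part, the discarded part, and minus the compensator of the latter, each of
    which converges.\<close>
  have comp: "AE \<omega> in M. real_cond_exp M (F k) (Z k) \<omega> + real_cond_exp M (F k) (B k) \<omega> = r k \<omega> * \<sigma>\<^sup>2" for k
  proof -
    interpret sigma_finite_subalgebra M "F k" by (rule sigma_finite_subalgebra_F)
    have e: "(\<lambda>\<omega>. Z k \<omega> + B k \<omega>) = (\<lambda>\<omega>. r k \<omega> * v k \<omega>)" by (auto simp: Z_def B_def)
    have "integrable M (\<lambda>\<omega>. r k \<omega> * v k \<omega>)"
      unfolding e[symmetric] by (intro Bochner_Integration.integrable_add Zi Bi)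
    from real_cond_exp_mult[OF rm _ this]
    have "AE \<omega> in M. real_cond_exp M (F k) (\<lambda>\<omega>. r k \<omega> * v k \<omega>) \<omega> = r k \<omega> * real_cond_exp M (F k) (v k) \<omega>"
      by simp
    with real_cond_exp_add[OF Zi[of k] Bi[of k]] V_square_cond[of k, folded v_def]
    show ?thesis unfolding e by eventually_elim simp
  qed
  have "AE \<omega> in M. \<forall>k. real_cond_exp M (F k) (Z k) \<omega> + real_cond_exp M (F k) (B k) \<omega> = r k \<omega> * \<sigma>\<^sup>2"
    using comp by (simp add: AE_all_countable)
  with Bconv Cconv Zconv show ?thesis
  proof eventually_elim
    case (elim \<omega>)
    have "convergent (\<lambda>n. (\<Sum>k<n. Z k \<omega> - real_cond_exp M (F k) (Z k) \<omega>) + (\<Sum>k<n. B k \<omega>)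
        - (\<Sum>k<n. real_cond_exp M (F k) (B k) \<omega>))"
      by (intro convergent_diff convergent_add elim)
    also have "(\<lambda>n. (\<Sum>k<n. Z k \<omega> - real_cond_exp M (F k) (Z k) \<omega>) + (\<Sum>k<n. B k \<omega>)
        - (\<Sum>k<n. real_cond_exp M (F k) (B k) \<omega>))
      = (\<lambda>n. \<Sum>k<n. Z k \<omega> + B k \<omega> - (real_cond_exp M (F k) (Z k) \<omega> + real_cond_exp M (F k) (B k) \<omega>))"
      by (simp add: sum.distrib sum_subtractf algebra_simps)
    also have "\<dots> = (\<lambda>n. \<Sum>k<n. f k \<omega> * ((V (Suc k) \<omega>)\<^sup>2 - \<sigma>\<^sup>2) / (1 + (\<Sum>j\<le>k. f j \<omega>)))"
      using elim(4) by (auto simp: fun_eq_iff Z_def B_def r_def v_def H_def diff_divide_distrib algebra_simps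
          intro!: sum.cong)
    finally show ?case using f01 by (intro kronecker_small_sums) auto
  qed
qed

text \<open>Localization: the weight is switched off where the conditional moment exceeds K. This is
  a predictable change, and almost every path has some K for which it changes nothing.\<close>

lemma weighted_squares_small_sums:
  assumes mom: "finite_cond_moment_gt M F V 2"
    and f: "\<And>k. f k \<in> borel_measurable (F k)" and f01: "\<And>k \<omega>. 0 \<le> f k \<omega> \<and> f k \<omega> \<le> 1"
  shows "AE \<omega> in M. small_sums (\<lambda>k. f k \<omega> * ((V (Suc k) \<omega>)\<^sup>2 - \<sigma>\<^sup>2)) (\<lambda>k. f k \<omega>)"
proof -
  obtain a where a: "a > 2" and
    am: "AE \<omega> in M. (SUP n. nn_cond_exp M (F n) (\<lambda>\<omega>. ennreal (\<bar>V (Suc n) \<omega>\<bar> powr a)) \<omega>) < \<infinity>"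
    using mom unfolding finite_cond_moment_gt_def by blast
  define g where "g K k \<omega> = (if cond_moment a k \<omega> \<le> ennreal (real K) then f k \<omega> else 0)" for K :: nat and k \<omega>
  have gm: "g K k \<in> borel_measurable (F k)" for K k unfolding g_def using f by measurable
  have "AE \<omega> in M. \<forall>K. small_sums (\<lambda>k. g K k \<omega> * ((V (Suc k) \<omega>)\<^sup>2 - \<sigma>\<^sup>2)) (\<lambda>k. g K k \<omega>)"
    unfolding AE_all_countable
    by (intro allI weighted_squares_bounded_moment[OF gm _ a]) (use f01 in \<open>auto simp: g_def split: if_splits\<close>)
  with AE_uniform_moment[OF am] show ?thesis
  proof eventually_elim
    case (elim \<omega>)
    then obtain K where "\<And>n. cond_moment a n \<omega> \<le> ennreal (real K)" by blast
    hence "g K k \<omega> = f k \<omega>" for k by (simp add: g_def)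
    thus ?case using elim(2)[rule_format, of K] by simp
  qed
qed

text \<open>For b strictly between c and the available order a, the series of |V|^a over the index
  to the power a/b has a convergent sum of conditional means. It therefore converges, its terms are
  bounded, and taking the power 2/a gives the rate. Having b strictly above c later makes the
  exponent strictly smaller than 2/c.\<close>

lemma noise_growth:
  assumes mom: "finite_cond_moment_gt M F V c" and c: "c > 0"
  shows "\<exists>b>c. AE \<omega> in M. \<exists>C. \<forall>k. (V (Suc k) \<omega>)\<^sup>2 \<le> C * (real (Suc k)) powr (2 / b)"
proof -
  obtain a where a: "a > c" and
    am: "AE \<omega> in M. (SUP n. nn_cond_exp M (F n) (\<lambda>\<omega>. ennreal (\<bar>V (Suc n) \<omega>\<bar> powr a)) \<omega>) < \<infinity>"
    using mom unfolding finite_cond_moment_gt_def by blast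
  define b where "b = (a + c) / 2"
  have b: "b > c" "b < a" "b > 0" using a c by (auto simp: b_def)
  have ab: "a / b > 1" using b by simp
  define w where "w K k \<omega> = (if cond_moment a k \<omega> \<le> ennreal (real K) then real (Suc k) powr (-(a/b)) else 0)"
    for K :: nat and k \<omega>
  have wm: "w K k \<in> borel_measurable (F k)" for K k unfolding w_def by measurable
  have w0: "w K k \<omega> \<ge> 0" for K k \<omega> by (simp add: w_def)
  have wi: "integrable M (w K k)" for K k
    by (rule integrable_of_bounded[where B="real (Suc k) powr (-(a/b))"]) (auto simp: w_def intro: measurable_M[OF wm])
  have wK: "cond_moment a k \<omega> \<le> ennreal (real K)" if "w K k \<omega> > 0" for K k \<omega>
    using that by (auto simp: w_def split: if_splits)
  note mb = moment_bound[OF wm w0 wi _ wK]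
  have sm: "summable (\<lambda>k. real (Suc k) powr (-(a/b)))"
    using ab summable_real_powr_iff[of "-(a/b)"] by (subst summable_Suc_iff) auto
  have "AE \<omega> in M. \<forall>K. convergent (\<lambda>n. \<Sum>k<n. w K k \<omega> * \<bar>V (Suc k) \<omega>\<bar> powr a)"
    unfolding AE_all_countable
  proof (intro allI nonneg_series_AE_convergent)
    fix K k show "integrable M (\<lambda>\<omega>. w K k \<omega> * \<bar>V (Suc k) \<omega>\<bar> powr a)" by (rule mb) auto
    show "AE \<omega> in M. 0 \<le> w K k \<omega> * \<bar>V (Suc k) \<omega>\<bar> powr a" using w0 by auto
  next
    fix K n
    have "(\<Sum>k<n. expectation (\<lambda>\<omega>. w K k \<omega> * \<bar>V (Suc k) \<omega>\<bar> powr a))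
        \<le> (\<Sum>k<n. real K * real (Suc k) powr (-(a/b)))"
    proof (intro sum_mono)
      fix k
      have "expectation (\<lambda>\<omega>. w K k \<omega> * \<bar>V (Suc k) \<omega>\<bar> powr a) \<le> real K * expectation (w K k)"
        by (rule mb) auto
      also have "\<dots> \<le> real K * expectation (\<lambda>\<omega>. real (Suc k) powr (-(a/b)))"
        using wi by (intro mult_left_mono integral_mono) (auto simp: w_def)
      finally show "expectation (\<lambda>\<omega>. w K k \<omega> * \<bar>V (Suc k) \<omega>\<bar> powr a) \<le> real K * real (Suc k) powr (-(a/b))"
        by (simp add: prob_space)
    qed
    also have "\<dots> = real K * (\<Sum>k<n. real (Suc k) powr (-(a/b)))" by (simp add: sum_distrib_left)
    also have "\<dots> \<le> real K * (\<Sum>k. real (Suc k) powr (-(a/b)))"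
      using sm by (intro mult_left_mono sum_le_suminf) auto
    finally show "(\<Sum>k<n. expectation (\<lambda>\<omega>. w K k \<omega> * \<bar>V (Suc k) \<omega>\<bar> powr a))
      \<le> real K * (\<Sum>k. real (Suc k) powr (-(a/b)))" .
  qed
  with AE_uniform_moment[OF am]
  have "AE \<omega> in M. \<exists>C. \<forall>k. (V (Suc k) \<omega>)\<^sup>2 \<le> C * (real (Suc k)) powr (2 / b)"
  proof eventually_elim
    case (elim \<omega>)
    then obtain K where K: "\<And>n. cond_moment a n \<omega> \<le> ennreal (real K)" by blast
    define t where "t k = real (Suc k) powr (-(a/b)) * \<bar>V (Suc k) \<omega>\<bar> powr a" for k
    have t: "w K k \<omega> * \<bar>V (Suc k) \<omega>\<bar> powr a = t k" for k using K by (simp add: w_def t_def)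
    have "summable t" using elim(2) unfolding t[symmetric] summable_iff_convergent by blast
    hence "Bseq t" using summable_LIMSEQ_zero convergentI convergent_imp_Bseq by blast
    then obtain C where C: "C > 0" "\<And>k. \<bar>t k\<bar> \<le> C" unfolding Bseq_def by auto
    have "(V (Suc k) \<omega>)\<^sup>2 \<le> C powr (2/a) * real (Suc k) powr (2 / b)" for k
    proof -
      have "t k = \<bar>V (Suc k) \<omega>\<bar> powr a / real (Suc k) powr (a/b)"
        by (simp only: t_def powr_minus_divide) simp
      hence "\<bar>V (Suc k) \<omega>\<bar> powr a / real (Suc k) powr (a/b) \<le> C"
        using C(2)[of k] by simp
      hence "\<bar>V (Suc k) \<omega>\<bar> powr a \<le> C * real (Suc k) powr (a/b)"
        by (simp add: divide_le_eq)
      hence "(\<bar>V (Suc k) \<omega>\<bar> powr a) powr (2/a) \<le> (C * real (Suc k) powr (a/b)) powr (2/a)"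
        using a c by (intro powr_mono2) auto
      also have "\<dots> = C powr (2/a) * real (Suc k) powr (2/b)"
        using C(1) a c by (simp add: powr_mult powr_powr)
      also have "(\<bar>V (Suc k) \<omega>\<bar> powr a) powr (2/a) = (V (Suc k) \<omega>)\<^sup>2"
        using a c by (cases "V (Suc k) \<omega> = 0") (simp_all add: powr_powr powr_numeral)
      finally show ?thesis .
    qed
    thus ?case by blast
  qed
  thus ?thesis using b by blast
qed

end

subsection \<open>Recursive least squares\<close>

locale regression =
  fixes d :: nat and \<Phi> :: "nat \<Rightarrow> nat \<Rightarrow> real"
begin

definition dot :: "(nat \<Rightarrow> real) \<Rightarrow> (nat \<Rightarrow> real) \<Rightarrow> real" where
  "dot a b = (\<Sum>i<d. a i * b i)"

text \<open>Only the regressors before time n enter, so \<open>gram n\<close> is the usual matrix S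
  at time n - 1. Vectors are functions of which only the coordinates below \<open>d\<close>
  count.\<close>

definition gram :: "nat \<Rightarrow> nat \<Rightarrow> nat \<Rightarrow> real" where
  "gram n i j = (if i = j then 1 else 0) + (\<Sum>k<n. \<Phi> k i * \<Phi> k j)"

definition gram_apply :: "nat \<Rightarrow> (nat \<Rightarrow> real) \<Rightarrow> nat \<Rightarrow> real" where
  "gram_apply n u i = (\<Sum>j<d. gram n i j * u j)"

text \<open>The inverse of the Gram matrix, updated by the Sherman-Morrison formula.\<close>

primrec inv_gram :: "nat \<Rightarrow> nat \<Rightarrow> nat \<Rightarrow> real" where
  "inv_gram 0 = (\<lambda>i j. if i = j then 1 else 0)"
| "inv_gram (Suc n) = (\<lambda>i j. inv_gram n i j
     - (\<Sum>l<d. inv_gram n i l * \<Phi> n l) * (\<Sum>l<d. inv_gram n j l * \<Phi> n l)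
        / (1 + (\<Sum>i<d. \<Phi> n i * (\<Sum>l<d. inv_gram n i l * \<Phi> n l))))"

definition gdir :: "nat \<Rightarrow> nat \<Rightarrow> real" where
  "gdir n i = (\<Sum>l<d. inv_gram n i l * \<Phi> n l)"

text \<open>The leverage is taken with respect to the matrix before the update; with the updated
  matrix it would be \<open>leverage n / (1 + leverage n)\<close>, the weight that appears in all
  sums below.\<close>

definition leverage :: "nat \<Rightarrow> real" where
  "leverage n = dot (\<Phi> n) (gdir n)"

text \<open>The quadratic form of \<open>gram n\<close>, written as a sum of squares so that
  positivity is evident.\<close>

definition quad :: "nat \<Rightarrow> (nat \<Rightarrow> real) \<Rightarrow> real" where
  "quad n u = dot u u + (\<Sum>k<n. (dot (\<Phi> k) u)\<^sup>2)"

lemma dot_commute: "dot a b = dot b a"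
  by (simp add: dot_def mult.commute)

lemma dot_add_scale: "dot a (\<lambda>i. b i + c * e i) = dot a b + c * dot a e"
  by (simp add: dot_def algebra_simps sum.distrib sum_distrib_left)

lemma dot_self_nonneg: "dot a a \<ge> 0"
  by (simp add: dot_def sum_nonneg)

lemma dot_Cauchy_Schwarz: "(dot a b)\<^sup>2 \<le> dot a a * dot b b"
  using Cauchy_Schwarz_ineq_sum[of a b "{..<d}"] by (simp add: dot_def power2_eq_square)

lemma dot_cong: "(\<And>i. i < d \<Longrightarrow> b i = c i) \<Longrightarrow> dot a b = dot a c"
  by (simp add: dot_def)

lemma inv_gram_Suc: "inv_gram (Suc n) i j = inv_gram n i j - gdir n i * gdir n j / (1 + leverage n)"
  by (simp add: gdir_def leverage_def dot_def)

declare inv_gram.simps(2)[simp del]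

lemma inv_gram_sym: "inv_gram n i j = inv_gram n j i"
  by (induction n arbitrary: i j) (auto simp: inv_gram_Suc mult.commute)

lemma gram_Suc: "gram (Suc n) i j = gram n i j + \<Phi> n i * \<Phi> n j"
  by (simp add: gram_def)

lemma gram_sym: "gram n i j = gram n j i"
  by (simp add: gram_def mult.commute)

lemma gram_apply_Suc: "gram_apply (Suc n) u i = gram_apply n u i + dot (\<Phi> n) u * \<Phi> n i"
  by (simp add: gram_apply_def gram_Suc algebra_simps sum.distrib sum_distrib_left dot_def)

lemma gram_apply_add_scale: "gram_apply n (\<lambda>i. u i + c * w i) i = gram_apply n u i + c * gram_apply n w i"
  by (simp add: gram_apply_def algebra_simps sum.distrib sum_distrib_left)

lemma gram_apply_0: "i < d \<Longrightarrow> gram_apply 0 u i = u i"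
  by (simp add: gram_apply_def gram_def if_distrib[of "\<lambda>x. x * _"] cong: if_cong)

lemma dot_gram_apply: "dot u (gram_apply n u) = quad n u"
proof (induction n)
  case 0
  show ?case by (auto simp: quad_def gram_apply_0 intro: dot_cong)
next
  case (Suc n)
  have "dot u (gram_apply (Suc n) u) = dot u (\<lambda>i. gram_apply n u i + dot (\<Phi> n) u * \<Phi> n i)"
    by (intro dot_cong) (rule gram_apply_Suc)
  also have "\<dots> = quad n u + dot (\<Phi> n) u * dot u (\<Phi> n)"
    by (simp add: dot_add_scale Suc)
  finally show ?case by (simp add: quad_def dot_commute[of u "\<Phi> n"] power2_eq_square)
qed

lemma dot_gram_apply_sym: "dot u (gram_apply n w) = dot w (gram_apply n u)"
proof -
  have "dot u (gram_apply n w) = (\<Sum>i<d. \<Sum>j<d. u i * gram n i j * w j)"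
    by (simp add: dot_def gram_apply_def sum_distrib_left mult.assoc)
  also have "\<dots> = (\<Sum>j<d. \<Sum>i<d. w j * (gram n j i * u i))"
    by (subst sum.swap) (simp add: gram_sym[of n] ac_simps)
  finally show ?thesis by (simp add: dot_def gram_apply_def sum_distrib_left)
qed

lemma quad_ge: "quad n u \<ge> dot u u"
  by (simp add: quad_def sum_nonneg)

lemma quad_nonneg: "quad n u \<ge> 0"
  using quad_ge[of u n] dot_self_nonneg[of u] by linarith

text \<open>The inverse property is a hypothesis here because the induction that proves it calls
  this step, in order to know that the denominator of the update is positive.\<close>

lemma gdir_inv_step:
  assumes inv: "\<And>i l. i < d \<Longrightarrow> l < d \<Longrightarrow> (\<Sum>j<d. gram n i j * inv_gram n j l) = (if i = l then 1 else 0)"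
  shows "i < d \<Longrightarrow> gram_apply n (gdir n) i = \<Phi> n i" "leverage n = quad n (gdir n)"
proof -
  show 1: "gram_apply n (gdir n) i = \<Phi> n i" if i: "i < d" for i
  proof -
    have "gram_apply n (gdir n) i = (\<Sum>j<d. \<Sum>l<d. gram n i j * inv_gram n j l * \<Phi> n l)"
      by (simp add: gram_apply_def gdir_def sum_distrib_left mult.assoc)
    also have "\<dots> = (\<Sum>l<d. (\<Sum>j<d. gram n i j * inv_gram n j l) * \<Phi> n l)"
      by (subst sum.swap) (simp add: sum_distrib_right)
    also have "\<dots> = (\<Sum>l<d. (if i = l then 1 else 0) * \<Phi> n l)"
      using inv i by (intro sum.cong) auto
    also have "\<dots> = \<Phi> n i" using i by (simp add: if_distrib[of "\<lambda>x. x * _"] cong: if_cong)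
    finally show ?thesis .
  qed
  have "leverage n = dot (gdir n) (gram_apply n (gdir n))"
    unfolding leverage_def by (subst dot_commute) (auto intro: dot_cong simp: 1)
  thus "leverage n = quad n (gdir n)" by (simp add: dot_gram_apply)
qed

lemma gram_inv_gram:
  "i < d \<Longrightarrow> l < d \<Longrightarrow> (\<Sum>j<d. gram n i j * inv_gram n j l) = (if i = l then 1 else 0)"
proof (induction n arbitrary: i l)
  case 0
  thus ?case by (simp add: gram_def if_distrib[of "\<lambda>x. x * _"] cong: if_cong)
next
  case (Suc n)
  have "leverage n = quad n (gdir n)" by (rule gdir_inv_step(2)) (rule Suc.IH)
  hence g: "leverage n \<ge> 0" using quad_nonneg[of n "gdir n"] by simp
  have "gram_apply n (gdir n) i = \<Phi> n i" by (rule gdir_inv_step(1)[OF _ Suc.prems(1)]) (rule Suc.IH)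
  hence a: "(\<Sum>j<d. gram n i j * gdir n j) = \<Phi> n i" by (simp add: gram_apply_def)
  have b: "(\<Sum>j<d. \<Phi> n j * inv_gram n j l) = gdir n l"
    by (simp add: gdir_def inv_gram_sym[of n l] mult.commute)
  have c: "(\<Sum>j<d. \<Phi> n j * gdir n j) = leverage n" by (simp add: leverage_def dot_def)
  define x where "x = gdir n l / (1 + leverage n)"
  have "(\<Sum>j<d. gram (Suc n) i j * inv_gram (Suc n) j l)
     = (\<Sum>j<d. gram n i j * inv_gram n j l + \<Phi> n i * (\<Phi> n j * inv_gram n j l)
         - x * (gram n i j * gdir n j) - x * \<Phi> n i * (\<Phi> n j * gdir n j))"
    by (simp add: gram_Suc inv_gram_Suc x_def algebra_simps add_divide_distrib)
  also have "\<dots> = (if i = l then 1 else 0) + \<Phi> n i * gdir n l - x * \<Phi> n i - x * \<Phi> n i * leverage n"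
    using Suc by (simp only: sum.distrib sum_subtractf sum_distrib_left[symmetric] a b c)
  also have "gdir n l = x * (1 + leverage n)" using g by (simp add: x_def)
  finally show ?case by (simp add: algebra_simps)
qed

lemma gram_apply_gdir: "i < d \<Longrightarrow> gram_apply n (gdir n) i = \<Phi> n i"
  and leverage_eq_quad: "leverage n = quad n (gdir n)"
  using gdir_inv_step[OF gram_inv_gram] by auto

lemma leverage_nonneg: "leverage n \<ge> 0"
  by (simp add: leverage_eq_quad quad_nonneg)

text \<open>By how much the trace of the inverse Gram matrix decreases when the regressor n is
  added.\<close>

definition trace_drop :: "nat \<Rightarrow> real" where
  "trace_drop n = dot (gdir n) (gdir n) / (1 + leverage n)"

lemma trace_drop_nonneg: "trace_drop n \<ge> 0"
  using leverage_nonneg[of n] dot_self_nonneg[of "gdir n"] by (simp add: trace_drop_def)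

text \<open>The trace of the inverse starts at \<open>d\<close> and telescopes; it stays
  nonnegative.\<close>

lemma sum_trace_drop_le: "(\<Sum>k<n. trace_drop k) \<le> real d"
proof -
  have tr: "(\<Sum>i<d. inv_gram n i i) = real d - (\<Sum>k<n. trace_drop k)"
  proof (induction n)
    case (Suc n)
    have "(\<Sum>i<d. inv_gram (Suc n) i i) = (\<Sum>i<d. inv_gram n i i) - trace_drop n"
      by (simp add: inv_gram_Suc sum_subtractf trace_drop_def dot_def sum_divide_distrib)
    thus ?case using Suc by simp
  qed simp
  \<comment> \<open>A diagonal entry of the inverse is the value of the quadratic form at the
    corresponding column of the inverse.\<close>
  have "inv_gram n i i \<ge> 0" if i: "i < d" for i
  proof -
    let ?w = "\<lambda>j. inv_gram n j i"
    have "dot ?w (gram_apply n ?w) = dot ?w (\<lambda>l. if l = i then 1 else 0)"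
      using i by (intro dot_cong) (simp add: gram_apply_def gram_inv_gram)
    also have "\<dots> = inv_gram n i i"
      using i by (simp add: dot_def if_distrib[of "\<lambda>x. _ * x"] cong: if_cong)
    finally show ?thesis using quad_nonneg[of n ?w] by (simp add: dot_gram_apply)
  qed
  hence "(\<Sum>i<d. inv_gram n i i) \<ge> 0" by (intro sum_nonneg) auto
  thus ?thesis using tr by simp
qed

text \<open>By Cauchy-Schwarz, the squared leverage is at most the squared norm of the regressor
  times that of \<open>gdir n\<close>, and the latter is the trace drop times one plus the leverage.
  Cancelling this factor costs the summand 1. A large leverage is thus paid for by a gain that tends
  to 0 times the squared norm.\<close>

lemma leverage_le_trace_drop: "leverage n \<le> 1 + trace_drop n * dot (\<Phi> n) (\<Phi> n)"
proof (cases "leverage n \<le> 1")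
  case True
  thus ?thesis using trace_drop_nonneg[of n] dot_self_nonneg[of "\<Phi> n"] by (simp add: add_increasing2)
next
  case False
  have "(leverage n)\<^sup>2 \<le> dot (\<Phi> n) (\<Phi> n) * dot (gdir n) (gdir n)"
    unfolding leverage_def by (rule dot_Cauchy_Schwarz)
  also have "dot (gdir n) (gdir n) = trace_drop n * (1 + leverage n)"
    using False by (simp add: trace_drop_def)
  finally have 1: "(leverage n)\<^sup>2 \<le> (trace_drop n * dot (\<Phi> n) (\<Phi> n)) * (1 + leverage n)" by (simp add: ac_simps)
  have "(leverage n - 1) * (1 + leverage n) \<le> (leverage n)\<^sup>2" by (simp add: algebra_simps power2_eq_square)
  with 1 have "(leverage n - 1) * (1 + leverage n) \<le> (trace_drop n * dot (\<Phi> n) (\<Phi> n)) * (1 + leverage n)" by linarith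
  hence "leverage n - 1 \<le> trace_drop n * dot (\<Phi> n) (\<Phi> n)"
    using False by (subst (asm) mult_le_cancel_right) auto
  thus ?thesis by simp
qed

text \<open>The same use of Cauchy-Schwarz, with the squared norm of \<open>gdir n\<close> now
  controlled by the lower bound on the quadratic form, whose value at \<open>gdir n\<close> is the
  leverage itself.\<close>

lemma leverage_le_of_excitation:
  assumes c: "c > 0" and ex: "\<And>u. c * dot u u \<le> quad n u"
  shows "leverage n \<le> dot (\<Phi> n) (\<Phi> n) / c"
proof (cases "leverage n = 0")
  case True
  thus ?thesis using c dot_self_nonneg[of "\<Phi> n"] by simp
next
  case False
  hence g: "leverage n > 0" using leverage_nonneg[of n] by linarith
  have "c * (leverage n)\<^sup>2 \<le> c * (dot (\<Phi> n) (\<Phi> n) * dot (gdir n) (gdir n))"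
    unfolding leverage_def using c by (intro mult_left_mono dot_Cauchy_Schwarz) auto
  also have "\<dots> = dot (\<Phi> n) (\<Phi> n) * (c * dot (gdir n) (gdir n))" by simp
  also have "\<dots> \<le> dot (\<Phi> n) (\<Phi> n) * leverage n"
    unfolding leverage_eq_quad by (intro mult_left_mono ex dot_self_nonneg)
  finally have "(c * leverage n) * leverage n \<le> dot (\<Phi> n) (\<Phi> n) * leverage n"
    by (simp add: power2_eq_square ac_simps)
  hence "c * leverage n \<le> dot (\<Phi> n) (\<Phi> n)" using g by (subst (asm) mult_le_cancel_right) auto
  thus ?thesis using c by (simp add: le_divide_eq mult.commute)
qed

text \<open>A stand-in for the trace of the Gram matrix, which equals
  \<open>energy n + real d - 1\<close>.\<close>

definition energy :: "nat \<Rightarrow> real" where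
  "energy n = 1 + (\<Sum>k<n. dot (\<Phi> k) (\<Phi> k))"

lemma energy_ge_1: "energy n \<ge> 1"
  by (simp add: energy_def sum_nonneg dot_self_nonneg)

lemma gram_abs_le_energy: "i < d \<Longrightarrow> j < d \<Longrightarrow> \<bar>gram n i j\<bar> \<le> energy n"
proof -
  assume ij: "i < d" "j < d"
  have le: "\<bar>\<Phi> k i * \<Phi> k j\<bar> \<le> dot (\<Phi> k) (\<Phi> k)" for k
  proof -
    have m: "(\<Phi> k l)\<^sup>2 \<le> dot (\<Phi> k) (\<Phi> k)" if "l < d" for l
      using that member_le_sum[of l "{..<d}" "\<lambda>l. (\<Phi> k l)\<^sup>2"] by (simp add: dot_def power2_eq_square)
    have "2 * \<bar>\<Phi> k i * \<Phi> k j\<bar> \<le> (\<Phi> k i)\<^sup>2 + (\<Phi> k j)\<^sup>2" by (rule abs_mult_le_squares)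
    thus ?thesis using m[OF ij(1)] m[OF ij(2)] by linarith
  qed
  have "\<bar>gram n i j\<bar> \<le> 1 + \<bar>\<Sum>k<n. \<Phi> k i * \<Phi> k j\<bar>"
    unfolding gram_def by (rule order_trans[OF abs_triangle_ineq]) simp
  also have "\<bar>\<Sum>k<n. \<Phi> k i * \<Phi> k j\<bar> \<le> (\<Sum>k<n. dot (\<Phi> k) (\<Phi> k))"
    by (intro order_trans[OF sum_abs] sum_mono le)
  finally show ?thesis by (simp add: energy_def)
qed

end

section \<open>Determinants and the sum of the leverages\<close>

text \<open>The matrix determinant lemma: the bordered matrix is multiplied by a unit triangular
  block matrix from the left and by another one from the right, and the resulting determinants are
  compared. The vector q stands for the inverse of A applied to u.\<close>

lemma det_add_rank_one:
  fixes A :: "real mat"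
  assumes A: "A \<in> carrier_mat n n" and u: "u \<in> carrier_mat n 1" and q: "q \<in> carrier_mat n 1"
    and Aq: "A * q = u"
  shows "det (A + u * transpose_mat u) = det A * (1 + (transpose_mat u * q) $$ (0, 0))"
proof -
  let ?uT = "transpose_mat u" and ?one = "1\<^sub>m 1 :: real mat" and ?z = "0\<^sub>m 1 n :: real mat"
  have uT: "?uT \<in> carrier_mat 1 n" using u by simp
  let ?M = "four_block_mat A (- u) ?uT ?one"
  let ?L = "four_block_mat (1\<^sub>m n) u ?z ?one"
  let ?R = "four_block_mat (1\<^sub>m n) q ?z ?one"
  have z: "?z \<in> carrier_mat 1 n" by simp
  have c: "?M \<in> carrier_mat (n+1) (n+1)" "?L \<in> carrier_mat (n+1) (n+1)" "?R \<in> carrier_mat (n+1) (n+1)"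
    using A by auto
  have dL: "det ?L = 1" by (subst det_four_block_mat_lower_left_zero[OF _ u]) auto
  have dR: "det ?R = 1" by (subst det_four_block_mat_lower_left_zero[OF _ q]) auto
  have "?L * ?M = four_block_mat (1\<^sub>m n * A + u * ?uT) (1\<^sub>m n * (- u) + u * ?one)
      (?z * A + ?one * ?uT) (?z * (- u) + ?one * ?one)"
    by (rule mult_four_block_mat) (use A u uT in auto)
  also have "\<dots> = four_block_mat (A + u * ?uT) (0\<^sub>m n 1) ?uT ?one"
  proof (rule cong_four_block_mat)
    show "1\<^sub>m n * (- u) + u * ?one = 0\<^sub>m n 1" using u by (intro eq_matI) auto
  qed (use A u uT in auto)
  also have "det \<dots> = det (A + u * ?uT)"
    by (subst det_four_block_mat_upper_right_zero[OF _ refl uT]) (use A u uT in auto)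
  finally have 1: "det ?M = det (A + u * ?uT)" using det_mult[OF c(2) c(1)] dL by simp
  have "?M * ?R = four_block_mat (A * 1\<^sub>m n + (- u) * ?z) (A * q + (- u) * ?one)
      (?uT * 1\<^sub>m n + ?one * ?z) (?uT * q + ?one * ?one)"
    by (rule mult_four_block_mat) (use A u uT q in auto)
  also have "\<dots> = four_block_mat A (0\<^sub>m n 1) ?uT (?uT * q + ?one)"
  proof (rule cong_four_block_mat)
    show "A * q + (- u) * ?one = 0\<^sub>m n 1" unfolding Aq using u by (intro eq_matI) auto
    show "A * 1\<^sub>m n + (- u) * ?z = A" using A u by (intro eq_matI) (auto simp: scalar_prod_def)
    show "?uT * 1\<^sub>m n + ?one * ?z = ?uT" using u uT by (intro eq_matI) auto
    show "?uT * q + ?one * ?one = ?uT * q + ?one" by simp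
  qed
  also have "det \<dots> = det A * det (?uT * q + ?one)"
    by (rule det_four_block_mat_upper_right_zero[OF A refl uT]) (use q uT in auto)
  also have "det (?uT * q + ?one) = 1 + (?uT * q) $$ (0, 0)"
    by (subst det_single) (use q uT in auto)
  finally have 2: "det ?M = det A * (1 + (?uT * q) $$ (0, 0))" using det_mult[OF c(1) c(3)] dR by simp
  show ?thesis using 1 2 by simp
qed

lemma the_mat_inverse_eqI:
  fixes A :: "real mat"
  assumes A: "A \<in> carrier_mat n n" and B: "B \<in> carrier_mat n n" and AB: "A * B = 1\<^sub>m n"
  shows "the (mat_inverse A) = B"
proof (cases "mat_inverse A")
  case None
  have "B * A = 1\<^sub>m n" by (rule mat_mult_left_right_inverse[OF A B AB])
  hence "A \<in> Units (ring_mat TYPE(real) n ())"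
    using A B AB by (auto simp: Units_def ring_mat_simps)
  thus ?thesis using mat_inverse(1)[OF A None, of "()"] by simp
next
  case (Some C)
  note C = mat_inverse(2)[OF A Some]
  have "C = C * (A * B)" unfolding AB using C right_mult_one_mat[of C n n] by simp
  also have "\<dots> = (C * A) * B" using A B C by (intro assoc_mult_mat[symmetric]) auto
  also have "\<dots> = B" using B C by simp
  finally show ?thesis using Some by simp
qed

context regression
begin

definition gram_mat :: "nat \<Rightarrow> real mat" where
  "gram_mat n = mat d d (\<lambda>(i, j). gram n i j)"

lemma gram_mat_carrier[simp]: "gram_mat n \<in> carrier_mat d d"
  by (simp add: gram_mat_def)

lemma det_gram_mat: "det (gram_mat n) = (\<Prod>k<n. 1 + leverage k)"
proof (induction n)
  case 0
  have "gram_mat 0 = 1\<^sub>m d" by (intro eq_matI) (auto simp: gram_mat_def gram_def)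
  thus ?case by simp
next
  case (Suc n)
  define u where "u = mat d 1 (\<lambda>(i, j). \<Phi> n i)"
  define q where "q = mat d 1 (\<lambda>(i, j). gdir n i)"
  have uq: "u \<in> carrier_mat d 1" "q \<in> carrier_mat d 1" by (auto simp: u_def q_def)
  have "gram_mat n * q = u"
    using gram_apply_gdir[of _ n]
    by (intro eq_matI) (auto simp: gram_mat_def q_def u_def scalar_prod_def gram_apply_def atLeast0LessThan)
  from det_add_rank_one[OF gram_mat_carrier uq this]
  have "det (gram_mat n + u * transpose_mat u) = det (gram_mat n) * (1 + (transpose_mat u * q) $$ (0, 0))" .
  also have "(transpose_mat u * q) $$ (0, 0) = leverage n"
    by (simp add: u_def q_def scalar_prod_def leverage_def dot_def atLeast0LessThan)
  also have "gram_mat n + u * transpose_mat u = gram_mat (Suc n)"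
    by (intro eq_matI) (auto simp: gram_mat_def u_def scalar_prod_def gram_Suc)
  finally show ?case using Suc by simp
qed

text \<open>Leibniz expansion with every entry bounded by the energy. Such a crude polynomial bound
  suffices since only its logarithm is used.\<close>

lemma prod_leverage_le: "(\<Prod>k<n. 1 + leverage k) \<le> fact d * energy n ^ d"
proof -
  have "det (gram_mat n) = (\<Sum>p\<in>{p. p permutes {0..<d}}. signof p * (\<Prod>i=0..<d. gram_mat n $$ (i, p i)))"
    by (rule det_def'[OF gram_mat_carrier])
  also have "\<dots> \<le> (\<Sum>p\<in>{p. p permutes {0..<d}}. energy n ^ d)"
  proof (rule sum_mono)
    fix p assume p: "p \<in> {p. p permutes {0..<d}}"
    have "signof p * (\<Prod>i=0..<d. gram_mat n $$ (i, p i)) \<le> \<bar>signof p * (\<Prod>i=0..<d. gram_mat n $$ (i, p i))\<bar>"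
      by simp
    also have "\<dots> = (\<Prod>i=0..<d. \<bar>gram_mat n $$ (i, p i)\<bar>)"
      by (simp add: abs_mult sign_def abs_prod)
    also have "\<dots> \<le> (\<Prod>i=0..<d. energy n)"
    proof (intro prod_mono conjI)
      fix i assume i: "i \<in> {0..<d}"
      hence "p i < d" using p permutes_in_image[of p "{0..<d}" i] by auto
      thus "\<bar>gram_mat n $$ (i, p i)\<bar> \<le> energy n"
        using i gram_abs_le_energy[of i "p i" n] by (simp add: gram_mat_def)
    qed simp
    finally show "signof p * (\<Prod>i=0..<d. gram_mat n $$ (i, p i)) \<le> energy n ^ d" by simp
  qed
  also have "\<dots> = fact d * energy n ^ d"
    by (simp add: card_permutations[OF refl])
  finally show ?thesis by (simp add: det_gram_mat)
qed

lemma sum_ln_leverage_le: "(\<Sum>k<n. ln (1 + leverage k)) \<le> ln (fact d) + real d * ln (energy n)"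
proof -
  have pos: "1 + leverage k > 0" for k using leverage_nonneg[of k] by simp
  have e: "energy n > 0" using energy_ge_1[of n] by simp
  have "(\<Sum>k<n. ln (1 + leverage k)) = ln (\<Prod>k<n. 1 + leverage k)"
    using pos by (subst ln_prod) (auto simp: less_imp_neq[symmetric])
  also have "\<dots> \<le> ln (fact d * energy n ^ d)"
    using pos e prod_leverage_le[of n] by (subst ln_le_cancel_iff) (auto intro: prod_pos)
  also have "\<dots> = ln (fact d) + real d * ln (energy n)"
    using e by (subst ln_mult) (auto simp: ln_realpow)
  finally show ?thesis .
qed

lemma sum_leverage_fraction_le:
  "(\<Sum>k<n. leverage k / (1 + leverage k)) \<le> ln (fact d) + real d * ln (energy n)"
proof -
  have "leverage k / (1 + leverage k) \<le> ln (1 + leverage k)" for k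
  proof -
    have g: "1 + leverage k > 0" using leverage_nonneg[of k] by simp
    \<comment> \<open>The inequality \<open>ln y \<le> y - 1\<close> at the reciprocal of
      \<open>1 + leverage k\<close>.\<close>
    have "ln (1 / (1 + leverage k)) \<le> 1 / (1 + leverage k) - 1"
      using g by (intro ln_le_minus_one) auto
    moreover have "1 / (1 + leverage k) - 1 = - (leverage k / (1 + leverage k))"
      using g by (simp add: field_simps)
    ultimately show ?thesis using g by (simp add: ln_div)
  qed
  thus ?thesis by (intro order_trans[OF sum_mono sum_ln_leverage_le])
qed

lemma the_inverse_gram_mat: "the (mat_inverse (gram_mat n)) = mat d d (\<lambda>(i, j). inv_gram n i j)"
proof (rule the_mat_inverse_eqI[OF gram_mat_carrier])
  show "gram_mat n * mat d d (\<lambda>(i, j). inv_gram n i j) = 1\<^sub>m d"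
    using gram_inv_gram[of _ _ n]
    by (intro eq_matI) (auto simp: gram_mat_def scalar_prod_def atLeast0LessThan)
qed simp

text \<open>The estimator multiplies the regressor by the inverse of the matrix that already
  contains it; the old inverse enters through \<open>gdir\<close>, up to the factor one over
  \<open>1 + leverage n\<close>.\<close>

lemma inv_gram_Suc_apply:
  "(\<Sum>j<d. inv_gram (Suc n) i j * \<Phi> n j) = gdir n i / (1 + leverage n)"
proof -
  have "(\<Sum>j<d. inv_gram (Suc n) i j * \<Phi> n j)
      = (\<Sum>j<d. inv_gram n i j * \<Phi> n j - gdir n i / (1 + leverage n) * (\<Phi> n j * gdir n j))"
    by (simp add: inv_gram_Suc algebra_simps)
  also have "\<dots> = gdir n i - gdir n i / (1 + leverage n) * leverage n"
    by (simp only: sum_subtractf sum_distrib_left[symmetric] gdir_def[symmetric])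
      (simp add: leverage_def dot_def)
  also have "\<dots> = gdir n i / (1 + leverage n)"
    using leverage_nonneg[of n] by (simp add: field_simps)
  finally show ?thesis .
qed

end

section \<open>The recursion of the estimation error\<close>

text \<open>Only the error \<open>e\<close>, estimate minus true parameter, appears.
  \<open>W\<close> is the noise of the regression equation.\<close>

locale least_squares = regression +
  fixes e :: "nat \<Rightarrow> nat \<Rightarrow> real" and W :: "nat \<Rightarrow> real"
  assumes e_Suc: "\<And>n i. i < d \<Longrightarrow>
    e (Suc n) i = e n i + (W n - dot (\<Phi> n) (e n)) * (gdir n i / (1 + leverage n))"
begin

text \<open>The sign makes this the true parameter minus the estimate, applied to the regressor:
  what the adaptive control adds to the tracking error besides the noise.\<close>

definition pred_err :: "nat \<Rightarrow> real" where
  "pred_err n = - dot (\<Phi> n) (e n)"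

definition lyap :: "nat \<Rightarrow> real" where
  "lyap n = quad n (e n)"

definition wgt_err :: "nat \<Rightarrow> real" where
  "wgt_err n = (pred_err n)\<^sup>2 / (1 + leverage n)"

lemma wgt_err_nonneg: "wgt_err n \<ge> 0"
  using leverage_nonneg[of n] by (simp add: wgt_err_def)

lemma pred_err_square: "(pred_err n)\<^sup>2 = wgt_err n * (1 + leverage n)"
  using leverage_nonneg[of n] by (simp add: wgt_err_def)

lemma quad_cong: "(\<And>i. i < d \<Longrightarrow> u i = w i) \<Longrightarrow> quad n u = quad n w"
  by (simp add: quad_def dot_def)

lemma e_Suc': "i < d \<Longrightarrow> e (Suc n) i = e n i + (W n + pred_err n) / (1 + leverage n) * gdir n i"
  by (simp add: e_Suc pred_err_def)

text \<open>The error moves along \<open>gdir n\<close>, which the Gram matrix maps to the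
  regressor. The new quadratic form is therefore a function of four scalars only: the old form, the
  prediction error, the leverage and the step size \<open>c\<close>.\<close>

lemma lyap_Suc:
  "lyap (Suc n) = lyap n - wgt_err n - 2 * (pred_err n / (1 + leverage n) * W n)
     + leverage n / (1 + leverage n) * (W n)\<^sup>2"
proof -
  define c where "c = (W n + pred_err n) / (1 + leverage n)"
  define g where "g = leverage n"
  have g: "1 + g > 0" using leverage_nonneg[of n] by (simp add: g_def)
  define E where "E = (\<lambda>i. e n i + c * gdir n i)"
  have s: "gram_apply n E i = gram_apply n (e n) i + c * \<Phi> n i" if "i < d" for i
    using that by (simp add: E_def gram_apply_add_scale gram_apply_gdir)
  have 1: "dot u (gram_apply n E) = dot u (gram_apply n (e n)) + c * dot u (\<Phi> n)" for u
    using dot_cong[of "gram_apply n E" _ u, OF s] by (simp add: dot_add_scale)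
  have dE: "dot u E = dot u (e n) + c * dot u (gdir n)" for u by (simp add: E_def dot_add_scale)
  have ps: "dot (\<Phi> n) (e n) = - pred_err n" by (simp add: pred_err_def)
  have ge: "dot (gdir n) (\<Phi> n) = g" by (simp add: g_def leverage_def dot_commute[of "gdir n" "\<Phi> n"])
  have "dot E (gram_apply n E) = dot E (gram_apply n (e n)) + c * dot E (\<Phi> n)" by (rule 1)
  also have "dot E (gram_apply n (e n)) = dot (e n) (gram_apply n E)" by (rule dot_gram_apply_sym)
  also have "\<dots> = lyap n + c * dot (e n) (\<Phi> n)" by (simp add: 1 dot_gram_apply lyap_def)
  also have "dot (e n) (\<Phi> n) = - pred_err n" by (simp add: ps dot_commute[of "e n" "\<Phi> n"])
  also have "dot E (\<Phi> n) = - pred_err n + c * g" by (simp add: dot_commute[of E "\<Phi> n"] dE ps g_def leverage_def)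
  finally have q: "quad n E = lyap n - 2 * c * pred_err n + c\<^sup>2 * g"
    by (simp add: dot_gram_apply algebra_simps power2_eq_square)
  have "lyap (Suc n) = quad (Suc n) E"
    unfolding lyap_def by (intro quad_cong) (simp add: E_def c_def e_Suc')
  also have "\<dots> = quad n E + (dot (\<Phi> n) E)\<^sup>2" by (simp add: quad_def)
  also have "dot (\<Phi> n) E = - pred_err n + c * g" by (simp add: dE ps g_def leverage_def)
  finally have l: "lyap (Suc n) = lyap n - 2 * c * pred_err n + c\<^sup>2 * g + (- pred_err n + c * g)\<^sup>2"
    using q by simp
  \<comment> \<open>Eliminating \<open>W n\<close> in favour of \<open>c\<close> leaves a polynomial
    identity once both sides are multiplied by \<open>1 + g\<close>.\<close>
  have W: "W n = c * (1 + g) - pred_err n" using g by (simp add: c_def g_def)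
  have "lyap (Suc n) * (1 + g) = (lyap n - wgt_err n - 2 * (pred_err n / (1 + g) * W n)
     + g / (1 + g) * (W n)\<^sup>2) * (1 + g)"
    unfolding l wgt_err_def g_def[symmetric] using g
    by (simp add: distrib_right left_diff_distrib) (simp add: W power2_eq_square algebra_simps)
  thus ?thesis using g by (simp add: g_def)
qed

lemma lyap_sum:
  "lyap n + (\<Sum>k<n. wgt_err k) = lyap 0 - 2 * (\<Sum>k<n. pred_err k / (1 + leverage k) * W k)
     + (\<Sum>k<n. leverage k / (1 + leverage k) * (W k)\<^sup>2)"
  by (induction n) (simp_all add: lyap_Suc algebra_simps)

text \<open>Used in reverse later: noise sums weighted by regressors are recovered from the size of
  the estimation error.\<close>

lemma normal_equation: "i < d \<Longrightarrow> gram_apply n (e n) i = e 0 i + (\<Sum>k<n. W k * \<Phi> k i)"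
proof (induction n)
  case 0
  thus ?case by (simp add: gram_apply_0)
next
  case (Suc n)
  define c where "c = (W n + pred_err n) / (1 + leverage n)"
  define E where "E = (\<lambda>i. e n i + c * gdir n i)"
  have g: "1 + leverage n > 0" using leverage_nonneg[of n] by simp
  have "gram_apply (Suc n) (e (Suc n)) i = gram_apply (Suc n) E i"
    unfolding gram_apply_def by (intro sum.cong) (auto simp: E_def c_def e_Suc')
  also have "\<dots> = gram_apply n E i + dot (\<Phi> n) E * \<Phi> n i" by (rule gram_apply_Suc)
  also have "gram_apply n E i = gram_apply n (e n) i + c * \<Phi> n i"
    using Suc.prems by (simp add: E_def gram_apply_add_scale gram_apply_gdir)
  also have "dot (\<Phi> n) E = - pred_err n + c * leverage n"
    by (simp add: E_def dot_add_scale pred_err_def leverage_def)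
  also have "gram_apply n (e n) i + c * \<Phi> n i + (- pred_err n + c * leverage n) * \<Phi> n i
     = gram_apply n (e n) i + (c * (1 + leverage n) - pred_err n) * \<Phi> n i" by (simp add: algebra_simps)
  also have "c * (1 + leverage n) - pred_err n = W n" using g by (simp add: c_def)
  finally show ?case using Suc by simp
qed

end

subsection \<open>Growth of real sequences\<close>

text \<open>Needed because the regression equation with noise \<open>V\<close> fails at time 0,
  where the initial values are arbitrary.\<close>

lemma small_sums_modify_first:
  assumes "small_sums s b" "\<And>k. k \<ge> 1 \<Longrightarrow> s' k = s k"
  shows "small_sums s' b"
  unfolding small_sums_def
proof (intro allI impI)
  fix \<eta> :: real assume "\<eta> > 0"
  then obtain C where C: "\<And>n. \<bar>\<Sum>k<n. s k\<bar> \<le> \<eta> * (\<Sum>k<n. b k) + C" using small_sumsD[OF assms(1)] by blast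
  have "\<bar>\<Sum>k<n. s' k\<bar> \<le> \<eta> * (\<Sum>k<n. b k) + (C + \<bar>s' 0 - s 0\<bar>)" for n
  proof -
    have "(\<Sum>k<n. s' k) - (\<Sum>k<n. s k) = (\<Sum>k<n. if k = 0 then s' 0 - s 0 else 0)"
      unfolding sum_subtractf[symmetric] by (intro sum.cong) (use assms(2) in auto)
    also have "\<bar>\<dots>\<bar> \<le> \<bar>s' 0 - s 0\<bar>" by simp
    finally show ?thesis using C[of n] by linarith
  qed
  thus "\<exists>C. \<forall>n. \<bar>\<Sum>k<n. s' k\<bar> \<le> \<eta> * (\<Sum>k<n. b k) + C" by blast
qed

lemma small_sums_linear:
  assumes s: "small_sums s b" and B: "\<And>n. (\<Sum>k<n. b k) \<le> B * (real n + 1)"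
  shows "small_sums s (\<lambda>_. 1)"
  unfolding small_sums_def
proof (intro allI impI)
  fix \<eta> :: real assume e: "\<eta> > 0"
  define B' where "B' = max B 1"
  have B': "B' > 0" "B' \<ge> B" by (auto simp: B'_def)
  have "\<eta> / B' > 0" using e B' by simp
  then obtain C where C: "\<And>n. \<bar>\<Sum>k<n. s k\<bar> \<le> \<eta> / B' * (\<Sum>k<n. b k) + C" using small_sumsD[OF s] by blast
  have "\<bar>\<Sum>k<n. s k\<bar> \<le> \<eta> * (\<Sum>k<n. 1) + (C + \<eta>)" for n
  proof -
    have "B * (real n + 1) \<le> B' * (real n + 1)" using B' by (intro mult_right_mono) auto
    with B[of n] have "(\<Sum>k<n. b k) \<le> B' * (real n + 1)" by linarith
    hence "\<eta> / B' * (\<Sum>k<n. b k) \<le> \<eta> / B' * (B' * (real n + 1))"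
      using e B' by (intro mult_left_mono) auto
    also have "\<dots> = \<eta> * (real n + 1)" using B' by simp
    finally show ?thesis using C[of n] by (simp add: algebra_simps)
  qed
  thus "\<exists>C. \<forall>n. \<bar>\<Sum>k<n. s k\<bar> \<le> \<eta> * (\<Sum>k<n. 1) + C" by blast
qed

lemma sum_delayed:
  fixes s :: "nat \<Rightarrow> real"
  assumes "i \<le> p" "n \<ge> Suc p"
  shows "(\<Sum>k<n. if p < k then s (k - Suc i) else 0) = (\<Sum>m<n - Suc i. s m) - (\<Sum>m<p - i. s m)"
  using assms(2)
proof (induction n rule: dec_induct)
  case base
  show ?case by simp
next
  case (step n)
  have "Suc n - Suc i = Suc (n - Suc i)" using step(1) assms(1) by simp
  thus ?case using step by simp
qed

lemma small_sums_delayed: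
  assumes s: "small_sums s (\<lambda>_. 1)" and i: "i \<le> p"
  shows "small_sums (\<lambda>k. if p < k then s (k - Suc i) else 0) (\<lambda>_. 1)"
  unfolding small_sums_def
proof (intro allI impI)
  fix \<eta> :: real assume e: "\<eta> > 0"
  then obtain C where C: "\<And>n. \<bar>\<Sum>k<n. s k\<bar> \<le> \<eta> * real n + C" using small_sumsD[OF s] by fastforce
  have "\<bar>\<Sum>k<n. if p < k then s (k - Suc i) else 0\<bar> \<le> \<eta> * (\<Sum>k<n. 1) + (\<bar>C\<bar> + \<bar>\<Sum>m<p - i. s m\<bar>)" for n
  proof (cases "n \<ge> Suc p")
    case True
    have "\<eta> * real (n - Suc i) \<le> \<eta> * real n" using e by simp
    hence "\<bar>(\<Sum>m<n - Suc i. s m) - (\<Sum>m<p - i. s m)\<bar> \<le> \<eta> * real n + (\<bar>C\<bar> + \<bar>\<Sum>m<p - i. s m\<bar>)"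
      using C[of "n - Suc i"] by linarith
    thus ?thesis unfolding sum_delayed[OF i True] by simp
  next
    case False
    have "(\<Sum>k<n. if p < k then s (k - Suc i) else 0) = 0" using False by (intro sum.neutral) auto
    moreover have "0 \<le> \<eta> * real n" using e by simp
    ultimately show ?thesis by simp
  qed
  thus "\<exists>C. \<forall>n. \<bar>\<Sum>k<n. if p < k then s (k - Suc i) else 0\<bar> \<le> \<eta> * (\<Sum>k<n. 1) + C" by blast
qed

text \<open>A discrete Gronwall inequality. Dividing by the exponential of twice the accumulated
  gains restores the contraction factor 1/2, because
  \<open>1/2 + b k \<le> exp (2 * b k) / 2\<close>.\<close>

lemma perturbed_contraction_sum:
  fixes L b R :: "nat \<Rightarrow> real"
  assumes L: "\<And>k. L k \<ge> 0" and b: "\<And>k. b k \<ge> 0" and R: "\<And>k. R k \<ge> 0"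
    and rec: "\<And>k. L (Suc k) \<le> (1/2 + b k) * L k + R k"
  shows "(\<Sum>k<n. L k) \<le> 2 * exp (2 * (\<Sum>k<n. b k)) * (L 0 + (\<Sum>k<n. R k))"
proof -
  define E where "E k = exp (2 * (\<Sum>j<k. b j))" for k
  define N where "N k = L k / E k" for k
  have E: "E k \<ge> 1" for k using b by (simp add: E_def sum_nonneg)
  have Emono: "E k \<le> E n" if "k \<le> n" for k
    using b that unfolding E_def by (auto intro!: sum_mono2)
  have ES: "E (Suc k) = E k * exp (2 * b k)" for k by (simp add: E_def exp_add algebra_simps)
  have N0: "N k \<ge> 0" for k using L E[of k] by (simp add: N_def)
  have step: "N (Suc k) \<le> N k / 2 + R k" for k
  proof -
    have Ek: "E k > 0" using E[of k] by simp
    have "1/2 + b k \<le> exp (2 * b k) / 2" using exp_ge_add_one_self[of "2 * b k"] by linarith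
    hence "(1/2 + b k) * L k \<le> exp (2 * b k) / 2 * L k" using L by (intro mult_right_mono)
    hence "L (Suc k) \<le> exp (2 * b k) / 2 * L k + R k" using rec[of k] by linarith
    hence "N (Suc k) \<le> (exp (2 * b k) / 2 * L k + R k) / E (Suc k)"
      unfolding N_def using E[of "Suc k"] by (intro divide_right_mono) auto
    also have "\<dots> = N k / 2 + R k / E (Suc k)"
      using Ek by (simp add: N_def ES add_divide_distrib)
    also have "R k / E (Suc k) \<le> R k" using R[of k] E[of "Suc k"] mult_left_mono[of 1 "E (Suc k)" "R k"]
      by (simp add: divide_le_eq)
    finally show ?thesis by simp
  qed
  have "(\<Sum>k<n. N k) \<le> (\<Sum>k<Suc n. N k)" using N0 by simp
  also have "\<dots> = N 0 + (\<Sum>k<n. N (Suc k))" by (rule sum.lessThan_Suc_shift)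
  also have "\<dots> \<le> N 0 + (\<Sum>k<n. N k / 2 + R k)" by (intro add_left_mono sum_mono step)
  also have "\<dots> = N 0 + (\<Sum>k<n. N k) / 2 + (\<Sum>k<n. R k)" by (simp add: sum.distrib sum_divide_distrib)
  finally have S: "(\<Sum>k<n. N k) \<le> 2 * (L 0 + (\<Sum>k<n. R k))" by (simp add: N_def E_def)
  have "(\<Sum>k<n. L k) \<le> (\<Sum>k<n. E n * N k)"
  proof (rule sum_mono)
    fix k assume "k \<in> {..<n}"
    hence "E k * N k \<le> E n * N k" using Emono N0 by (intro mult_right_mono) auto
    thus "L k \<le> E n * N k" using E[of k] by (simp add: N_def)
  qed
  also have "\<dots> = E n * (\<Sum>k<n. N k)" by (simp add: sum_distrib_left)
  also have "\<dots> \<le> E n * (2 * (L 0 + (\<Sum>k<n. R k)))" using S E[of n] by (intro mult_left_mono) auto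
  finally show ?thesis by (simp add: E_def algebra_simps)
qed

text \<open>The shift by 3 keeps the logarithm at least 1 for every n, including 0.\<close>

definition log3 :: "nat \<Rightarrow> real" where "log3 n = ln (real n + 3)"

lemma log3_ge_1: "log3 n \<ge> 1"
proof -
  have "ln (exp 1) \<le> ln (real n + 3)" using exp_le by (subst ln_le_cancel_iff) auto
  thus ?thesis by (simp add: log3_def)
qed

lemma log3_le_powr:
  assumes "a > 0"
  shows "log3 n \<le> (real n + 3) powr a / a"
  using ln_powr_bound[of "real n + 3" a] assms by (simp add: log3_def)

text \<open>Summation by parts turns logarithmic growth of the partial sums into convergence.\<close>

lemma sum_div_index_bounded:
  fixes a :: "nat \<Rightarrow> real"
  assumes a: "\<And>k. a k \<ge> 0" and C: "\<And>n. (\<Sum>k<n. a k) \<le> C * log3 n"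
  shows "\<exists>B. \<forall>n. (\<Sum>k<n. a k / real k) \<le> B"
proof -
  define A where "A n = (\<Sum>k<n. a k)" for n
  have A0: "A n \<ge> 0" for n using a by (simp add: A_def sum_nonneg)
  have AC: "A n \<le> C * log3 n" for n using C by (simp add: A_def)
  have "0 \<le> C * log3 0" using AC[of 0] A0[of 0] by linarith
  hence C0: "C \<ge> 0" using log3_ge_1[of 0] by (simp add: zero_le_mult_iff)
  \<comment> \<open>Division by 0 yields 0, so the term with k = 0 vanishes on the left but
    contributes minus \<open>A 1\<close> to the weighted sum on the right; the last summand
    compensates for it.\<close>
  have parts: "(\<Sum>k<n. a k / real k) \<le> A n / real n + (\<Sum>k<n. A (Suc k) * (1 / real k - 1 / real (Suc k))) + A 1" for n
  proof (induction n)
    case (Suc n)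
    show ?case
    proof (cases "n = 0")
      case True thus ?thesis using A0[of 1] by simp
    next
      case False
      have "a n / real n = A (Suc n) / real (Suc n) - A n / real n + A (Suc n) * (1 / real n - 1 / real (Suc n))"
      proof -
        have "A (Suc n) * (1 / real n - 1 / real (Suc n)) = A (Suc n) / real n - A (Suc n) / real (Suc n)"
          by (simp add: right_diff_distrib)
        moreover have "a n / real n = A (Suc n) / real n - A n / real n"
          by (simp add: A_def add_divide_distrib)
        ultimately show ?thesis by linarith
      qed
      thus ?thesis using Suc by simp
    qed
  qed (simp add: A0)
  have lg: "log3 (Suc k) \<le> 2 * 4 powr (1/2) * real (Suc k) powr (1/2)" for k
  proof -
    have "log3 (Suc k) \<le> (real (Suc k) + 3) powr (1/2) / (1/2)" by (rule log3_le_powr) simp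
    also have "\<dots> \<le> (4 * real (Suc k)) powr (1/2) / (1/2)"
      by (intro divide_right_mono powr_mono2) auto
    also have "\<dots> = 2 * 4 powr (1/2) * real (Suc k) powr (1/2)" by (subst powr_mult) auto
    finally show ?thesis .
  qed
  have weight: "A (Suc k) * (1 / real k - 1 / real (Suc k)) \<le> C * 8 * real k powr (-3/2)" for k
  proof (cases "k = 0")
    case True
    thus ?thesis using A0[of 1] by simp
  next
    case False
    have eq: "1 / real k - 1 / real (Suc k) = 1 / (real k * real (Suc k))" using False by (simp add: field_simps)
    have "A (Suc k) * (1 / real k - 1 / real (Suc k)) \<le> C * log3 (Suc k) * (1 / real k - 1 / real (Suc k))"
      using False by (intro mult_right_mono AC) (simp add: field_simps)
    also have "\<dots> \<le> C * (2 * 4 powr (1/2) * real (Suc k) powr (1/2)) * (1 / real k - 1 / real (Suc k))"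
      using False C0 by (intro mult_right_mono mult_left_mono lg) (auto simp: field_simps)
    also have "4 powr (1/2) = (2::real)" by (simp add: powr_half_sqrt)
    also note eq
    also have "C * (2 * 2 * real (Suc k) powr (1/2)) * (1 / (real k * real (Suc k)))
        = C * 4 * (real (Suc k) powr (1/2) / real (Suc k) powr 1) / real k" by (simp add: ac_simps)
    also have "real (Suc k) powr (1/2) / real (Suc k) powr 1 = real (Suc k) powr (-1/2)"
      by (simp only: powr_diff[symmetric]) simp
    also have "C * 4 * real (Suc k) powr (-1/2) / real k \<le> C * 4 * real k powr (-1/2) / real k"
      using False C0 by (intro divide_right_mono mult_left_mono powr_mono2') auto
    also have "\<dots> = C * 4 * (real k powr (-1/2) / real k powr 1)" using False by simp
    also have "real k powr (-1/2) / real k powr 1 = real k powr (-3/2)"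
      by (simp only: powr_diff[symmetric]) simp
    also have "C * 4 * real k powr (-3/2) \<le> C * 8 * real k powr (-3/2)"
      using C0 by (intro mult_right_mono mult_left_mono) auto
    finally show ?thesis unfolding eq .
  qed
  have sm: "summable (\<lambda>k. C * 8 * real k powr (-3/2))"
    by (intro summable_mult) (simp add: summable_real_powr_iff)
  have "(\<Sum>k<n. a k / real k) \<le> C * 8 + (\<Sum>k. C * 8 * real k powr (-3/2)) + A 1" for n
  proof -
    have 1: "A n / real n \<le> C * 8"
    proof (cases n)
      case 0 thus ?thesis using C0 by simp
    next
      case (Suc m)
      have "A n / real n \<le> C * log3 n / real n" by (intro divide_right_mono AC) simp
      also have "\<dots> \<le> C * (2 * 4 powr (1/2) * real n powr (1/2)) / real n"
        using lg[of m] C0 unfolding Suc by (intro divide_right_mono mult_left_mono) auto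
      also have "real n powr (1/2) \<le> real n powr 1" using Suc by (intro powr_mono) auto
      hence "C * (2 * 4 powr (1/2) * real n powr (1/2)) / real n \<le> C * (2 * 4 powr (1/2) * real n) / real n"
        using C0 Suc by (intro divide_right_mono mult_left_mono) auto
      also have "\<dots> = C * (2 * 4 powr (1/2))" using Suc by (simp del: of_nat_Suc)
      also have "4 powr (1/2) = (2::real)" by (simp add: powr_half_sqrt)
      finally show ?thesis using C0 by simp
    qed
    have "(\<Sum>k<n. A (Suc k) * (1 / real k - 1 / real (Suc k))) \<le> (\<Sum>k<n. C * 8 * real k powr (-3/2))"
      by (intro sum_mono weight)
    also have "\<dots> \<le> (\<Sum>k. C * 8 * real k powr (-3/2))"
      using C0 by (intro sum_le_suminf sm) auto
    finally show ?thesis using parts[of n] 1 by linarith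
  qed
  thus ?thesis by blast
qed

text \<open>A one-sided little-o of n: only upper bounds matter, and the constant absorbs small
  n.\<close>

definition sublinear :: "(nat \<Rightarrow> real) \<Rightarrow> bool" where
  "sublinear f \<longleftrightarrow> (\<forall>\<eta>>0. \<exists>C. \<forall>n. f n \<le> \<eta> * real n + C)"

lemma sublinearI: "(\<And>\<eta>. \<eta> > 0 \<Longrightarrow> \<exists>C. \<forall>n. f n \<le> \<eta> * real n + C) \<Longrightarrow> sublinear f"
  by (simp add: sublinear_def)

lemma sublinear_add:
  assumes "sublinear f" "sublinear g"
  shows "sublinear (\<lambda>n. f n + g n)"
proof (rule sublinearI)
  fix \<eta> :: real assume "\<eta> > 0"
  hence e: "\<eta> / 2 > 0" by simp
  obtain C D where "\<And>n. f n \<le> \<eta> / 2 * real n + C" "\<And>n. g n \<le> \<eta> / 2 * real n + D"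
    using assms e unfolding sublinear_def by meson
  hence "f n + g n \<le> \<eta> * real n + (C + D)" for n
    by (smt (verit, best) field_sum_of_halves distrib_right)
  thus "\<exists>C. \<forall>n. f n + g n \<le> \<eta> * real n + C" by blast
qed

lemma sublinear_mono:
  assumes "sublinear f" "c \<ge> 0" "\<And>n. g n \<le> c * f n"
  shows "sublinear g"
proof (rule sublinearI)
  fix \<eta> :: real assume e: "\<eta> > 0"
  hence "\<eta> / (c + 1) > 0" using assms(2) by simp
  then obtain C where C: "\<And>n. f n \<le> \<eta> / (c + 1) * real n + C" using assms(1) unfolding sublinear_def by meson
  have "g n \<le> \<eta> * real n + c * C" for n
  proof -
    have "g n \<le> c * (\<eta> / (c + 1) * real n + C)"
      using assms(2,3) C[of n] by (meson mult_left_mono order_trans)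
    also have "\<dots> = c / (c + 1) * (\<eta> * real n) + c * C" by (simp add: algebra_simps)
    also have "c / (c + 1) * (\<eta> * real n) \<le> 1 * (\<eta> * real n)"
      using assms(2) e by (intro mult_right_mono) auto
    finally show ?thesis by simp
  qed
  thus "\<exists>C. \<forall>n. g n \<le> \<eta> * real n + C" by blast
qed

lemma smallo_imp_sublinear:
  assumes "f \<in> o(\<lambda>n. real n)"
  shows "sublinear f"
proof (rule sublinearI)
  fix \<eta> :: real assume e: "\<eta> > 0"
  from landau_o.smallD[OF assms e] obtain N where N: "\<And>n. n \<ge> N \<Longrightarrow> \<bar>f n\<bar> \<le> \<eta> * real n"
    by (auto simp: eventually_sequentially)
  have "f n \<le> \<eta> * real n + (\<Sum>k<N. \<bar>f k\<bar>)" for n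
  proof (cases "n < N")
    case True
    hence "\<bar>f n\<bar> \<le> (\<Sum>k<N. \<bar>f k\<bar>)" by (intro member_le_sum) auto
    moreover have "0 \<le> \<eta> * real n" using e by simp
    ultimately show ?thesis by linarith
  next
    case False
    hence "\<bar>f n\<bar> \<le> \<eta> * real n" using N by simp
    moreover have "0 \<le> (\<Sum>k<N. \<bar>f k\<bar>)" by (simp add: sum_nonneg)
    ultimately show ?thesis by linarith
  qed
  thus "\<exists>C. \<forall>n. f n \<le> \<eta> * real n + C" by blast
qed

lemma powr_sublinear:
  assumes "0 \<le> b" "b < 1"
  shows "sublinear (\<lambda>n. (real n + 3) powr b)"
proof -
  have "((\<lambda>n. (real n + 3) powr b / real n) \<longlongrightarrow> 0) at_top" using assms by real_asymp
  hence "(\<lambda>n. (real n + 3) powr b) \<in> o(\<lambda>n. real n)"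
    by (intro smalloI_tendsto) (auto simp: eventually_at_top_linorder intro: exI[of _ 1])
  thus ?thesis by (rule smallo_imp_sublinear)
qed

lemma log3_times_powr_sublinear:
  assumes "0 \<le> b" "b < 1"
  shows "sublinear (\<lambda>n. log3 n * (real n + 3) powr b)"
proof -
  define a where "a = (1 - b) / 2"
  have a: "a > 0" "a + b < 1" using assms by (auto simp: a_def field_simps)
  show ?thesis
  proof (rule sublinear_mono[OF powr_sublinear[of "a + b"]])
    fix n
    have "log3 n * (real n + 3) powr b \<le> ((real n + 3) powr a / a) * (real n + 3) powr b"
      by (intro mult_right_mono log3_le_powr a) simp
    also have "\<dots> = 1 / a * (real n + 3) powr (a + b)" by (simp add: powr_add)
    finally show "log3 n * (real n + 3) powr b \<le> 1 / a * (real n + 3) powr (a + b)" .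
  qed (use a assms in auto)
qed

lemma log3_sublinear: "sublinear log3"
  using log3_times_powr_sublinear[of 0] by simp

context least_squares
begin

text \<open>The self-normalization makes both noise sums negligible against the terms they perturb.\<close>

lemma lyap_log_bound:
  assumes N1: "small_sums (\<lambda>k. pred_err k / (1 + leverage k) * W k) (\<lambda>k. (pred_err k / (1 + leverage k))\<^sup>2)"
    and N2: "small_sums (\<lambda>k. leverage k / (1 + leverage k) * ((W k)\<^sup>2 - s)) (\<lambda>k. leverage k / (1 + leverage k))"
    and s: "s \<ge> 0"
  shows "\<exists>C\<ge>0. \<forall>n. lyap n + (\<Sum>k<n. wgt_err k) \<le> C * (1 + ln (energy n))"
proof -
  define h where "h k = pred_err k / (1 + leverage k)" for k
  define f where "f k = leverage k / (1 + leverage k)" for k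
  have g: "1 + leverage k \<ge> 1" for k using leverage_nonneg[of k] by simp
  have f0: "f k \<ge> 0" for k using leverage_nonneg[of k] by (simp add: f_def)
  \<comment> \<open>The noise sum occurs with factor 2 in the balance, so 1/4 costs half of the sum
    of \<open>wgt_err\<close>, which the left-hand side can absorb.\<close>
  obtain C1 where C1: "\<And>n. \<bar>\<Sum>k<n. h k * W k\<bar> \<le> 1/4 * (\<Sum>k<n. (h k)\<^sup>2) + C1"
    using small_sumsD[OF N1, of "1/4"] by (auto simp: h_def)
  obtain C2 where C2: "\<And>n. \<bar>\<Sum>k<n. f k * ((W k)\<^sup>2 - s)\<bar> \<le> 1 * (\<Sum>k<n. f k) + C2"
    using small_sumsD[OF N2, of 1] by (auto simp: f_def)
  have hw: "(h k)\<^sup>2 \<le> wgt_err k" for k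
  proof -
    have "(pred_err k)\<^sup>2 / (1 + leverage k)\<^sup>2 \<le> (pred_err k)\<^sup>2 / (1 + leverage k)"
      using g[of k] by (intro divide_left_mono) (auto simp: power2_eq_square)
    thus ?thesis by (simp add: h_def wgt_err_def power_divide)
  qed
  define lF where "lF = ln (fact d :: real)"
  have lF: "lF \<ge> 0" by (simp add: lF_def)
  define D where "D = 2 * (\<bar>lyap 0\<bar> + 2 * \<bar>C1\<bar> + \<bar>C2\<bar> + (1 + s) * (lF + real d))"
  have "lyap n + (\<Sum>k<n. wgt_err k) \<le> D * (1 + ln (energy n))" for n
  proof -
    define A where "A = (\<Sum>k<n. wgt_err k)"
    define l where "l = ln (energy n)"
    have l0: "l \<ge> 0" using energy_ge_1[of n] by (simp add: l_def)
    have l1: "lyap n \<ge> 0" by (simp add: lyap_def quad_nonneg)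
    have "(\<Sum>k<n. (h k)\<^sup>2) \<le> A" unfolding A_def by (intro sum_mono hw)
    hence 1: "- 2 * (\<Sum>k<n. h k * W k) \<le> A / 2 + 2 * \<bar>C1\<bar>" using C1[of n] by linarith
    have F: "(\<Sum>k<n. f k) \<le> lF + real d * l"
      using sum_leverage_fraction_le[of n] by (simp add: f_def lF_def l_def)
    have "(\<Sum>k<n. f k * (W k)\<^sup>2) = (\<Sum>k<n. f k * ((W k)\<^sup>2 - s)) + s * (\<Sum>k<n. f k)"
      by (simp add: algebra_simps sum.distrib sum_subtractf sum_distrib_left)
    also have "\<dots> \<le> (1 + s) * (\<Sum>k<n. f k) + \<bar>C2\<bar>" using C2[of n] by (simp add: algebra_simps)
    also have "\<dots> \<le> (1 + s) * (lF + real d * l) + \<bar>C2\<bar>" using F s by (intro add_right_mono mult_left_mono) auto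
    finally have 2: "(\<Sum>k<n. f k * (W k)\<^sup>2) \<le> (1 + s) * (lF + real d * l) + \<bar>C2\<bar>" .
    have "lyap n + A = lyap 0 - 2 * (\<Sum>k<n. h k * W k) + (\<Sum>k<n. f k * (W k)\<^sup>2)"
      using lyap_sum[of n] by (simp add: A_def h_def f_def)
    hence "lyap n + A \<le> \<bar>lyap 0\<bar> + 2 * \<bar>C1\<bar> + \<bar>C2\<bar> + (1 + s) * (lF + real d * l) + A / 2"
      using 1 2 by linarith
    moreover have "y + a \<le> 2 * Z" if "y + a \<le> Z + a / 2" "0 \<le> y" for y a Z :: real using that by linarith
    ultimately have "lyap n + A \<le> 2 * (\<bar>lyap 0\<bar> + 2 * \<bar>C1\<bar> + \<bar>C2\<bar> + (1 + s) * (lF + real d * l))"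
      using l1 by blast
    also have "\<dots> \<le> D * (1 + l)"
    proof -
      have "0 \<le> (\<bar>lyap 0\<bar> + 2 * \<bar>C1\<bar> + \<bar>C2\<bar>) * l + (1 + s) * lF * l + (1 + s) * real d"
        using l0 lF s by (intro add_nonneg_nonneg mult_nonneg_nonneg) auto
      thus ?thesis by (simp add: D_def algebra_simps)
    qed
    finally show ?thesis by (simp add: A_def l_def)
  qed
  moreover have "D \<ge> 0" using lF s by (simp add: D_def)
  ultimately show ?thesis by blast
qed

end

subsection \<open>Trajectories of the closed loop\<close>

text \<open>The noise enters a trajectory only through \<open>N1\<close>-\<open>N5\<close> and \<open>V_growth\<close>. The regression equation
  holds from time \<open>1\<close> on, so that \<open>W 0\<close> is unrelated to \<open>V\<close>.\<close>

locale closed_loop = least_squares d \<Phi> e W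
  for d :: nat and \<Phi> :: "nat \<Rightarrow> nat \<Rightarrow> real" and e W +
  fixes p :: nat and \<theta> :: "nat \<Rightarrow> real" and \<rho> \<sigma> \<gamma> :: real and X U :: "int \<Rightarrow> real" and \<epsilon> V x :: "nat \<Rightarrow> real"
  assumes d: "d = p + 2"
    and \<Phi>_def: "\<And>k i. \<Phi> k i = (if i \<le> p then X (int k - int i) else U (int k - 1))"
    and \<rho>: "\<bar>\<rho>\<bar> < 1" "\<rho> \<noteq> 0" and \<sigma>: "\<sigma> > 0"
    and model: "\<And>n. X (int n + 1) = (\<Sum>i<p. \<theta> i * X (int n - int i)) + U (int n) + \<epsilon> (Suc n)"
    and \<epsilon>_Suc: "\<And>n. \<epsilon> (Suc n) = \<rho> * \<epsilon> n + V (Suc n)"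
    and W_eq: "\<And>n. n \<ge> 1 \<Longrightarrow> W n = V (Suc n)"
    and tracking: "\<And>n. n \<ge> 1 \<Longrightarrow> X (int n + 1) = x (Suc n) + pred_err n + V (Suc n)"
    and x_sublinear: "sublinear (\<lambda>n. \<Sum>k=1..n. (x k)\<^sup>2)"
    and N1: "small_sums (\<lambda>k. pred_err k / (1 + leverage k) * V (Suc k)) (\<lambda>k. (pred_err k / (1 + leverage k))\<^sup>2)"
    and N2: "small_sums (\<lambda>k. leverage k / (1 + leverage k) * ((V (Suc k))\<^sup>2 - \<sigma>\<^sup>2)) (\<lambda>k. leverage k / (1 + leverage k))"
    and N3: "small_sums (\<lambda>k. (V (Suc k))\<^sup>2 - \<sigma>\<^sup>2) (\<lambda>_. 1)"
    and N4: "\<And>j. j \<ge> 1 \<Longrightarrow> small_sums (\<lambda>k. (if j \<le> k then V (Suc k - j) else 0) * V (Suc k))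
                (\<lambda>k. (if j \<le> k then V (Suc k - j) else 0)\<^sup>2)"
    and N5: "\<And>j. small_sums (\<lambda>k. (if j \<le> k then \<epsilon> (k - j) else 0) * V (Suc k))
                (\<lambda>k. (if j \<le> k then \<epsilon> (k - j) else 0)\<^sup>2)"
    and \<gamma>: "0 < \<gamma>" "\<gamma> < 1" and V_growth: "\<exists>C. \<forall>k. (V (Suc k))\<^sup>2 \<le> C * (real (Suc k)) powr \<gamma>"
begin

lemma log_bound: "\<exists>C\<ge>0. \<forall>n. lyap n + (\<Sum>k<n. wgt_err k) \<le> C * (1 + ln (energy n))"
  by (rule lyap_log_bound[OF small_sums_modify_first[OF N1] small_sums_modify_first[OF N2]])
    (auto simp: W_eq)

lemma V_square_sum: "\<exists>C>0. \<forall>n. (\<Sum>k<n. (V (Suc k))\<^sup>2) \<le> C * (real n + 1)"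
proof -
  obtain C where C: "\<And>n. \<bar>\<Sum>k<n. (V (Suc k))\<^sup>2 - \<sigma>\<^sup>2\<bar> \<le> 1 * (\<Sum>k<n. 1) + C"
    using small_sumsD[OF N3, of 1] by auto
  have "(\<Sum>k<n. (V (Suc k))\<^sup>2) \<le> (\<sigma>\<^sup>2 + 1 + \<bar>C\<bar>) * (real n + 1)" for n
  proof -
    have "(\<Sum>k<n. (V (Suc k))\<^sup>2) \<le> \<sigma>\<^sup>2 * real n + real n + \<bar>C\<bar>" using C[of n] by (simp add: sum_subtractf mult.commute)
    moreover have "0 \<le> \<bar>C\<bar> * real n" "0 \<le> \<sigma>\<^sup>2" by simp_all
    moreover have "(\<sigma>\<^sup>2 + 1 + \<bar>C\<bar>) * (real n + 1) = \<sigma>\<^sup>2 * real n + real n + \<bar>C\<bar> * real n + \<sigma>\<^sup>2 + 1 + \<bar>C\<bar>"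
      by (simp add: algebra_simps)
    ultimately show ?thesis by linarith
  qed
  moreover have "\<sigma>\<^sup>2 + 1 + \<bar>C\<bar> > 0" by (simp add: add_pos_nonneg add_nonneg_pos)
  ultimately show ?thesis by blast
qed

text \<open>The squared autoregression, summed. It yields the linear bound on the energy of
  \<epsilon> and, with the boundary term under control, also its exact asymptotic mean.\<close>

lemma \<epsilon>_balance:
  "(1 - \<rho>\<^sup>2) * (\<Sum>k<n. (\<epsilon> k)\<^sup>2) + (\<epsilon> n)\<^sup>2 = (\<epsilon> 0)\<^sup>2 + 2 * \<rho> * (\<Sum>k<n. \<epsilon> k * V (Suc k)) + (\<Sum>k<n. (V (Suc k))\<^sup>2)"
proof (induction n)
  case (Suc n)
  have "(\<epsilon> (Suc n))\<^sup>2 = \<rho>\<^sup>2 * (\<epsilon> n)\<^sup>2 + 2 * \<rho> * (\<epsilon> n * V (Suc n)) + (V (Suc n))\<^sup>2"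
    by (simp add: \<epsilon>_Suc power2_eq_square algebra_simps)
  moreover have "(1 - \<rho>\<^sup>2) * ((\<Sum>k<n. (\<epsilon> k)\<^sup>2) + (\<epsilon> n)\<^sup>2)
      = (1 - \<rho>\<^sup>2) * (\<Sum>k<n. (\<epsilon> k)\<^sup>2) + (\<epsilon> n)\<^sup>2 - \<rho>\<^sup>2 * (\<epsilon> n)\<^sup>2" by (simp add: algebra_simps)
  moreover have "2 * \<rho> * ((\<Sum>k<n. \<epsilon> k * V (Suc k)) + \<epsilon> n * V (Suc n))
      = 2 * \<rho> * (\<Sum>k<n. \<epsilon> k * V (Suc k)) + 2 * \<rho> * (\<epsilon> n * V (Suc n))" by (rule distrib_left)
  ultimately show ?case using Suc unfolding sum.lessThan_Suc by linarith
qed simp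

lemma \<epsilon>V_small: "small_sums (\<lambda>k. \<epsilon> k * V (Suc k)) (\<lambda>k. (\<epsilon> k)\<^sup>2)"
  using N5[of 0] by simp

lemma \<rho>2: "1 - \<rho>\<^sup>2 > 0"
  using \<rho>(1) by (simp add: abs_square_less_1)

lemma \<epsilon>_square_sum: "\<exists>C>0. \<forall>n. (\<Sum>k<n. (\<epsilon> k)\<^sup>2) \<le> C * (real n + 1)"
proof -
  define \<kappa> where "\<kappa> = 1 - \<rho>\<^sup>2"
  have k: "\<kappa> > 0" using \<rho>2 by (simp add: \<kappa>_def)
  obtain C where C: "\<And>n. \<bar>\<Sum>k<n. \<epsilon> k * V (Suc k)\<bar> \<le> \<kappa>/4 * (\<Sum>k<n. (\<epsilon> k)\<^sup>2) + C"
    using small_sumsD[OF \<epsilon>V_small, of "\<kappa>/4"] k by auto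
  obtain B where B: "B > 0" "\<And>n. (\<Sum>k<n. (V (Suc k))\<^sup>2) \<le> B * (real n + 1)" using V_square_sum by blast
  have "(\<Sum>k<n. (\<epsilon> k)\<^sup>2) \<le> 2 / \<kappa> * ((\<epsilon> 0)\<^sup>2 + 2 * \<bar>C\<bar> + B) * (real n + 1)" for n
  proof -
    define Q where "Q = (\<Sum>k<n. (\<epsilon> k)\<^sup>2)"
    have "2 * \<rho> * (\<Sum>k<n. \<epsilon> k * V (Suc k)) \<le> \<bar>2 * \<rho> * (\<Sum>k<n. \<epsilon> k * V (Suc k))\<bar>" by simp
    also have "\<dots> = \<bar>\<rho>\<bar> * (2 * \<bar>\<Sum>k<n. \<epsilon> k * V (Suc k)\<bar>)" by (simp add: abs_mult)
    also have "\<dots> \<le> 1 * (2 * \<bar>\<Sum>k<n. \<epsilon> k * V (Suc k)\<bar>)" using \<rho> by (intro mult_right_mono) auto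
    also have "\<dots> \<le> \<kappa>/2 * Q + 2 * \<bar>C\<bar>" using C[of n] unfolding Q_def by linarith
    finally have "\<kappa> * Q \<le> (\<epsilon> 0)\<^sup>2 + \<kappa>/2 * Q + 2 * \<bar>C\<bar> + B * (real n + 1)"
      using \<epsilon>_balance[of n] B(2)[of n] zero_le_power2[of "\<epsilon> n"] unfolding Q_def \<kappa>_def by linarith
    moreover have "\<kappa>/2 * Q = \<kappa> * Q - \<kappa>/2 * Q" by simp
    ultimately have "\<kappa>/2 * Q \<le> (\<epsilon> 0)\<^sup>2 + 2 * \<bar>C\<bar> + B * (real n + 1)" by linarith
    moreover define Y where "Y = (\<epsilon> 0)\<^sup>2 + 2 * \<bar>C\<bar>"
    moreover have "Y * 1 \<le> Y * (real n + 1)" unfolding Y_def by (intro mult_left_mono) auto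
    ultimately have "\<kappa>/2 * Q \<le> (Y + B) * (real n + 1)" by (simp add: distrib_right)
    thus ?thesis unfolding Q_def[symmetric] Y_def[symmetric] using k by (simp add: field_simps)
  qed
  moreover have "2 / \<kappa> * ((\<epsilon> 0)\<^sup>2 + 2 * \<bar>C\<bar> + B) > 0" using k B by (intro mult_pos_pos add_nonneg_pos) auto
  ultimately show ?thesis by blast
qed

lemma \<epsilon>_growth:
  assumes g: "0 \<le> g" and V: "\<And>k. (V (Suc k))\<^sup>2 \<le> C * (real (Suc k)) powr g"
  shows "\<exists>D. \<forall>n. (\<epsilon> n)\<^sup>2 \<le> D * (real n + 1) powr g"
proof -
  define r where "r = \<bar>\<rho>\<bar>"
  have r: "0 \<le> r" "r < 1" using \<rho> by (auto simp: r_def)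
  have C0: "C \<ge> 0" using order_trans[OF zero_le_power2 V[of 0]] by simp
  \<comment> \<open>The constant satisfies \<open>sqrt C \<le> (1 - r) * E\<close>, so the induction
    closes: a share r comes from the previous value, the share 1 - r from the new noise.\<close>
  define E where "E = \<bar>\<epsilon> 0\<bar> + sqrt C / (1 - r)"
  have "(1 - r) * E = (1 - r) * \<bar>\<epsilon> 0\<bar> + sqrt C" using r by (simp add: E_def distrib_left)
  hence E: "E \<ge> 0" "sqrt C \<le> (1 - r) * E" using r C0 by (auto simp: E_def)
  have "\<bar>\<epsilon> n\<bar> \<le> E * (real n + 1) powr (g / 2)" for n
  proof (induction n)
    case 0 thus ?case using r C0 by (simp add: E_def)
  next
    case (Suc n)
    let ?m = "(real (Suc n) + 1) powr (g / 2)"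
    have mm: "(real n + 1) powr (g/2) \<le> ?m" using g by (intro powr_mono2) auto
    have "\<bar>V (Suc n)\<bar> = sqrt ((V (Suc n))\<^sup>2)" by simp
    also have "\<dots> \<le> sqrt (C * (real (Suc n)) powr g)" using V by (intro real_sqrt_le_mono)
    also have "\<dots> = sqrt C * (real (Suc n)) powr (g/2)"
      by (simp add: real_sqrt_mult powr_half_sqrt[symmetric] powr_powr)
    also have "\<dots> \<le> sqrt C * ?m" using g C0 by (intro mult_left_mono powr_mono2) auto
    finally have "\<bar>V (Suc n)\<bar> \<le> (1 - r) * E * ?m" using E(2) by (smt (verit) mult_right_mono powr_ge_zero)
    moreover have "\<bar>\<epsilon> (Suc n)\<bar> \<le> r * \<bar>\<epsilon> n\<bar> + \<bar>V (Suc n)\<bar>"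
      unfolding \<epsilon>_Suc r_def by (rule order_trans[OF abs_triangle_ineq]) (simp add: abs_mult)
    moreover have "r * \<bar>\<epsilon> n\<bar> \<le> r * (E * ?m)"
      using Suc mult_left_mono[OF mm E(1)] r(1) by (intro mult_left_mono) auto
    ultimately show ?case by (simp add: algebra_simps)
  qed
  hence "(\<epsilon> n)\<^sup>2 \<le> (E * (real n + 1) powr (g / 2))\<^sup>2" for n
    using E(1) by (subst abs_le_square_iff[symmetric]) (auto simp: abs_mult)
  moreover have "((real n + 1) powr (g / 2))\<^sup>2 = (real n + 1) powr g" for n
    by (simp add: power2_eq_square powr_add[symmetric])
  ultimately have "(\<epsilon> n)\<^sup>2 \<le> E\<^sup>2 * (real n + 1) powr g" for n by (simp add: power_mult_distrib)
  thus ?thesis by blast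
qed

text \<open>In the balance, the cross sum and the centered squares of \<open>V\<close> are
  negligible against n. The boundary term is negligible because \<gamma> is below 1.\<close>

lemma \<epsilon>_centered_small: "small_sums (\<lambda>k. (\<epsilon> k)\<^sup>2 - \<sigma>\<^sup>2 / (1 - \<rho>\<^sup>2)) (\<lambda>_. 1)"
  unfolding small_sums_def
proof (intro allI impI)
  fix \<eta> :: real assume eta: "\<eta> > 0"
  define \<kappa> where "\<kappa> = 1 - \<rho>\<^sup>2"
  have k: "\<kappa> > 0" using \<rho>2 by (simp add: \<kappa>_def)
  define \<eta>' where "\<eta>' = \<eta> * \<kappa> / 4"
  have eta': "\<eta>' > 0" using eta k by (simp add: \<eta>'_def)
  obtain E where E: "E > 0" "\<And>n. (\<Sum>k<n. (\<epsilon> k)\<^sup>2) \<le> E * (real n + 1)" using \<epsilon>_square_sum by blast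
  have eV: "small_sums (\<lambda>k. \<epsilon> k * V (Suc k)) (\<lambda>_. 1)" by (rule small_sums_linear[OF \<epsilon>V_small E(2)])
  obtain C1 where C1: "\<And>n. \<bar>\<Sum>k<n. \<epsilon> k * V (Suc k)\<bar> \<le> \<eta>' * real n + C1"
    using small_sumsD[OF eV eta'] by auto
  obtain C2 where C2: "\<And>n. \<bar>\<Sum>k<n. (V (Suc k))\<^sup>2 - \<sigma>\<^sup>2\<bar> \<le> \<eta>' * real n + C2"
    using small_sumsD[OF N3 eta'] by auto
  obtain C where "\<And>k. (V (Suc k))\<^sup>2 \<le> C * (real (Suc k)) powr \<gamma>" using V_growth by blast
  then obtain D where D: "\<And>n. (\<epsilon> n)\<^sup>2 \<le> D * (real n + 1) powr \<gamma>" using \<epsilon>_growth[of \<gamma> C] \<gamma> by auto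
  have D0: "D \<ge> 0" using order_trans[OF zero_le_power2 D[of 0]] by simp
  have "sublinear (\<lambda>n. (\<epsilon> n)\<^sup>2)"
  proof (rule sublinear_mono[OF powr_sublinear[of \<gamma>]])
    fix n show "(\<epsilon> n)\<^sup>2 \<le> D * (real n + 3) powr \<gamma>"
      using D0 \<gamma> by (intro order_trans[OF D[of n]] mult_left_mono powr_mono2) auto
  qed (use \<gamma> D0 in auto)
  then obtain C3 where C3: "\<And>n. (\<epsilon> n)\<^sup>2 \<le> \<eta>' * real n + C3" using eta' unfolding sublinear_def by blast
  have "\<bar>\<Sum>k<n. (\<epsilon> k)\<^sup>2 - \<sigma>\<^sup>2 / \<kappa>\<bar> \<le> \<eta> * (\<Sum>k<n. 1) + ((\<epsilon> 0)\<^sup>2 + 2 * \<bar>C1\<bar> + \<bar>C2\<bar> + \<bar>C3\<bar>) / \<kappa>" for n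
  proof -
    define S where "S = (\<Sum>k<n. (\<epsilon> k)\<^sup>2 - \<sigma>\<^sup>2 / \<kappa>)"
    define m where "m = (\<Sum>k<n. \<epsilon> k * V (Suc k))"
    have "\<kappa> * S = \<kappa> * (\<Sum>k<n. (\<epsilon> k)\<^sup>2) - \<sigma>\<^sup>2 * real n"
      using k by (simp add: S_def sum_subtractf algebra_simps)
    also have "\<dots> = (\<epsilon> 0)\<^sup>2 - (\<epsilon> n)\<^sup>2 + 2 * \<rho> * m + (\<Sum>k<n. (V (Suc k))\<^sup>2 - \<sigma>\<^sup>2)"
      using \<epsilon>_balance[of n] by (simp add: \<kappa>_def sum_subtractf m_def)
    finally have 1: "\<kappa> * S = (\<epsilon> 0)\<^sup>2 - (\<epsilon> n)\<^sup>2 + 2 * \<rho> * m + (\<Sum>k<n. (V (Suc k))\<^sup>2 - \<sigma>\<^sup>2)" .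
    have "\<bar>2 * \<rho> * m\<bar> \<le> 2 * \<bar>m\<bar>" using \<rho> by (simp add: abs_mult mult_left_le_one_le)
    hence "\<bar>\<kappa> * S\<bar> \<le> (\<epsilon> 0)\<^sup>2 + (\<epsilon> n)\<^sup>2 + 2 * \<bar>m\<bar> + \<bar>\<Sum>k<n. (V (Suc k))\<^sup>2 - \<sigma>\<^sup>2\<bar>"
      using zero_le_power2[of "\<epsilon> 0"] zero_le_power2[of "\<epsilon> n"] unfolding 1 by linarith
    also have "\<dots> \<le> 4 * \<eta>' * real n + ((\<epsilon> 0)\<^sup>2 + 2 * \<bar>C1\<bar> + \<bar>C2\<bar> + \<bar>C3\<bar>)"
      using C1[of n] C2[of n] C3[of n] by (simp add: m_def)
    finally have "\<bar>S\<bar> * \<kappa> \<le> \<eta> * \<kappa> * real n + ((\<epsilon> 0)\<^sup>2 + 2 * \<bar>C1\<bar> + \<bar>C2\<bar> + \<bar>C3\<bar>)"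
      using k by (simp add: abs_mult \<eta>'_def mult.commute)
    hence "\<bar>S\<bar> \<le> (\<eta> * \<kappa> * real n + ((\<epsilon> 0)\<^sup>2 + 2 * \<bar>C1\<bar> + \<bar>C2\<bar> + \<bar>C3\<bar>)) / \<kappa>"
      using k by (simp add: le_divide_eq)
    thus ?thesis using k by (simp add: S_def add_divide_distrib)
  qed
  thus "\<exists>C. \<forall>n. \<bar>\<Sum>k<n. (\<epsilon> k)\<^sup>2 - \<sigma>\<^sup>2 / (1 - \<rho>\<^sup>2)\<bar> \<le> \<eta> * (\<Sum>k<n. 1) + C" unfolding \<kappa>_def by blast
qed

end

section \<open>Growth of the regressors in the closed loop\<close>

context closed_loop
begin

text \<open>A discounted sum of past squares. With the discount 1/2 it dominates each of the p
  delays up to the factor 2^p, so the memory of the closed loop is compressed into one scalar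
  first-order recursion.\<close>

primrec agg :: "nat \<Rightarrow> real" where
  "agg 0 = (X 0)\<^sup>2 + (\<epsilon> 0)\<^sup>2 + (\<Sum>i\<le>p. (X (- int i))\<^sup>2) + (U (-1))\<^sup>2"
| "agg (Suc k) = agg k / 2 + (X (int (Suc k)))\<^sup>2 + (\<epsilon> (Suc k))\<^sup>2"

lemma agg_nonneg: "agg k \<ge> 0"
  by (induction k) (auto simp: sum_nonneg)

lemma agg_ge: "(X (int k))\<^sup>2 \<le> agg k" "(\<epsilon> k)\<^sup>2 \<le> agg k"
  using agg_nonneg by (cases k; simp add: sum_nonneg add_nonneg_nonneg)+

lemma agg_delay: "agg k \<le> 2 ^ i * agg (k + i)"
proof (induction i)
  case (Suc i)
  have "agg (k + i) \<le> 2 * agg (Suc (k + i))" by simp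
  hence "2 ^ i * agg (k + i) \<le> 2 ^ i * (2 * agg (Suc (k + i)))" by (intro mult_left_mono) auto
  from order_trans[OF Suc this] show ?case by (simp del: agg.simps add: ac_simps)
qed simp

lemma X_square_le_agg:
  assumes i: "i \<le> p"
  shows "(X (int k - int i))\<^sup>2 \<le> 2 ^ p * agg k"
proof (cases "i \<le> k")
  case True
  hence "(X (int k - int i))\<^sup>2 \<le> agg (k - i)" using agg_ge(1)[of "k - i"] by (simp add: of_nat_diff)
  also have "\<dots> \<le> 2 ^ i * agg k" using agg_delay[of "k - i" i] True by simp
  also have "\<dots> \<le> 2 ^ p * agg k" using i agg_nonneg by (intro mult_right_mono power_increasing) auto
  finally show ?thesis .
next
  case False
  hence e: "int k - int i = - int (i - k)" by simp
  have "(X (- int (i - k)))\<^sup>2 \<le> (\<Sum>j\<le>p. (X (- int j))\<^sup>2)"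
    using i by (intro member_le_sum[where f="\<lambda>j. (X (- int j))\<^sup>2"]) auto
  also have "\<dots> \<le> agg 0" by simp
  also have "\<dots> \<le> 2 ^ k * agg k" using agg_delay[of 0 k] by simp
  also have "\<dots> \<le> 2 ^ p * agg k" using i False agg_nonneg by (intro mult_right_mono power_increasing) auto
  finally show ?thesis unfolding e .
qed

lemma U_eq: "U (int (Suc n) - 1) = X (int (Suc n)) - (\<Sum>i<p. \<theta> i * X (int (Suc n) - int (Suc i))) - \<epsilon> (Suc n)"
  using model[of n] by (simp add: algebra_simps)

text \<open>The input in the regressor is recovered from the model equation in terms of outputs and
  \<epsilon>; at time 0 it is part of the initial value of \<open>agg\<close>.\<close>

lemma regressor_bound: "\<exists>C>0. \<forall>k. dot (\<Phi> k) (\<Phi> k) \<le> C * agg k"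
proof -
  define T where "T = (\<Sum>i<p. (\<theta> i)\<^sup>2)"
  define B where "B = 3 * (1 + T * (real p * 2 ^ p) + 1)"
  have T0: "T \<ge> 0" by (simp add: T_def sum_nonneg)
  have U: "(U (int k - 1))\<^sup>2 \<le> B * agg k" for k
  proof (cases k)
    case 0
    have "(U (-1))\<^sup>2 \<le> agg 0" by (simp add: sum_nonneg)
    also have "\<dots> \<le> B * agg 0" using T0 agg_nonneg[of 0] by (intro mult_le_cancel_right1[THEN iffD2]) (auto simp: B_def)
    finally show ?thesis using 0 by simp
  next
    case (Suc n)
    define S where "S = (\<Sum>i<p. \<theta> i * X (int (Suc n) - int (Suc i)))"
    have "S\<^sup>2 \<le> T * (\<Sum>i<p. (X (int (Suc n) - int (Suc i)))\<^sup>2)"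
      unfolding S_def T_def by (rule Cauchy_Schwarz_ineq_sum)
    also have "\<dots> \<le> T * (\<Sum>i<p. 2 ^ p * agg k)"
      using T0 unfolding Suc by (intro mult_left_mono sum_mono X_square_le_agg) auto
    finally have S2: "S\<^sup>2 \<le> T * (real p * 2 ^ p) * agg k" by simp
    have "(U (int k - 1))\<^sup>2 \<le> 3 * ((X (int k))\<^sup>2 + S\<^sup>2 + (\<epsilon> k)\<^sup>2)"
      unfolding Suc U_eq S_def[symmetric] by (rule square_diff3_le)
    also have "\<dots> \<le> 3 * (agg k + T * (real p * 2 ^ p) * agg k + agg k)"
      using agg_ge[of k] S2 by (intro mult_left_mono add_mono) auto
    also have "\<dots> = B * agg k" by (simp add: B_def algebra_simps)
    finally show ?thesis .
  qed
  have "dot (\<Phi> k) (\<Phi> k) \<le> (real (Suc p) * 2 ^ p + B) * agg k" for k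
  proof -
    have "dot (\<Phi> k) (\<Phi> k) = (\<Sum>i<Suc p. (X (int k - int i))\<^sup>2) + (U (int k - 1))\<^sup>2"
      unfolding dot_def by (simp add: d \<Phi>_def power2_eq_square)
    also have "\<dots> \<le> (\<Sum>i<Suc p. 2 ^ p * agg k) + B * agg k"
      by (intro add_mono sum_mono X_square_le_agg U) auto
    finally show ?thesis by (simp add: algebra_simps)
  qed
  moreover have "real (Suc p) * 2 ^ p + B > 0" using T0 by (auto simp: B_def intro!: add_pos_nonneg)
  ultimately show ?thesis by blast
qed

text \<open>Tracking expresses the new output by the reference, the prediction error and the noise.
  The squared prediction error is \<open>wgt_err k\<close> times \<open>1 + leverage k\<close>,
  hence at most \<open>2 * wgt_err k\<close> plus a gain \<open>b k * wgt_err k\<close> times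
  \<open>agg k\<close>, up to a constant. The gain \<open>b\<close> is left open since two choices
  of it are needed.\<close>

lemma energy_growth:
  "\<exists>C>0. \<exists>K>0. \<forall>b. (\<forall>k. b k \<ge> 0) \<longrightarrow> (\<forall>k. leverage k \<le> 1 + b k * dot (\<Phi> k) (\<Phi> k)) \<longrightarrow>
     (\<forall>n. energy n \<le> C * exp (K * (\<Sum>k<n. b k * wgt_err k)) * (real n + 1 + (\<Sum>k<n. wgt_err k)))"
proof -
  obtain C1 where C1: "C1 > 0" "\<And>k. dot (\<Phi> k) (\<Phi> k) \<le> C1 * agg k" using regressor_bound by blast
  obtain CV where CV: "CV > 0" "\<And>n. (\<Sum>k<n. (V (Suc k))\<^sup>2) \<le> CV * (real n + 1)" using V_square_sum by blast
  obtain CE where CE: "CE > 0" "\<And>n. (\<Sum>k<n. (\<epsilon> k)\<^sup>2) \<le> CE * (real n + 1)" using \<epsilon>_square_sum by blast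
  obtain CX where CX: "\<And>n. (\<Sum>k=1..n. (x k)\<^sup>2) \<le> 1 * real n + CX"
    using x_sublinear[unfolded sublinear_def, rule_format, of 1] by auto
  define D where "D = 6 + 3 * (1 + \<bar>CX\<bar>) + 3 * CV + 2 * CE + (X 1)\<^sup>2 + agg 0"
  have D0: "D > 0" using CV CE agg_nonneg[of 0] unfolding D_def by (intro add_pos_nonneg) auto
  define C where "C = 1 + C1 * 2 * D"
  have C0: "C > 0" using C1 D0 by (simp add: C_def add_pos_pos)
  have "energy n \<le> C * exp (6 * C1 * (\<Sum>k<n. b k * wgt_err k)) * (real n + 1 + (\<Sum>k<n. wgt_err k))"
    if b: "\<And>k. b k \<ge> 0" and lev: "\<And>k. leverage k \<le> 1 + b k * dot (\<Phi> k) (\<Phi> k)" for b n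
  proof -
    \<comment> \<open>The forcing term. The control at time 0 is arbitrary, so the square of
      \<open>X 1\<close> is added as it is.\<close>
    define R where "R k = 6 * wgt_err k + 3 * (x (Suc k))\<^sup>2 + 3 * (V (Suc k))\<^sup>2 + (\<epsilon> (Suc k))\<^sup>2
      + (if k = 0 then (X 1)\<^sup>2 else 0)" for k
    have R0: "R k \<ge> 0" for k using wgt_err_nonneg[of k] by (simp add: R_def)
    define A where "A = (\<Sum>k<n. wgt_err k)"
    have A0: "A \<ge> 0" using wgt_err_nonneg by (simp add: A_def sum_nonneg)
    have pe: "(pred_err k)\<^sup>2 \<le> 2 * wgt_err k + C1 * (b k * wgt_err k) * agg k" for k
    proof -
      have "(pred_err k)\<^sup>2 \<le> wgt_err k * (2 + b k * (C1 * agg k))"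
        unfolding pred_err_square
        using lev[of k] mult_left_mono[OF C1(2) b, of k k] wgt_err_nonneg by (intro mult_left_mono) auto
      thus ?thesis by (simp add: algebra_simps)
    qed
    have rec: "agg (Suc k) \<le> (1/2 + 3 * C1 * (b k * wgt_err k)) * agg k + R k" for k
    proof -
      have nn: "0 \<le> 3 * C1 * (b k * wgt_err k) * agg k"
        using C1 b wgt_err_nonneg agg_nonneg by simp
      have e: "agg (Suc k) = agg k / 2 + (X (int k + 1))\<^sup>2 + (\<epsilon> (Suc k))\<^sup>2" by (simp add: add.commute)
      have "(X (int k + 1))\<^sup>2 \<le> 3 * C1 * (b k * wgt_err k) * agg k + (R k - (\<epsilon> (Suc k))\<^sup>2)"
      proof (cases "k = 0")
        case True
        thus ?thesis using nn wgt_err_nonneg[of 0] by (simp add: R_def)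
      next
        case False
        have "(X (int k + 1))\<^sup>2 \<le> 3 * ((x (Suc k))\<^sup>2 + (pred_err k)\<^sup>2 + (V (Suc k))\<^sup>2)"
          using tracking[of k] False square_add3_le by simp
        also have "\<dots> \<le> 3 * ((x (Suc k))\<^sup>2 + (2 * wgt_err k + C1 * (b k * wgt_err k) * agg k) + (V (Suc k))\<^sup>2)"
          using pe[of k] by simp
        finally show ?thesis using False by (simp add: R_def algebra_simps)
      qed
      thus ?thesis unfolding e by (simp add: distrib_right)
    qed
    have RS: "agg 0 + (\<Sum>k<n. R k) \<le> D * (real n + 1 + A)"
    proof -
      have xs: "(\<Sum>k<n. (x (Suc k))\<^sup>2) = (\<Sum>k=1..n. (x k)\<^sup>2)"
        by (rule sum.reindex_bij_witness[where i="\<lambda>k. k - 1" and j=Suc]) auto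
      have "(\<Sum>k<n. (\<epsilon> (Suc k))\<^sup>2) \<le> (\<Sum>k<Suc n. (\<epsilon> k)\<^sup>2)"
        by (subst sum.lessThan_Suc_shift) simp
      also have "\<dots> \<le> CE * (real (Suc n) + 1)" by (rule CE(2))
      also have "\<dots> \<le> CE * (2 * (real n + 1))" using CE(1) by (intro mult_left_mono) auto
      finally have es: "(\<Sum>k<n. (\<epsilon> (Suc k))\<^sup>2) \<le> 2 * CE * (real n + 1)" by (simp only: ac_simps)
      have fs: "(\<Sum>k<n. if k = 0 then (X 1)\<^sup>2 else 0) \<le> (X 1)\<^sup>2 * (real n + 1)"
        by (simp add: algebra_simps)
      have "real n + CX \<le> (1 + \<bar>CX\<bar>) * (real n + 1)"
      proof -
        have "(1 + \<bar>CX\<bar>) * (real n + 1) = real n + 1 + \<bar>CX\<bar> * real n + \<bar>CX\<bar>" by (simp add: algebra_simps)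
        moreover have "0 \<le> \<bar>CX\<bar> * real n" by simp
        ultimately show ?thesis by linarith
      qed
      with CX[of n] have cx: "(\<Sum>k=1..n. (x k)\<^sup>2) \<le> (1 + \<bar>CX\<bar>) * (real n + 1)" by linarith
      have a0: "agg 0 \<le> agg 0 * (real n + 1)" using mult_left_mono[of 1 "real n + 1" "agg 0"] agg_nonneg[of 0] by simp
      have "(\<Sum>k<n. R k) = 6 * A + 3 * (\<Sum>k=1..n. (x k)\<^sup>2) + 3 * (\<Sum>k<n. (V (Suc k))\<^sup>2)
          + (\<Sum>k<n. (\<epsilon> (Suc k))\<^sup>2) + (\<Sum>k<n. if k = 0 then (X 1)\<^sup>2 else 0)"
        by (simp only: R_def sum.distrib sum_distrib_left[symmetric] A_def xs)
      also have "\<dots> \<le> 6 * A + 3 * ((1 + \<bar>CX\<bar>) * (real n + 1)) + 3 * (CV * (real n + 1))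
          + 2 * CE * (real n + 1) + (X 1)\<^sup>2 * (real n + 1)"
        using cx CV(2)[of n] es fs by linarith
      finally have "agg 0 + (\<Sum>k<n. R k) \<le> 6 * A + 3 * ((1 + \<bar>CX\<bar>) * (real n + 1)) + 3 * (CV * (real n + 1))
          + 2 * CE * (real n + 1) + (X 1)\<^sup>2 * (real n + 1) + agg 0 * (real n + 1)" using a0 by linarith
      also have "\<dots> = 6 * A + (D - 6) * (real n + 1)" by (simp only: D_def) (simp add: algebra_simps)
      also have "\<dots> \<le> D * A + D * (real n + 1)"
        using A0 CV CE agg_nonneg[of 0] by (intro add_mono mult_right_mono) (auto simp: D_def)
      finally show ?thesis by (simp add: algebra_simps)
    qed
    define E where "E = exp (6 * C1 * (\<Sum>k<n. b k * wgt_err k))"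
    have E1: "E \<ge> 1" using C1 b wgt_err_nonneg by (simp add: E_def sum_nonneg)
    have "(\<Sum>k<n. agg k) \<le> 2 * exp (2 * (\<Sum>k<n. 3 * C1 * (b k * wgt_err k))) * (agg 0 + (\<Sum>k<n. R k))"
      by (rule perturbed_contraction_sum[where L=agg and R=R and b="\<lambda>k. 3 * C1 * (b k * wgt_err k)"])
        (use C1 b wgt_err_nonneg agg_nonneg R0 rec in \<open>simp_all del: agg.simps\<close>)
    also have "2 * (\<Sum>k<n. 3 * C1 * (b k * wgt_err k)) = 6 * C1 * (\<Sum>k<n. b k * wgt_err k)"
      by (simp add: sum_distrib_left mult.assoc)
    also have "2 * exp (6 * C1 * (\<Sum>k<n. b k * wgt_err k)) * (agg 0 + (\<Sum>k<n. R k)) \<le> 2 * E * (D * (real n + 1 + A))"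
      unfolding E_def[symmetric] using RS E1 by (intro mult_left_mono) auto
    finally have ag: "(\<Sum>k<n. agg k) \<le> 2 * E * (D * (real n + 1 + A))" .
    have "energy n \<le> 1 + (\<Sum>k<n. C1 * agg k)" unfolding energy_def by (intro add_left_mono sum_mono C1)
    also have "\<dots> = 1 + C1 * (\<Sum>k<n. agg k)" by (simp add: sum_distrib_left)
    also have "\<dots> \<le> E * (real n + 1 + A) + C1 * (2 * E * (D * (real n + 1 + A)))"
    proof (intro add_mono mult_left_mono ag)
      show "1 \<le> E * (real n + 1 + A)" using mult_mono[of 1 E 1 "real n + 1 + A"] E1 A0 by simp
    qed (use C1 in simp)
    also have "\<dots> = C * E * (real n + 1 + A)" by (simp add: C_def algebra_simps)
    finally show ?thesis by (simp add: E_def A_def)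
  qed
  hence "\<forall>b. (\<forall>k. b k \<ge> 0) \<longrightarrow> (\<forall>k. leverage k \<le> 1 + b k * dot (\<Phi> k) (\<Phi> k)) \<longrightarrow>
     (\<forall>n. energy n \<le> C * exp (6 * C1 * (\<Sum>k<n. b k * wgt_err k)) * (real n + 1 + (\<Sum>k<n. wgt_err k)))" by blast
  moreover have "6 * C1 > 0" using C1 by simp
  ultimately show ?thesis using C0 by blast
qed

lemma trace_drop_tendsto_0: "trace_drop \<longlonglongrightarrow> 0"
  using sum_trace_drop_le trace_drop_nonneg
  by (intro summable_LIMSEQ_zero summableI_nonneg_bounded) auto

text \<open>With s the energy, the sum of \<open>wgt_err\<close> is O(1 + ln s). The exponential in
  the growth bound costs a factor of order s^(1/4), the logarithm another s^(1/4), so s is at most a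
  constant times (n + 1) sqrt s, and sqrt s cancels.\<close>

lemma energy_polynomial: "\<exists>C>0. \<forall>n. energy n \<le> C * (real n + 1)\<^sup>2"
proof -
  obtain C K where CK: "C > 0" "K > 0"
    and eg: "\<And>n. energy n \<le> C * exp (K * (\<Sum>k<n. trace_drop k * wgt_err k)) * (real n + 1 + (\<Sum>k<n. wgt_err k))"
    using energy_growth trace_drop_nonneg leverage_le_trace_drop by meson
  obtain C2 where C2: "C2 \<ge> 0" "\<And>n. lyap n + (\<Sum>k<n. wgt_err k) \<le> C2 * (1 + ln (energy n))"
    using log_bound by blast
  \<comment> \<open>Chosen so that the late trace drops, times \<open>K\<close>, contribute at most
    (1 + ln s) / 4 to the exponent.\<close>
  define \<eta> where "\<eta> = 1 / (4 * K * (C2 + 1))"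
  have eta: "\<eta> > 0" using CK C2 by (simp add: \<eta>_def)
  obtain N where "\<forall>n\<ge>N. norm (trace_drop n - 0) < \<eta>" using LIMSEQ_D[OF trace_drop_tendsto_0 eta] by blast
  hence N: "trace_drop n \<le> \<eta>" if "n \<ge> N" for n using that by (force simp: less_imp_le)
  define cN where "cN = (\<Sum>k<N. trace_drop k * wgt_err k)"
  define Z where "Z = C * exp (K * cN + 1/4) * (1 + 5 * C2)"
  have Z: "Z > 0" using CK C2 by (simp add: Z_def)
  have "energy n \<le> Z\<^sup>2 * (real n + 1)\<^sup>2" for n
  proof -
    define s where "s = energy n"
    define q where "q = s powr (1/4)"
    have s: "s \<ge> 1" using energy_ge_1 by (simp add: s_def)
    have q: "q \<ge> 1" using s by (simp add: q_def ge_one_powr_ge_zero)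
    have qq: "q * q = sqrt s" using s by (simp add: q_def powr_add[symmetric] powr_half_sqrt)
    define A where "A = (\<Sum>k<n. wgt_err k)"
    have A0: "A \<ge> 0" using wgt_err_nonneg by (simp add: A_def sum_nonneg)
    have A: "A \<le> C2 * (1 + ln s)" using C2(2)[of n] quad_nonneg[of n "e n"] by (simp add: A_def s_def lyap_def)
    have "(\<Sum>k<n. trace_drop k * wgt_err k) \<le> cN + \<eta> * A"
    proof -
      have "(\<Sum>k<n. trace_drop k * wgt_err k) \<le> (\<Sum>k<n. (if k < N then trace_drop k * wgt_err k else 0) + \<eta> * wgt_err k)"
      proof (rule sum_mono)
        fix k show "trace_drop k * wgt_err k \<le> (if k < N then trace_drop k * wgt_err k else 0) + \<eta> * wgt_err k"
          using N[of k] wgt_err_nonneg[of k] eta by (auto intro: mult_right_mono)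
      qed
      also have "\<dots> = (\<Sum>k\<in>{..<n} \<inter> {k. k < N}. trace_drop k * wgt_err k) + \<eta> * A"
        by (subst sum.inter_restrict) (auto simp: sum.distrib sum_distrib_left A_def)
      also have "(\<Sum>k\<in>{..<n} \<inter> {k. k < N}. trace_drop k * wgt_err k) \<le> cN"
        unfolding cN_def using trace_drop_nonneg wgt_err_nonneg by (intro sum_mono2) auto
      finally show ?thesis by simp
    qed
    also have "\<eta> * A \<le> \<eta> * ((C2 + 1) * (1 + ln s))"
      using A s eta by (intro mult_left_mono order_trans[OF A] mult_right_mono) auto
    also have "\<dots> = (1 + ln s) / (4 * K)" using C2 CK by (simp add: \<eta>_def)
    finally have "K * (\<Sum>k<n. trace_drop k * wgt_err k) \<le> K * (cN + (1 + ln s) / (4 * K))"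
      using CK by (intro mult_left_mono) auto
    also have "\<dots> = K * cN + 1/4 + ln s / 4" using CK by (simp add: field_simps)
    finally have "exp (K * (\<Sum>k<n. trace_drop k * wgt_err k)) \<le> exp (K * cN + 1/4 + ln s / 4)" by simp
    also have "\<dots> = exp (K * cN + 1/4) * q" using s by (simp add: q_def powr_def exp_add)
    finally have 1: "exp (K * (\<Sum>k<n. trace_drop k * wgt_err k)) \<le> exp (K * cN + 1/4) * q" .
    have "ln s \<le> 4 * q" using ln_powr_bound[of s "1/4"] s by (simp add: q_def)
    hence "1 + ln s \<le> 5 * q" using q by linarith
    hence "A \<le> C2 * (5 * q)" using A C2 by (meson mult_left_mono order_trans)
    moreover have "1 * (C2 * (5 * q)) \<le> (real n + 1) * (C2 * (5 * q))"
      using C2(1) q by (intro mult_right_mono) auto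
    moreover have "real n + 1 \<le> (real n + 1) * q" using q mult_left_mono[of 1 q "real n + 1"] by simp
    ultimately have 2: "real n + 1 + A \<le> (real n + 1) * ((1 + 5 * C2) * q)"
      by (simp add: algebra_simps)
    have "s \<le> C * exp (K * (\<Sum>k<n. trace_drop k * wgt_err k)) * (real n + 1 + A)"
      using eg[of n] by (simp add: s_def A_def)
    also have "\<dots> \<le> C * (exp (K * cN + 1/4) * q) * ((real n + 1) * ((1 + 5 * C2) * q))"
      using 1 2 CK A0 q by (intro mult_mono mult_left_mono) auto
    also have "\<dots> = Z * (real n + 1) * (q * q)" by (simp add: Z_def algebra_simps)
    finally have "sqrt s * sqrt s \<le> Z * (real n + 1) * sqrt s" using s qq by simp
    hence "sqrt s \<le> Z * (real n + 1)" using s by (subst (asm) mult_le_cancel_right) auto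
    hence "(sqrt s)\<^sup>2 \<le> (Z * (real n + 1))\<^sup>2" using s by (intro power_mono) auto
    thus ?thesis using s by (simp add: s_def power_mult_distrib)
  qed
  moreover have "Z\<^sup>2 > 0" using Z by simp
  ultimately show ?thesis by blast
qed

lemma ln_energy: "\<exists>C>0. \<forall>n. 1 + ln (energy n) \<le> C * log3 n"
proof -
  obtain C where C: "C > 0" "\<And>n. energy n \<le> C * (real n + 1)\<^sup>2" using energy_polynomial by blast
  have "1 + ln (energy n) \<le> (3 + \<bar>ln C\<bar>) * log3 n" for n
  proof -
    have "ln (energy n) \<le> ln (C * (real n + 1)\<^sup>2)"
      using C energy_ge_1[of n] by (subst ln_le_cancel_iff) auto
    also have "\<dots> = ln C + 2 * ln (real n + 1)" using C by (simp add: ln_mult ln_realpow)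
    also have "ln (real n + 1) \<le> log3 n" by (simp add: log3_def)
    finally have "1 + ln (energy n) \<le> 1 + \<bar>ln C\<bar> + 2 * log3 n" by simp
    also have "\<dots> \<le> (3 + \<bar>ln C\<bar>) * log3 n"
      using mult_left_mono[OF log3_ge_1[of n], of "1 + \<bar>ln C\<bar>"] by (simp add: algebra_simps)
    finally show ?thesis .
  qed
  moreover have "3 + \<bar>ln C\<bar> > 0" by simp
  ultimately show ?thesis by blast
qed

lemma lyap_wgt_log: "\<exists>C\<ge>0. \<forall>n. lyap n \<le> C * log3 n \<and> (\<Sum>k<n. wgt_err k) \<le> C * log3 n"
proof -
  obtain C where C: "C > 0" "\<And>n. 1 + ln (energy n) \<le> C * log3 n" using ln_energy by blast
  obtain D where D: "D \<ge> 0" "\<And>n. lyap n + (\<Sum>k<n. wgt_err k) \<le> D * (1 + ln (energy n))"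
    using log_bound by blast
  have "lyap n \<le> D * C * log3 n \<and> (\<Sum>k<n. wgt_err k) \<le> D * C * log3 n" for n
  proof -
    have "lyap n + (\<Sum>k<n. wgt_err k) \<le> D * C * log3 n"
      using order_trans[OF D(2) mult_left_mono[OF C(2) D(1)]] by (simp add: mult.assoc)
    moreover have "lyap n \<ge> 0" "(\<Sum>k<n. wgt_err k) \<ge> 0"
      using wgt_err_nonneg by (auto simp: lyap_def quad_nonneg sum_nonneg)
    ultimately show ?thesis by linarith
  qed
  thus ?thesis using C D by (intro exI[of _ "D * C"]) auto
qed

end

subsection \<open>Persistent excitation\<close>

lemma sum_shifted_le:
  fixes a :: "nat \<Rightarrow> real"
  assumes a: "\<And>k. a k \<ge> 0"
  shows "(\<Sum>k<n. if j \<le> k then a (k - j) else 0) \<le> (\<Sum>k<n. a k)"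
proof -
  have "(\<Sum>k<n. if j \<le> k then a (k - j) else 0) = (\<Sum>m<n - j. a m)"
    by (induction n) (auto simp: Suc_diff_le)
  also have "\<dots> \<le> (\<Sum>k<n. a k)" using a by (intro sum_mono2) auto
  finally show ?thesis .
qed

lemma sum_delayed_le:
  fixes s :: "nat \<Rightarrow> real"
  assumes s: "\<And>k. s k \<ge> 0" and i: "i \<le> p"
  shows "(\<Sum>k<n. if p < k then s (k - Suc i) else 0) \<le> (\<Sum>m<n. s m)"
proof -
  have "(\<Sum>k<n. if p < k then s (k - Suc i) else 0) \<le> (\<Sum>k<n. if Suc i \<le> k then s (k - Suc i) else 0)"
    using s i by (intro sum_mono) auto
  also have "\<dots> \<le> (\<Sum>m<n. s m)" by (rule sum_shifted_le[OF s])
  finally show ?thesis .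
qed

context closed_loop
begin

text \<open>The regressor that perfect tracking of the zero trajectory would produce is a linear
  function of \<open>z\<close>, whose coordinates are asymptotically uncorrelated.\<close>

definition z :: "nat \<Rightarrow> nat \<Rightarrow> real" where
  "z i k = (if p < k then (if i \<le> p then V (k - i) else \<epsilon> (k - Suc p)) else 0)"

definition zvar :: "nat \<Rightarrow> real" where
  "zvar i = (if i \<le> p then \<sigma>\<^sup>2 else \<sigma>\<^sup>2 / (1 - \<rho>\<^sup>2))"

lemma zvar_ge: "zvar i \<ge> \<sigma>\<^sup>2"
proof -
  have "\<sigma>\<^sup>2 * (1 - \<rho>\<^sup>2) \<le> \<sigma>\<^sup>2 * 1" by (intro mult_left_mono) auto
  thus ?thesis using \<rho>2 by (simp add: zvar_def le_divide_eq)
qed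

lemma VV_small:
  assumes "j \<ge> 1"
  shows "small_sums (\<lambda>k. (if j \<le> k then V (Suc k - j) else 0) * V (Suc k)) (\<lambda>_. 1)"
proof -
  obtain C where C: "\<And>n. (\<Sum>k<n. (V (Suc k))\<^sup>2) \<le> C * (real n + 1)" using V_square_sum by blast
  have "(\<Sum>k<n. (if j \<le> k then V (Suc k - j) else 0)\<^sup>2) \<le> C * (real n + 1)" for n
  proof -
    have "(\<Sum>k<n. (if j \<le> k then V (Suc k - j) else 0)\<^sup>2) = (\<Sum>k<n. if j \<le> k then (V (Suc (k - j)))\<^sup>2 else 0)"
      by (intro sum.cong) (auto simp: Suc_diff_le)
    also have "\<dots> \<le> (\<Sum>k<n. (V (Suc k))\<^sup>2)" by (rule sum_shifted_le) simp
    finally show ?thesis using C[of n] by simp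
  qed
  thus ?thesis by (rule small_sums_linear[OF N4[OF assms]])
qed

lemma \<epsilon>V_shift_small: "small_sums (\<lambda>k. (if j \<le> k then \<epsilon> (k - j) else 0) * V (Suc k)) (\<lambda>_. 1)"
proof -
  obtain C where C: "\<And>n. (\<Sum>k<n. (\<epsilon> k)\<^sup>2) \<le> C * (real n + 1)" using \<epsilon>_square_sum by blast
  have "(\<Sum>k<n. (if j \<le> k then \<epsilon> (k - j) else 0)\<^sup>2) \<le> C * (real n + 1)" for n
  proof -
    have "(\<Sum>k<n. (if j \<le> k then \<epsilon> (k - j) else 0)\<^sup>2) = (\<Sum>k<n. if j \<le> k then (\<epsilon> (k - j))\<^sup>2 else 0)"
      by (intro sum.cong) auto
    also have "\<dots> \<le> (\<Sum>k<n. (\<epsilon> k)\<^sup>2)" by (rule sum_shifted_le) simp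
    finally show ?thesis using C[of n] by simp
  qed
  thus ?thesis by (rule small_sums_linear[OF N5])
qed

text \<open>Off the diagonal, the factor with the smaller index is the newer \<open>V\<close> and
  the other one is known before it, so the products form a delayed martingale transform. On the
  diagonal, the strong laws for the squares of \<open>V\<close> and \<epsilon> apply.\<close>

lemma zz_small_le:
  assumes "i \<le> j" "j \<le> Suc p"
  shows "small_sums (\<lambda>k. z i k * z j k - (if i = j \<and> p < k then zvar i else 0)) (\<lambda>_. 1)"
proof -
  consider (a) "i = j" "j \<le> p" | (b) "i = j" "j = Suc p" | (c) "i < j" "j \<le> p" | (d) "i \<le> p" "j = Suc p"
    using assms by linarith
  thus ?thesis
  proof cases
    case a
    have e: "(\<lambda>k. z i k * z j k - (if i = j \<and> p < k then zvar i else 0))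
        = (\<lambda>k. if p < k then (V (Suc (k - Suc i)))\<^sup>2 - \<sigma>\<^sup>2 else 0)"
      using a by (auto simp: fun_eq_iff z_def zvar_def Suc_diff_Suc power2_eq_square)
    show ?thesis unfolding e by (rule small_sums_delayed[OF N3]) (use a in simp)
  next
    case b
    have e: "(\<lambda>k. z i k * z j k - (if i = j \<and> p < k then zvar i else 0))
        = (\<lambda>k. if p < k then (\<epsilon> (k - Suc p))\<^sup>2 - \<sigma>\<^sup>2 / (1 - \<rho>\<^sup>2) else 0)"
      using b by (auto simp: fun_eq_iff z_def zvar_def power2_eq_square)
    show ?thesis unfolding e by (rule small_sums_delayed[OF \<epsilon>_centered_small]) simp
  next
    case c
    have e: "(\<lambda>k. z i k * z j k - (if i = j \<and> p < k then zvar i else 0))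
        = (\<lambda>k. if p < k then (if j - i \<le> k - Suc i then V (Suc (k - Suc i) - (j - i)) else 0) * V (Suc (k - Suc i)) else 0)"
      using c by (auto simp: fun_eq_iff z_def Suc_diff_Suc)
    show ?thesis unfolding e by (rule small_sums_delayed[OF VV_small]) (use c in auto)
  next
    case d
    have e: "(\<lambda>k. z i k * z j k - (if i = j \<and> p < k then zvar i else 0))
        = (\<lambda>k. if p < k then (if p - i \<le> k - Suc i then \<epsilon> (k - Suc i - (p - i)) else 0) * V (Suc (k - Suc i)) else 0)"
      using d by (auto simp: fun_eq_iff z_def Suc_diff_Suc)
    show ?thesis unfolding e by (rule small_sums_delayed[OF \<epsilon>V_shift_small]) (use d in simp)
  qed
qed

lemma zz_small:
  assumes "i < d" "j < d"
  shows "small_sums (\<lambda>k. z i k * z j k - (if i = j \<and> p < k then zvar i else 0)) (\<lambda>_. 1)"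
proof (cases "i \<le> j")
  case True
  thus ?thesis using zz_small_le[of i j] assms d by simp
next
  case False
  hence "(\<lambda>k. z i k * z j k - (if i = j \<and> p < k then zvar i else 0))
    = (\<lambda>k. z j k * z i k - (if j = i \<and> p < k then zvar j else 0))" by (auto simp: mult.commute)
  thus ?thesis using zz_small_le[of j i] assms d False by simp
qed

text \<open>The form is expanded into the empirical covariances of \<open>z\<close>. These have
  diagonal limits of at least \<sigma> squared, and their errors are uniform over pairs of indices,
  so one threshold serves all directions.\<close>

lemma ideal_excitation:
  "\<exists>N. \<forall>n\<ge>N. \<forall>c. \<sigma>\<^sup>2 / 2 * real n * (\<Sum>i<d. (c i)\<^sup>2) \<le> (\<Sum>k<n. (\<Sum>i<d. c i * z i k)\<^sup>2)"
proof -
  \<comment> \<open>Summed over the d * d pairs, the linear errors take a quarter of the main term;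
    \<open>N\<close> is chosen so that the constant errors and the p + 1 missing times take at most
    another quarter.\<close>
  define \<eta> where "\<eta> = \<sigma>\<^sup>2 / (4 * (real d)\<^sup>2)"
  have d0: "real d > 0" using d by simp
  have eta: "\<eta> > 0" using \<sigma> d0 by (simp add: \<eta>_def)
  define Y where "Y i j n = (\<Sum>k<n. z i k * z j k - (if i = j \<and> p < k then zvar i else 0))" for i j n
  have "\<forall>i j. \<exists>C. i < d \<longrightarrow> j < d \<longrightarrow> (\<forall>n. \<bar>Y i j n\<bar> \<le> \<eta> * real n + C)"
    using small_sumsD[OF zz_small eta] by (auto simp: Y_def)
  then obtain C where C: "\<And>i j n. i < d \<Longrightarrow> j < d \<Longrightarrow> \<bar>Y i j n\<bar> \<le> \<eta> * real n + C i j" by metis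
  define Cm where "Cm = (\<Sum>i<d. \<Sum>j<d. \<bar>C i j\<bar>)"
  have Cm: "\<bar>Y i j n\<bar> \<le> \<eta> * real n + Cm" if "i < d" "j < d" for i j n
  proof -
    have "\<bar>C i j\<bar> \<le> (\<Sum>j<d. \<bar>C i j\<bar>)" using that by (intro member_le_sum) auto
    also have "\<dots> \<le> Cm" unfolding Cm_def
      using that by (intro member_le_sum[where f="\<lambda>i. \<Sum>j<d. \<bar>C i j\<bar>"]) (auto intro: sum_nonneg)
    finally show ?thesis using C[OF that, of n] by linarith
  qed
  define N where "N = nat \<lceil>4 * (real (Suc p) * \<sigma>\<^sup>2 + (real d)\<^sup>2 * Cm) / \<sigma>\<^sup>2\<rceil>"
  have "\<sigma>\<^sup>2 / 2 * real n * (\<Sum>i<d. (c i)\<^sup>2) \<le> (\<Sum>k<n. (\<Sum>i<d. c i * z i k)\<^sup>2)" if n: "n \<ge> N" for n c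
  proof -
    define m where "m = (\<Sum>k<n. if p < k then 1 else (0::real))"
    have m: "m \<ge> real n - real (Suc p)" unfolding m_def by (induction n) auto
    define c2 where "c2 = (\<Sum>i<d. (c i)\<^sup>2)"
    have c2: "c2 \<ge> 0" by (simp add: c2_def sum_nonneg)
    have cc: "\<bar>c i * c j\<bar> \<le> c2" if "i < d" "j < d" for i j
    proof -
      have "(c i)\<^sup>2 \<le> c2" "(c j)\<^sup>2 \<le> c2" unfolding c2_def
        using that by (auto intro!: member_le_sum[where f="\<lambda>i. (c i)\<^sup>2"])
      moreover have "2 * \<bar>c i * c j\<bar> \<le> (c i)\<^sup>2 + (c j)\<^sup>2" by (rule abs_mult_le_squares)
      ultimately show ?thesis by linarith
    qed
    have "(\<Sum>k<n. (\<Sum>i<d. c i * z i k)\<^sup>2) = (\<Sum>k<n. \<Sum>i<d. \<Sum>j<d. c i * c j * (z i k * z j k))"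
      by (simp add: power2_eq_square sum_product ac_simps)
    also have "\<dots> = (\<Sum>i<d. \<Sum>k<n. \<Sum>j<d. c i * c j * (z i k * z j k))" by (rule sum.swap)
    also have "\<dots> = (\<Sum>i<d. \<Sum>j<d. c i * c j * (\<Sum>k<n. z i k * z j k))"
    proof (rule sum.cong[OF refl])
      fix i show "(\<Sum>k<n. \<Sum>j<d. c i * c j * (z i k * z j k)) = (\<Sum>j<d. c i * c j * (\<Sum>k<n. z i k * z j k))"
        by (subst sum.swap) (simp add: sum_distrib_left)
    qed
    also have "\<dots> = (\<Sum>i<d. \<Sum>j<d. c i * c j * Y i j n + (if i = j then c i * c j * zvar i * m else 0))"
    proof (intro sum.cong refl)
      fix i j
      have "(\<Sum>k<n. z i k * z j k) = Y i j n + (\<Sum>k<n. if i = j \<and> p < k then zvar i else 0)"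
        by (simp add: Y_def sum_subtractf)
      also have "(\<Sum>k<n. if i = j \<and> p < k then zvar i else 0) = (if i = j then zvar i * m else 0)"
        by (auto simp: m_def sum_distrib_left if_distrib[of "\<lambda>x. _ * x"] cong: if_cong)
      finally show "c i * c j * (\<Sum>k<n. z i k * z j k)
        = c i * c j * Y i j n + (if i = j then c i * c j * zvar i * m else 0)" by (simp add: algebra_simps)
    qed
    also have "\<dots> = (\<Sum>i<d. \<Sum>j<d. c i * c j * Y i j n) + m * (\<Sum>i<d. (c i)\<^sup>2 * zvar i)"
      by (simp add: sum.distrib sum_distrib_left power2_eq_square ac_simps)
    finally have E: "(\<Sum>k<n. (\<Sum>i<d. c i * z i k)\<^sup>2)
      = (\<Sum>i<d. \<Sum>j<d. c i * c j * Y i j n) + m * (\<Sum>i<d. (c i)\<^sup>2 * zvar i)" .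
    have m0: "m \<ge> 0" by (simp add: m_def sum_nonneg)
    have "c2 * \<sigma>\<^sup>2 \<le> (\<Sum>i<d. (c i)\<^sup>2 * zvar i)"
      unfolding c2_def sum_distrib_right by (intro sum_mono mult_left_mono zvar_ge) auto
    hence 1: "m * (c2 * \<sigma>\<^sup>2) \<le> m * (\<Sum>i<d. (c i)\<^sup>2 * zvar i)" using m0 by (intro mult_left_mono)
    have "\<bar>\<Sum>i<d. \<Sum>j<d. c i * c j * Y i j n\<bar> \<le> (\<Sum>i<d. \<Sum>j<d. c2 * (\<eta> * real n + Cm))"
    proof (intro order_trans[OF sum_abs] sum_mono)
      fix i j assume "i \<in> {..<d}" "j \<in> {..<d}"
      thus "\<bar>c i * c j * Y i j n\<bar> \<le> c2 * (\<eta> * real n + Cm)"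
        unfolding abs_mult[of "c i * c j"] using c2 by (intro mult_mono cc Cm) auto
    qed
    hence 2: "\<bar>\<Sum>i<d. \<Sum>j<d. c i * c j * Y i j n\<bar> \<le> (real d)\<^sup>2 * (c2 * (\<eta> * real n + Cm))"
      by (simp add: power2_eq_square)
    have "4 * (real (Suc p) * \<sigma>\<^sup>2 + (real d)\<^sup>2 * Cm) / \<sigma>\<^sup>2 \<le> real n"
      using n unfolding N_def by linarith
    hence 3: "4 * (real (Suc p) * \<sigma>\<^sup>2 + (real d)\<^sup>2 * Cm) \<le> real n * \<sigma>\<^sup>2"
      using \<sigma> by (simp add: divide_le_eq)
    have 4: "(real d)\<^sup>2 * (\<eta> * real n) = \<sigma>\<^sup>2 * real n / 4" using d0 by (simp add: \<eta>_def)
    have "(real n - real (Suc p)) * \<sigma>\<^sup>2 \<le> m * \<sigma>\<^sup>2" using m by (intro mult_right_mono) auto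
    hence "\<sigma>\<^sup>2 / 2 * real n \<le> m * \<sigma>\<^sup>2 - (real d)\<^sup>2 * (\<eta> * real n + Cm)"
    proof -
      have "(real d)\<^sup>2 * (\<eta> * real n + Cm) = \<sigma>\<^sup>2 * real n / 4 + (real d)\<^sup>2 * Cm"
        using 4 by (simp only: distrib_left)
      moreover have "4 * (real (Suc p) * \<sigma>\<^sup>2) + 4 * ((real d)\<^sup>2 * Cm) \<le> \<sigma>\<^sup>2 * real n"
        using 3 by (simp only: distrib_left mult.commute[of "real n"])
      moreover have "(real n - real (Suc p)) * \<sigma>\<^sup>2 = \<sigma>\<^sup>2 * real n - real (Suc p) * \<sigma>\<^sup>2"
        by (simp only: left_diff_distrib mult.commute[of "real n"])
      moreover have "\<sigma>\<^sup>2 / 2 * real n = \<sigma>\<^sup>2 * real n / 2" by simp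
      ultimately show ?thesis using \<open>(real n - real (Suc p)) * \<sigma>\<^sup>2 \<le> m * \<sigma>\<^sup>2\<close> by linarith
    qed
    hence "c2 * (\<sigma>\<^sup>2 / 2 * real n) \<le> c2 * (m * \<sigma>\<^sup>2 - (real d)\<^sup>2 * (\<eta> * real n + Cm))"
      using c2 by (intro mult_left_mono)
    hence "\<sigma>\<^sup>2 / 2 * real n * c2 \<le> m * (c2 * \<sigma>\<^sup>2) - (real d)\<^sup>2 * (c2 * (\<eta> * real n + Cm))"
      by (simp add: algebra_simps)
    thus ?thesis using 1 2 E unfolding c2_def by linarith
  qed
  thus ?thesis by blast
qed

text \<open>By the model equation, the input at time k - 1 is the combination of the outputs X(k),
  ..., X(k - p) with these coefficients, minus \<epsilon> at time k.\<close>

definition ucoef :: "nat \<Rightarrow> real" where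
  "ucoef i = (case i of 0 \<Rightarrow> 1 | Suc j \<Rightarrow> - \<theta> j)"

definition xcoef :: "(nat \<Rightarrow> real) \<Rightarrow> nat \<Rightarrow> real" where
  "xcoef u i = u i + u (Suc p) * ucoef i"

text \<open>Substituting \<open>V\<close> for the outputs and expanding \<epsilon> over p + 1 steps
  gives these coefficients. The last one determines \<open>u (Suc p)\<close> because \<rho> is
  nonzero, and the others then determine the remaining entries.\<close>

definition zcoef :: "(nat \<Rightarrow> real) \<Rightarrow> nat \<Rightarrow> real" where
  "zcoef u i = (if i \<le> p then xcoef u i - u (Suc p) * \<rho> ^ i else - (u (Suc p) * \<rho> ^ Suc p))"

lemma \<epsilon>_expand: "q < k \<Longrightarrow> \<epsilon> k = (\<Sum>i\<le>q. \<rho> ^ i * V (k - i)) + \<rho> ^ Suc q * \<epsilon> (k - Suc q)"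
proof (induction q)
  case 0
  thus ?case using \<epsilon>_Suc[of "k - 1"] by simp
next
  case (Suc q)
  hence "\<epsilon> (k - Suc q) = \<rho> * \<epsilon> (k - Suc (Suc q)) + V (k - Suc q)"
    using \<epsilon>_Suc[of "k - Suc (Suc q)"] by (simp add: Suc_diff_Suc)
  thus ?case using Suc by (simp add: algebra_simps)
qed

lemma U_eq_ucoef: "k \<ge> 1 \<Longrightarrow> U (int k - 1) = (\<Sum>i\<le>p. ucoef i * X (int k - int i)) - \<epsilon> k"
  using U_eq[of "k - 1"] by (simp add: sum.atMost_shift ucoef_def sum_negf)

lemma dot_regressor: "dot (\<Phi> k) u = (\<Sum>i\<le>p. u i * X (int k - int i)) + u (Suc p) * U (int k - 1)"
proof -
  have "dot (\<Phi> k) u = (\<Sum>i<Suc (Suc p). \<Phi> k i * u i)" unfolding dot_def using d by simp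
  also have "\<dots> = (\<Sum>i<Suc p. \<Phi> k i * u i) + u (Suc p) * U (int k - 1)" by (simp add: \<Phi>_def)
  also have "(\<Sum>i<Suc p. \<Phi> k i * u i) = (\<Sum>i\<le>p. u i * X (int k - int i))"
    unfolding lessThan_Suc_atMost by (intro sum.cong) (auto simp: \<Phi>_def)
  finally show ?thesis .
qed

text \<open>The input is eliminated by the model equation, each output is split as \<open>V\<close>
  plus the rest, and the remaining \<epsilon> is expanded far enough back that its old value is
  independent of the listed noises in the linear sense of the coordinates \<open>z\<close>.\<close>

lemma regressor_decomposition:
  assumes k: "p < k"
  shows "dot (\<Phi> k) u = (\<Sum>i\<le>p. xcoef u i * (X (int k - int i) - V (k - i))) + (\<Sum>i<d. zcoef u i * z i k)"
proof -
  have "(\<Sum>i<d. zcoef u i * z i k) = (\<Sum>i<Suc p. zcoef u i * z i k) + zcoef u (Suc p) * z (Suc p) k"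
    using d by simp
  also have "(\<Sum>i<Suc p. zcoef u i * z i k) = (\<Sum>i\<le>p. xcoef u i * V (k - i) - u (Suc p) * (\<rho> ^ i * V (k - i)))"
    unfolding lessThan_Suc_atMost using k by (intro sum.cong) (auto simp: zcoef_def z_def algebra_simps)
  also have "\<dots> = (\<Sum>i\<le>p. xcoef u i * V (k - i)) - u (Suc p) * (\<Sum>i\<le>p. \<rho> ^ i * V (k - i))"
    by (simp add: sum_subtractf sum_distrib_left)
  also have "zcoef u (Suc p) * z (Suc p) k = - (u (Suc p) * (\<rho> ^ Suc p * \<epsilon> (k - Suc p)))"
    using k by (simp add: zcoef_def z_def)
  finally have "(\<Sum>i<d. zcoef u i * z i k) = (\<Sum>i\<le>p. xcoef u i * V (k - i)) - u (Suc p) * \<epsilon> k"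
    unfolding \<epsilon>_expand[OF k] by (simp add: algebra_simps)
  moreover have "dot (\<Phi> k) u = (\<Sum>i\<le>p. xcoef u i * X (int k - int i)) - u (Suc p) * \<epsilon> k"
    unfolding dot_regressor using k U_eq_ucoef[of k]
    by (simp add: xcoef_def distrib_right sum.distrib sum_distrib_left right_diff_distrib mult.assoc)
  ultimately show ?thesis by (simp add: right_diff_distrib sum_subtractf)
qed

lemma dot_self_split: "dot u u = (\<Sum>i\<le>p. (u i)\<^sup>2) + (u (Suc p))\<^sup>2"
proof -
  have "dot u u = (\<Sum>i<Suc (Suc p). (u i)\<^sup>2)" unfolding dot_def using d by (simp add: power2_eq_square)
  thus ?thesis by (simp add: lessThan_Suc_atMost)
qed

text \<open>The triangular inversion of \<open>zcoef\<close>, made quantitative; division by the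
  square of \<rho>^(p + 1) gives the constant.\<close>

lemma coefficient_bounds:
  "\<exists>\<kappa>>0. \<exists>B\<ge>0. \<forall>u. \<kappa> * dot u u \<le> (\<Sum>i<d. (zcoef u i)\<^sup>2) \<and> (\<Sum>i\<le>p. (xcoef u i)\<^sup>2) \<le> B * dot u u"
proof -
  define r where "r = (\<rho> ^ Suc p)\<^sup>2"
  have r: "r > 0" using \<rho> by (simp add: r_def)
  define T where "T = (\<Sum>i\<le>p. (ucoef i)\<^sup>2)"
  define S where "S = (\<Sum>i\<le>p. (\<rho> ^ i - ucoef i)\<^sup>2)"
  have T: "T \<ge> 0" and S: "S \<ge> 0" by (auto simp: T_def S_def sum_nonneg)
  define K where "K = 2 + (2 * S + 1) / r"
  have K: "K > 0" using r S by (simp add: K_def add_pos_nonneg)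
  have "dot u u \<le> K * (\<Sum>i<d. (zcoef u i)\<^sup>2) \<and> (\<Sum>i\<le>p. (xcoef u i)\<^sup>2) \<le> (2 + 2 * T) * dot u u" for u
  proof
    let ?w = "u (Suc p)"
    define Z where "Z = (\<Sum>i\<le>p. (zcoef u i)\<^sup>2)"
    have "(\<Sum>i<d. (zcoef u i)\<^sup>2) = (\<Sum>i<Suc (Suc p). (zcoef u i)\<^sup>2)" using d by simp
    also have "\<dots> = Z + ?w\<^sup>2 * r"
      by (simp add: lessThan_Suc_atMost[symmetric] Z_def zcoef_def[of u "Suc p"] r_def power_mult_distrib)
    finally have zd: "(\<Sum>i<d. (zcoef u i)\<^sup>2) = Z + ?w\<^sup>2 * r" .
    have Z0: "Z \<ge> 0" by (simp add: Z_def sum_nonneg)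
    have "(\<Sum>i\<le>p. (u i)\<^sup>2) \<le> (\<Sum>i\<le>p. 2 * (zcoef u i)\<^sup>2 + 2 * (?w\<^sup>2 * (\<rho> ^ i - ucoef i)\<^sup>2))"
    proof (rule sum_mono)
      fix i assume "i \<in> {..p}"
      hence "u i = zcoef u i + ?w * (\<rho> ^ i - ucoef i)" by (simp add: zcoef_def xcoef_def algebra_simps)
      thus "(u i)\<^sup>2 \<le> 2 * (zcoef u i)\<^sup>2 + 2 * (?w\<^sup>2 * (\<rho> ^ i - ucoef i)\<^sup>2)"
        using square_add_le[of "zcoef u i" "?w * (\<rho> ^ i - ucoef i)"] by (simp add: power_mult_distrib)
    qed
    also have "\<dots> = 2 * Z + 2 * (?w\<^sup>2 * S)" by (simp add: Z_def S_def sum.distrib sum_distrib_left)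
    finally have "dot u u \<le> 2 * Z + (2 * S + 1) * ?w\<^sup>2" unfolding dot_self_split by (simp add: algebra_simps)
    also have "\<dots> = 2 * Z + (2 * S + 1) / r * (?w\<^sup>2 * r)" using r by simp
    also have "\<dots> \<le> K * Z + K * (?w\<^sup>2 * r)"
      using r S Z0 by (intro add_mono mult_right_mono) (auto simp: K_def)
    finally show "dot u u \<le> K * (\<Sum>i<d. (zcoef u i)\<^sup>2)" unfolding zd by (simp add: algebra_simps)
    have "(\<Sum>i\<le>p. (xcoef u i)\<^sup>2) \<le> (\<Sum>i\<le>p. 2 * (u i)\<^sup>2 + 2 * (?w\<^sup>2 * (ucoef i)\<^sup>2))"
      using square_add_le by (intro sum_mono) (simp add: xcoef_def flip: power_mult_distrib)
    also have "\<dots> = 2 * (\<Sum>i\<le>p. (u i)\<^sup>2) + 2 * T * ?w\<^sup>2"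
      by (simp add: T_def sum.distrib sum_distrib_left mult.assoc mult.left_commute mult.commute)
    also have "\<dots> \<le> (2 + 2 * T) * (\<Sum>i\<le>p. (u i)\<^sup>2) + (2 + 2 * T) * ?w\<^sup>2"
      using T by (intro add_mono mult_right_mono) (auto simp: sum_nonneg)
    finally show "(\<Sum>i\<le>p. (xcoef u i)\<^sup>2) \<le> (2 + 2 * T) * dot u u"
      unfolding dot_self_split by (simp add: algebra_simps)
  qed
  hence b: "(1 / K) * dot u u \<le> (\<Sum>i<d. (zcoef u i)\<^sup>2) \<and> (\<Sum>i\<le>p. (xcoef u i)\<^sup>2) \<le> (2 + 2 * T) * dot u u" for u
    using K by (simp add: divide_le_eq mult.commute)
  have "1 / K > 0" "2 + 2 * T \<ge> 0" using K T by auto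
  thus ?thesis using b by blast
qed

end

section \<open>From ideal to actual regressors\<close>

context closed_loop
begin

text \<open>Leverages at most 1 make the prediction errors behind all p + 1 outputs of the regressor
  comparable to \<open>wgt_err\<close>. The strict bound on k keeps those times at least 1, where
  the tracking identity holds.\<close>

definition clean :: "nat \<Rightarrow> bool" where
  "clean k \<longleftrightarrow> Suc p < k \<and> (\<forall>i\<le>p. leverage (k - Suc i) \<le> 1)"

text \<open>Each leverage above 1 contributes at least ln 2 to a sum that is O(ln n), and it spoils
  at most p + 1 later regressors. The time p + 1 is counted separately.\<close>

lemma unclean_count: "\<exists>C\<ge>0. \<forall>n. (\<Sum>k<n. if p < k \<and> \<not> clean k then 1 else (0::real)) \<le> C * log3 n"
proof -
  obtain C where C: "C > 0" "\<And>n. 1 + ln (energy n) \<le> C * log3 n" using ln_energy by blast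
  define b where "b k = (if leverage k > 1 then 1 else (0::real))" for k
  have l2: "ln 2 > (0::real)" by simp
  have b: "b k \<le> ln (1 + leverage k) / ln 2" for k
    using leverage_nonneg[of k] l2 by (auto simp: b_def)
  define K where "K = ln (fact d) + real d * C"
  define D where "D = 1 + real (Suc p) * (K / ln 2)"
  have D0: "D \<ge> 0" using C l2 by (auto simp: D_def K_def intro!: add_nonneg_nonneg mult_nonneg_nonneg divide_nonneg_nonneg)
  have "(\<Sum>k<n. if p < k \<and> \<not> clean k then 1 else (0::real)) \<le> D * log3 n" for n
  proof -
    have "(\<Sum>k<n. if p < k \<and> \<not> clean k then 1 else (0::real))
       \<le> (\<Sum>k<n. (if k = Suc p then 1 else 0) + (\<Sum>i\<le>p. if p < k then b (k - Suc i) else 0))"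
    proof (rule sum_mono)
      fix k
      have nn: "0 \<le> (\<Sum>i\<le>p. if p < k then b (k - Suc i) else 0)" by (intro sum_nonneg) (simp add: b_def)
      show "(if p < k \<and> \<not> clean k then 1 else (0::real))
        \<le> (if k = Suc p then 1 else 0) + (\<Sum>i\<le>p. if p < k then b (k - Suc i) else 0)"
      proof (cases "p < k \<and> \<not> clean k \<and> k \<noteq> Suc p")
        case True
        then obtain i where i: "i \<le> p" "leverage (k - Suc i) > 1" by (auto simp: clean_def not_le)
        have "(if p < k then b (k - Suc i) else 0) \<le> (\<Sum>i\<le>p. if p < k then b (k - Suc i) else 0)"
          using i by (intro member_le_sum) (auto simp: b_def)
        thus ?thesis using True i by (simp add: b_def)
      qed (use nn in auto)
    qed
    also have "\<dots> = (\<Sum>k<n. if k = Suc p then 1 else 0) + (\<Sum>i\<le>p. \<Sum>k<n. if p < k then b (k - Suc i) else 0)"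
      by (simp only: sum.distrib) (subst sum.swap, simp)
    also have "\<dots> \<le> 1 + (\<Sum>i\<le>p. \<Sum>m<n. b m)"
      by (intro add_mono sum_mono sum_delayed_le) (auto simp: b_def)
    also have "\<dots> = 1 + real (Suc p) * (\<Sum>m<n. b m)" by simp
    also have "(\<Sum>m<n. b m) \<le> (\<Sum>m<n. ln (1 + leverage m) / ln 2)" by (intro sum_mono b)
    also have "\<dots> = (\<Sum>m<n. ln (1 + leverage m)) / ln 2" by (simp add: sum_divide_distrib)
    also have "\<dots> \<le> ((ln (fact d) + real d * C) * log3 n) / ln 2"
    proof (rule divide_right_mono)
      have "real d * ln (energy n) \<le> real d * (C * log3 n)" using C(2)[of n] by (intro mult_left_mono) auto
      moreover have "ln (fact d) * 1 \<le> ln (fact d) * log3 n" by (intro mult_left_mono log3_ge_1) auto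
      ultimately show "(\<Sum>m<n. ln (1 + leverage m)) \<le> (ln (fact d) + real d * C) * log3 n"
        using sum_ln_leverage_le[of n] by (simp add: algebra_simps)
    qed simp
    finally have "(\<Sum>k<n. if p < k \<and> \<not> clean k then 1 else (0::real))
      \<le> 1 + real (Suc p) * (((ln (fact d) + real d * C) * log3 n) / ln 2)" by simp
    also have "\<dots> = 1 + real (Suc p) * (K / ln 2) * log3 n" by (simp add: K_def)
    also have "\<dots> \<le> D * log3 n" using log3_ge_1[of n] unfolding D_def distrib_right mult_1 by linarith
    finally show ?thesis .
  qed
  thus ?thesis using D0 by blast
qed

lemma z_growth: "\<exists>D\<ge>0. \<forall>i n k. k < n \<longrightarrow> (z i k)\<^sup>2 \<le> D * (real n + 3) powr \<gamma>"
proof -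
  obtain C where C: "\<And>k. (V (Suc k))\<^sup>2 \<le> C * (real (Suc k)) powr \<gamma>" using V_growth by blast
  obtain E where E: "\<And>n. (\<epsilon> n)\<^sup>2 \<le> E * (real n + 1) powr \<gamma>" using \<epsilon>_growth[OF _ C] \<gamma> by auto
  have C0: "C \<ge> 0" using order_trans[OF zero_le_power2 C[of 0]] by simp
  have E0: "E \<ge> 0" using order_trans[OF zero_le_power2 E[of 0]] by simp
  have "(z i k)\<^sup>2 \<le> (C + E) * (real n + 3) powr \<gamma>" if "k < n" for i n k
  proof (cases "p < k")
    case True
    show ?thesis
    proof (cases "i \<le> p")
      case True
      have "(z i k)\<^sup>2 = (V (Suc (k - Suc i)))\<^sup>2" using True \<open>p < k\<close> by (simp add: z_def Suc_diff_Suc)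
      also have "\<dots> \<le> C * real (Suc (k - Suc i)) powr \<gamma>" by (rule C)
      also have "\<dots> \<le> (C + E) * (real n + 3) powr \<gamma>"
        using C0 E0 \<gamma> that by (intro mult_mono powr_mono2) auto
      finally show ?thesis .
    next
      case False
      have "(z i k)\<^sup>2 = (\<epsilon> (k - Suc p))\<^sup>2" using False \<open>p < k\<close> by (simp add: z_def)
      also have "\<dots> \<le> E * (real (k - Suc p) + 1) powr \<gamma>" by (rule E)
      also have "\<dots> \<le> (C + E) * (real n + 3) powr \<gamma>"
        using C0 E0 \<gamma> that by (intro mult_mono powr_mono2) auto
      finally show ?thesis .
    qed
  next
    case False
    thus ?thesis using C0 E0 by (simp add: z_def)
  qed
  moreover have "C + E \<ge> 0" using C0 E0 by simp
  ultimately show ?thesis by blast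
qed

lemma tracking_gap:
  assumes "clean k" "i \<le> p"
  shows "(X (int k - int i) - V (k - i))\<^sup>2 \<le> 2 * (x (Suc (k - Suc i)))\<^sup>2 + 4 * wgt_err (k - Suc i)"
proof -
  define m where "m = k - Suc i"
  have m: "m \<ge> 1" "k - i = Suc m" "int k - int i = int m + 1" and l: "leverage m \<le> 1"
    using assms by (auto simp: m_def clean_def)
  have "(X (int m + 1) - V (Suc m))\<^sup>2 = (x (Suc m) + pred_err m)\<^sup>2" using tracking[OF m(1)] by simp
  also have "\<dots> \<le> 2 * (x (Suc m))\<^sup>2 + 2 * (pred_err m)\<^sup>2"
    by (rule square_add_le)
  also have "(pred_err m)\<^sup>2 \<le> wgt_err m * 2"
    unfolding pred_err_square using l wgt_err_nonneg by (intro mult_left_mono) auto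
  finally show ?thesis using m unfolding m_def[symmetric] by simp
qed

text \<open>At clean times the regressor differs from its ideal form by reference values and
  \<open>wgt_err\<close>, whose sum is sublinear. The other times are O(ln n) in number, and there
  the ideal form is at most of order n^\<gamma> with \<gamma> below 1, so their total is sublinear
  too. The linear lower bound therefore survives.\<close>

lemma excitation: "\<exists>c>0. \<exists>N. \<forall>n\<ge>N. \<forall>u. c * real n * dot u u \<le> quad n u"
proof -
  obtain N0 where N0: "\<And>n c. n \<ge> N0 \<Longrightarrow> \<sigma>\<^sup>2 / 2 * real n * (\<Sum>i<d. (c i)\<^sup>2) \<le> (\<Sum>k<n. (\<Sum>i<d. c i * z i k)\<^sup>2)"
    using ideal_excitation by blast
  obtain \<kappa> B where \<kappa>: "\<kappa> > 0" and B: "B \<ge> 0"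
    and zc: "\<And>u. \<kappa> * dot u u \<le> (\<Sum>i<d. (zcoef u i)\<^sup>2)"
    and xc: "\<And>u. (\<Sum>i\<le>p. (xcoef u i)\<^sup>2) \<le> B * dot u u"
    using coefficient_bounds by blast
  obtain D where D: "D \<ge> 0" "\<And>i n k. k < n \<Longrightarrow> (z i k)\<^sup>2 \<le> D * (real n + 3) powr \<gamma>"
    using z_growth by blast
  obtain C where C: "C \<ge> 0"
    "\<And>n. (\<Sum>k<n. if p < k \<and> \<not> clean k then 1 else (0::real)) \<le> C * log3 n" using unclean_count by blast
  obtain CA where CA: "CA \<ge> 0" "\<And>n. (\<Sum>k<n. wgt_err k) \<le> CA * log3 n" using lyap_wgt_log by blast
  define s where "s m = 2 * (x (Suc m))\<^sup>2 + 4 * wgt_err m" for m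
  have s0: "s m \<ge> 0" for m using wgt_err_nonneg by (simp add: s_def)
  define f where "f n = 2 * B * real (Suc p) * (\<Sum>m<n. s m)" for n
  define g where "g n = real d * D * C * (log3 n * (real n + 3) powr \<gamma>)" for n
  have gs: "sublinear g"
    by (rule sublinear_mono[OF log3_times_powr_sublinear[of \<gamma>], of "real d * D * C"]) (use \<gamma> D C in \<open>auto simp: g_def\<close>)
  have fs: "sublinear f"
  proof (rule sublinear_mono[of "\<lambda>n. (\<Sum>k=1..n. (x k)\<^sup>2) + log3 n"])
    show "sublinear (\<lambda>n. (\<Sum>k=1..n. (x k)\<^sup>2) + log3 n)" by (rule sublinear_add[OF x_sublinear log3_sublinear])
    show "2 * B * real (Suc p) * (2 + 4 * CA) \<ge> 0" using B CA by simp
    fix n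
    have xs: "(\<Sum>k<n. (x (Suc k))\<^sup>2) = (\<Sum>k=1..n. (x k)\<^sup>2)"
      by (rule sum.reindex_bij_witness[where i="\<lambda>k. k - 1" and j=Suc]) auto
    have x0: "(\<Sum>k=1..n. (x k)\<^sup>2) \<ge> 0" by (simp add: sum_nonneg)
    have l0: "log3 n \<ge> 0" using log3_ge_1[of n] by simp
    have "(\<Sum>m<n. s m) = 2 * (\<Sum>k=1..n. (x k)\<^sup>2) + 4 * (\<Sum>k<n. wgt_err k)"
      by (simp only: s_def sum.distrib sum_distrib_left[symmetric] xs)
    also have "\<dots> \<le> 2 * (\<Sum>k=1..n. (x k)\<^sup>2) + 4 * (CA * log3 n)" using CA(2)[of n] by simp
    also have "\<dots> \<le> (2 + 4 * CA) * (\<Sum>k=1..n. (x k)\<^sup>2) + (2 + 4 * CA) * log3 n"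
      using CA(1) x0 l0 by (intro add_mono) (auto simp: distrib_right mult.assoc)
    finally have "(\<Sum>m<n. s m) \<le> (2 + 4 * CA) * ((\<Sum>k=1..n. (x k)\<^sup>2) + log3 n)" by (simp add: distrib_left)
    hence "2 * B * real (Suc p) * (\<Sum>m<n. s m) \<le> 2 * B * real (Suc p) * ((2 + 4 * CA) * ((\<Sum>k=1..n. (x k)\<^sup>2) + log3 n))"
      using B by (intro mult_left_mono) auto
    thus "f n \<le> 2 * B * real (Suc p) * (2 + 4 * CA) * ((\<Sum>k=1..n. (x k)\<^sup>2) + log3 n)"
      by (simp add: f_def mult.assoc)
  qed
  have main: "(\<Sum>k<n. (\<Sum>i<d. zcoef u i * z i k)\<^sup>2) \<le> 2 * quad n u + dot u u * f n + (\<Sum>i<d. (zcoef u i)\<^sup>2) * g n" for n u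
  proof -
    define c2 where "c2 = (\<Sum>i<d. (zcoef u i)\<^sup>2)"
    have c20: "c2 \<ge> 0" by (simp add: c2_def sum_nonneg)
    define G where "G = c2 * (real d * (D * (real n + 3) powr \<gamma>))"
    have G0: "G \<ge> 0" using c20 D by (simp add: G_def)
    define Y where "Y k = (\<Sum>i\<le>p. if p < k then s (k - Suc i) else 0)" for k
    have Y0: "Y k \<ge> 0" for k using s0 by (simp add: Y_def sum_nonneg)
    have u0: "dot u u \<ge> 0" by (rule dot_self_nonneg)
    have pt: "(\<Sum>i<d. zcoef u i * z i k)\<^sup>2
       \<le> 2 * (dot (\<Phi> k) u)\<^sup>2 + 2 * (B * dot u u * Y k) + G * (if p < k \<and> \<not> clean k then 1 else 0)"
      if k: "k < n" for k
    proof -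
      have nn: "0 \<le> 2 * (B * dot u u * Y k)" "0 \<le> 2 * (dot (\<Phi> k) u)\<^sup>2"
        using B u0 Y0 by auto
      consider "\<not> p < k" | "clean k" "p < k" | "p < k" "\<not> clean k" by blast
      thus ?thesis
      proof cases
        case 1
        hence "z i k = 0" for i by (simp add: z_def)
        thus ?thesis using nn 1 by simp
      next
        case 2
        define h where "h = (\<Sum>i\<le>p. xcoef u i * (X (int k - int i) - V (k - i)))"
        have "h\<^sup>2 \<le> (\<Sum>i\<le>p. (xcoef u i)\<^sup>2) * (\<Sum>i\<le>p. (X (int k - int i) - V (k - i))\<^sup>2)"
          unfolding h_def by (rule Cauchy_Schwarz_ineq_sum)
        also have "\<dots> \<le> (B * dot u u) * Y k"
        proof (intro mult_mono xc)
          show "(\<Sum>i\<le>p. (X (int k - int i) - V (k - i))\<^sup>2) \<le> Y k"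
            unfolding Y_def s_def using tracking_gap[OF 2(1)] 2(2) by (intro sum_mono) auto
        qed (use B u0 in \<open>auto intro: sum_nonneg\<close>)
        finally have h: "h\<^sup>2 \<le> B * dot u u * Y k" .
        have "(\<Sum>i<d. zcoef u i * z i k) = dot (\<Phi> k) u - h"
          using regressor_decomposition[OF 2(2)] by (simp add: h_def)
        hence "(\<Sum>i<d. zcoef u i * z i k)\<^sup>2 \<le> 2 * (dot (\<Phi> k) u)\<^sup>2 + 2 * h\<^sup>2" using square_diff_le by simp
        thus ?thesis using h 2 by simp
      next
        case 3
        have "(\<Sum>i<d. zcoef u i * z i k)\<^sup>2 \<le> c2 * (\<Sum>i<d. (z i k)\<^sup>2)"
          unfolding c2_def by (rule Cauchy_Schwarz_ineq_sum)
        also have "\<dots> \<le> c2 * (\<Sum>i<d. D * (real n + 3) powr \<gamma>)"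
          using c20 k by (intro mult_left_mono sum_mono D(2))
        also have "\<dots> = G" by (simp add: G_def)
        finally have "(\<Sum>i<d. zcoef u i * z i k)\<^sup>2 \<le> G" .
        moreover have "G * (if p < k \<and> \<not> clean k then 1 else 0) = G" using 3 by simp
        ultimately show ?thesis using nn by linarith
      qed
    qed
    have "(\<Sum>k<n. (\<Sum>i<d. zcoef u i * z i k)\<^sup>2)
      \<le> (\<Sum>k<n. 2 * (dot (\<Phi> k) u)\<^sup>2 + 2 * (B * dot u u * Y k) + G * (if p < k \<and> \<not> clean k then 1 else 0))"
      by (intro sum_mono pt) simp
    also have "\<dots> = 2 * (\<Sum>k<n. (dot (\<Phi> k) u)\<^sup>2) + 2 * (B * dot u u * (\<Sum>k<n. Y k))
        + G * (\<Sum>k<n. if p < k \<and> \<not> clean k then 1 else 0)"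
      by (simp only: sum.distrib sum_distrib_left)
    also have "\<dots> \<le> 2 * quad n u + 2 * (B * dot u u * (real (Suc p) * (\<Sum>m<n. s m))) + G * (C * log3 n)"
    proof (intro add_mono mult_left_mono C(2))
      show "(\<Sum>k<n. (dot (\<Phi> k) u)\<^sup>2) \<le> quad n u" using u0 by (simp add: quad_def)
      have "(\<Sum>k<n. Y k) = (\<Sum>i\<le>p. \<Sum>k<n. if p < k then s (k - Suc i) else 0)"
        unfolding Y_def by (rule sum.swap)
      also have "\<dots> \<le> (\<Sum>i\<le>p. \<Sum>m<n. s m)" by (intro sum_mono sum_delayed_le s0) auto
      finally show "(\<Sum>k<n. Y k) \<le> real (Suc p) * (\<Sum>m<n. s m)" by simp
    qed (use B u0 G0 in auto)
    also have "\<dots> = 2 * quad n u + dot u u * f n + c2 * g n"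
      by (simp add: f_def g_def G_def)
    finally show ?thesis by (simp add: c2_def)
  qed
  define S where "S = \<sigma>\<^sup>2"
  have S: "S > 0" using \<sigma> by (simp add: S_def)
  \<comment> \<open>From S/2 the term with g takes 5S/16, leaving 3S/16. Passing from the
    coefficients to u brings in \<kappa>, the term with f takes \<kappa>S/8, and \<kappa>S/16
    remains for twice the form.\<close>
  have "S / 4 > 0" "\<kappa> * S / 16 > 0" using S \<kappa> by auto
  then obtain Cg Cf where Cg: "\<And>n. g n \<le> S / 4 * real n + Cg" and Cf: "\<And>n. f n \<le> \<kappa> * S / 16 * real n + Cf"
    using gs fs unfolding sublinear_def by meson
  define N where "N = max N0 (nat \<lceil>max (16 * Cg / S) (16 * Cf / (\<kappa> * S))\<rceil>)"
  have "\<kappa> * S / 32 * real n * dot u u \<le> quad n u" if n: "n \<ge> N" for n u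
  proof -
    define c2 where "c2 = (\<Sum>i<d. (zcoef u i)\<^sup>2)"
    have c20: "c2 \<ge> 0" by (simp add: c2_def sum_nonneg)
    have u0: "dot u u \<ge> 0" by (rule dot_self_nonneg)
    have "max (16 * Cg / S) (16 * Cf / (\<kappa> * S)) \<le> real n" using n unfolding N_def by linarith
    hence cg: "Cg \<le> S / 16 * real n" and cf: "Cf \<le> \<kappa> * S / 16 * real n"
      using S \<kappa> by (auto simp: divide_le_eq mult.commute)
    have "S / 2 * real n * c2 \<le> 2 * quad n u + dot u u * f n + c2 * g n"
      using main[of u n] N0[of n "zcoef u"] n unfolding c2_def S_def N_def by (smt (verit) max.bounded_iff)
    moreover have "dot u u * f n \<le> dot u u * (\<kappa> * S / 8 * real n)"
      using Cf[of n] cf u0 by (intro mult_left_mono) auto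
    moreover have "c2 * g n \<le> c2 * (5 * S / 16 * real n)"
      using Cg[of n] cg c20 by (intro mult_left_mono) auto
    moreover have "S / 2 * real n * c2 - c2 * (5 * S / 16 * real n) = 3 * S / 16 * real n * c2"
      by (simp add: algebra_simps)
    moreover have "3 * S / 16 * real n * (\<kappa> * dot u u) \<le> 3 * S / 16 * real n * c2"
      using zc[of u] S unfolding c2_def by (intro mult_left_mono) auto
    moreover have "3 * S / 16 * real n * (\<kappa> * dot u u) - dot u u * (\<kappa> * S / 8 * real n)
        = 2 * (\<kappa> * S / 32 * real n * dot u u)" by (simp add: algebra_simps)
    ultimately show ?thesis by linarith
  qed
  moreover have "\<kappa> * S / 32 > 0" using S \<kappa> by simp
  ultimately show ?thesis by blast
qed

text \<open>Excitation improves the gain at time k to order 1/k. Since the sum of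
  \<open>wgt_err\<close> grows logarithmically, the sum of \<open>wgt_err k / real k\<close> is
  bounded, and the exponential factor becomes a constant.\<close>

lemma energy_linear: "\<exists>C>0. \<forall>n. energy n \<le> C * (real n + 1)"
proof -
  obtain c N where c: "c > 0" and ex: "\<And>n u. n \<ge> N \<Longrightarrow> c * real n * dot u u \<le> quad n u"
    using excitation by blast
  obtain C K where CK: "C > 0" "K > 0"
    and eg: "\<And>b n. (\<forall>k. b k \<ge> 0) \<Longrightarrow> (\<forall>k. leverage k \<le> 1 + b k * dot (\<Phi> k) (\<Phi> k)) \<Longrightarrow>
      energy n \<le> C * exp (K * (\<Sum>k<n. b k * wgt_err k)) * (real n + 1 + (\<Sum>k<n. wgt_err k))"
    using energy_growth by blast
  obtain CA where CA: "CA \<ge> 0" "\<And>n. (\<Sum>k<n. wgt_err k) \<le> CA * log3 n" using lyap_wgt_log by blast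
  obtain B where B: "\<And>n. (\<Sum>k<n. wgt_err k / real k) \<le> B"
    using sum_div_index_bounded[OF wgt_err_nonneg CA(2)] by blast
  define M where "M = max N 1"
  \<comment> \<open>Before excitation sets in, the trace drops still serve as gains; they affect
    finitely many terms.\<close>
  define b where "b k = (if k < M then trace_drop k else 1 / (c * real k))" for k
  have b0: "\<forall>k. b k \<ge> 0" using c trace_drop_nonneg by (simp add: b_def)
  have lev: "\<forall>k. leverage k \<le> 1 + b k * dot (\<Phi> k) (\<Phi> k)"
  proof
    fix k
    show "leverage k \<le> 1 + b k * dot (\<Phi> k) (\<Phi> k)"
    proof (cases "k < M")
      case True thus ?thesis using leverage_le_trace_drop by (simp add: b_def)
    next
      case False
      hence k: "k \<ge> N" "k \<ge> 1" by (auto simp: M_def)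
      have "leverage k \<le> dot (\<Phi> k) (\<Phi> k) / (c * real k)"
        using k c ex by (intro leverage_le_of_excitation) auto
      thus ?thesis using False by (simp add: b_def)
    qed
  qed
  define B1 where "B1 = (\<Sum>k<M. trace_drop k * wgt_err k) + B / c"
  have bs: "(\<Sum>k<n. b k * wgt_err k) \<le> B1" for n
  proof -
    have "(\<Sum>k<n. b k * wgt_err k) \<le> (\<Sum>k<n. (if k < M then trace_drop k * wgt_err k else 0) + (wgt_err k / real k) / c)"
      using wgt_err_nonneg c by (intro sum_mono) (auto simp: b_def mult.commute)
    also have "\<dots> = (\<Sum>k\<in>{..<n} \<inter> {k. k < M}. trace_drop k * wgt_err k) + (\<Sum>k<n. wgt_err k / real k) / c"
      by (subst sum.inter_restrict) (auto simp: sum.distrib sum_divide_distrib)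
    also have "\<dots> \<le> B1" unfolding B1_def
      using trace_drop_nonneg wgt_err_nonneg B c by (intro add_mono sum_mono2 divide_right_mono) auto
    finally show ?thesis .
  qed
  obtain CL where CL: "\<And>n. log3 n \<le> 1 * real n + CL"
    using log3_sublinear[unfolded sublinear_def, rule_format, of 1] by auto
  define E where "E = C * exp (K * B1) * (1 + CA * (1 + \<bar>CL\<bar>))"
  have "energy n \<le> E * (real n + 1)" for n
  proof -
    have A0: "(\<Sum>k<n. wgt_err k) \<ge> 0" by (simp add: sum_nonneg wgt_err_nonneg)
    have "log3 n \<le> (1 + \<bar>CL\<bar>) * (real n + 1)"
      using CL[of n] mult_nonneg_nonneg[of "\<bar>CL\<bar>" "real n"] unfolding distrib_right distrib_left by linarith
    hence "CA * log3 n \<le> CA * ((1 + \<bar>CL\<bar>) * (real n + 1))" using CA by (intro mult_left_mono)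
    hence "real n + 1 + (\<Sum>k<n. wgt_err k) \<le> (real n + 1) + CA * ((1 + \<bar>CL\<bar>) * (real n + 1))"
      using CA(2)[of n] by linarith
    also have "\<dots> = (1 + CA * (1 + \<bar>CL\<bar>)) * (real n + 1)" by (simp only: distrib_right mult_1 mult.assoc)
    finally have 1: "real n + 1 + (\<Sum>k<n. wgt_err k) \<le> (1 + CA * (1 + \<bar>CL\<bar>)) * (real n + 1)" .
    have "energy n \<le> C * exp (K * (\<Sum>k<n. b k * wgt_err k)) * (real n + 1 + (\<Sum>k<n. wgt_err k))"
      by (rule eg[OF b0 lev])
    also have "\<dots> \<le> C * exp (K * B1) * ((1 + CA * (1 + \<bar>CL\<bar>)) * (real n + 1))"
      using bs[of n] 1 CK A0 by (intro mult_mono mult_left_mono) auto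
    finally show ?thesis by (simp add: E_def mult.assoc)
  qed
  moreover have "E > 0" using CK CA by (simp add: E_def add_pos_nonneg)
  ultimately show ?thesis by blast
qed

lemma estimation_error_rate: "\<exists>C>0. \<exists>N. \<forall>n\<ge>N. dot (e n) (e n) \<le> C * log3 n / real n"
proof -
  obtain c N where c: "c > 0" and ex: "\<And>n u. n \<ge> N \<Longrightarrow> c * real n * dot u u \<le> quad n u"
    using excitation by blast
  obtain CA where CA: "CA \<ge> 0" "\<And>n. lyap n \<le> CA * log3 n" using lyap_wgt_log by blast
  have "dot (e n) (e n) \<le> (CA + 1) / c * log3 n / real n" if n: "n \<ge> max N 1" for n
  proof -
    have "c * real n * dot (e n) (e n) \<le> CA * log3 n"
      using ex[of n "e n"] CA(2)[of n] n by (simp add: lyap_def)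
    also have "\<dots> \<le> (CA + 1) * log3 n" using log3_ge_1[of n] by (intro mult_right_mono) auto
    finally show ?thesis using c n by (simp add: field_simps)
  qed
  moreover have "(CA + 1) / c > 0" using c CA by simp
  ultimately show ?thesis by blast
qed

text \<open>Since \<epsilon> is a fixed linear functional \<open>a\<close> of the regressor, the sum
  is, up to a constant, \<open>a\<close> applied to the Gram matrix times the error. The square of
  this is at most of order energy squared times the squared error, that is n^2 times ln n /
  n.\<close>

lemma \<epsilon>V_rate: "\<exists>C>0. \<exists>N. \<forall>n\<ge>N. (\<Sum>k<n. \<epsilon> k * V (Suc k))\<^sup>2 \<le> C * (real n * log3 n)"
proof -
  obtain CE where CE: "CE > 0" "\<And>n. energy n \<le> CE * (real n + 1)" using energy_linear by blast
  obtain C N where C: "C > 0" and er: "\<And>n. n \<ge> N \<Longrightarrow> dot (e n) (e n) \<le> C * log3 n / real n"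
    using estimation_error_rate by blast
  define a where "a i = (if i \<le> p then ucoef i else (-1::real))" for i
  have eps: "\<epsilon> k = dot (\<Phi> k) a" if "k \<ge> 1" for k
  proof -
    have "dot (\<Phi> k) a = (\<Sum>i\<le>p. ucoef i * X (int k - int i)) - U (int k - 1)"
      unfolding dot_regressor by (simp add: a_def)
    thus ?thesis using U_eq_ucoef[OF that] by simp
  qed
  \<comment> \<open>At time 0 neither \<open>\<epsilon> 0\<close> is the functional of the regressor
    nor \<open>W 0\<close> equal to \<open>V 1\<close>; this constant covers the mismatch.\<close>
  define b where "b = \<bar>dot a (e 0)\<bar> + \<bar>\<epsilon> 0 * V 1 - W 0 * dot (\<Phi> 0) a\<bar>"
  have key: "\<bar>\<Sum>k<n. \<epsilon> k * V (Suc k)\<bar> \<le> \<bar>dot a (gram_apply n (e n))\<bar> + b" for n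
  proof -
    have "dot a (gram_apply n (e n)) = dot a (\<lambda>i. e 0 i + (\<Sum>k<n. W k * \<Phi> k i))"
      by (intro dot_cong normal_equation)
    also have "\<dots> = dot a (e 0) + (\<Sum>i<d. \<Sum>k<n. a i * (W k * \<Phi> k i))"
      by (simp add: dot_def distrib_left sum.distrib sum_distrib_left)
    also have "(\<Sum>i<d. \<Sum>k<n. a i * (W k * \<Phi> k i)) = (\<Sum>k<n. W k * dot (\<Phi> k) a)"
      by (subst sum.swap) (simp add: dot_def sum_distrib_left ac_simps)
    finally have 1: "dot a (gram_apply n (e n)) = dot a (e 0) + (\<Sum>k<n. W k * dot (\<Phi> k) a)" .
    have "(\<Sum>k<n. \<epsilon> k * V (Suc k)) - (\<Sum>k<n. W k * dot (\<Phi> k) a)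
      = (\<Sum>k<n. if k = 0 then \<epsilon> 0 * V 1 - W 0 * dot (\<Phi> 0) a else 0)"
      unfolding sum_subtractf[symmetric] by (intro sum.cong) (auto simp: eps W_eq)
    also have "\<bar>\<dots>\<bar> \<le> \<bar>\<epsilon> 0 * V 1 - W 0 * dot (\<Phi> 0) a\<bar>" by simp
    finally show ?thesis using 1 unfolding b_def by linarith
  qed
  have ge: "(dot a (gram_apply n u))\<^sup>2 \<le> dot a a * (real d * (energy n)\<^sup>2 * real d * dot u u)" for n u
  proof -
    have "dot (gram_apply n u) (gram_apply n u) = (\<Sum>i<d. (gram_apply n u i)\<^sup>2)"
      by (simp add: dot_def power2_eq_square)
    also have "\<dots> \<le> (\<Sum>i<d. real d * (energy n)\<^sup>2 * dot u u)"
    proof (rule sum_mono)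
      fix i assume i: "i \<in> {..<d}"
      have "(gram_apply n u i)\<^sup>2 \<le> (\<Sum>j<d. (gram n i j)\<^sup>2) * (\<Sum>j<d. (u j)\<^sup>2)"
        unfolding gram_apply_def by (rule Cauchy_Schwarz_ineq_sum)
      also have "\<dots> \<le> (\<Sum>j<d. (energy n)\<^sup>2) * (\<Sum>j<d. (u j)\<^sup>2)"
        using gram_abs_le_energy[of i _ n] i energy_ge_1[of n]
        by (intro mult_right_mono sum_mono) (auto simp: abs_le_square_iff[symmetric] intro: sum_nonneg)
      finally show "(gram_apply n u i)\<^sup>2 \<le> real d * (energy n)\<^sup>2 * dot u u"
        by (simp add: dot_def power2_eq_square)
    qed
    finally have "dot a a * dot (gram_apply n u) (gram_apply n u) \<le> dot a a * (real d * (energy n)\<^sup>2 * real d * dot u u)"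
      using dot_self_nonneg[of a] by (intro mult_left_mono) (auto simp: ac_simps)
    with dot_Cauchy_Schwarz[of a "gram_apply n u"] show ?thesis by (rule order_trans)
  qed
  define A where "A = dot a a * (real d * real d)"
  have A0: "A \<ge> 0" using dot_self_nonneg[of a] by (simp add: A_def)
  define Z where "Z = 2 * (A * (4 * CE\<^sup>2 * C)) + 2 * b\<^sup>2 + 1"
  have "(\<Sum>k<n. \<epsilon> k * V (Suc k))\<^sup>2 \<le> Z * (real n * log3 n)" if n: "n \<ge> max N 1" for n
  proof -
    have n1: "real n \<ge> 1" "n \<ge> N" using n by auto
    have nl: "1 \<le> real n * log3 n" using n1 log3_ge_1[of n] mult_mono[of 1 "real n" 1 "log3 n"] by simp
    have "CE * (real n + 1) \<le> CE * (2 * real n)" using CE(1) n1 by (intro mult_left_mono) auto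
    hence "energy n \<le> 2 * CE * real n" using CE(2)[of n] by linarith
    hence e2: "(energy n)\<^sup>2 \<le> (2 * CE * real n)\<^sup>2" using energy_ge_1[of n] by (intro power_mono) auto
    have "(energy n)\<^sup>2 * dot (e n) (e n) \<le> (2 * CE * real n)\<^sup>2 * (C * log3 n / real n)"
      using e2 er[OF n1(2)] by (intro mult_mono dot_self_nonneg) auto
    also have "\<dots> = 4 * CE\<^sup>2 * C * (real n * log3 n)" using n1 by (simp add: power2_eq_square)
    finally have 1: "(energy n)\<^sup>2 * dot (e n) (e n) \<le> 4 * CE\<^sup>2 * C * (real n * log3 n)" .
    have "(dot a (gram_apply n (e n)))\<^sup>2 \<le> A * ((energy n)\<^sup>2 * dot (e n) (e n))"
      using ge[of n "e n"] by (simp add: A_def ac_simps)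
    also have "\<dots> \<le> A * (4 * CE\<^sup>2 * C * (real n * log3 n))" using 1 A0 by (intro mult_left_mono)
    finally have 2: "(dot a (gram_apply n (e n)))\<^sup>2 \<le> A * (4 * CE\<^sup>2 * C) * (real n * log3 n)" by (simp add: mult.assoc)
    have b0: "b \<ge> 0" by (simp add: b_def)
    have "(\<Sum>k<n. \<epsilon> k * V (Suc k))\<^sup>2 \<le> (\<bar>dot a (gram_apply n (e n))\<bar> + b)\<^sup>2"
      using key[of n] b0 by (subst abs_le_square_iff[symmetric]) simp
    also have "\<dots> \<le> 2 * (dot a (gram_apply n (e n)))\<^sup>2 + 2 * b\<^sup>2"
      using square_add_le[of "\<bar>dot a (gram_apply n (e n))\<bar>" b] by simp
    also have "\<dots> \<le> 2 * (A * (4 * CE\<^sup>2 * C) * (real n * log3 n)) + 2 * b\<^sup>2 * (real n * log3 n)"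
      using 2 nl mult_left_mono[OF nl, of "2 * b\<^sup>2"] by simp
    also have "\<dots> \<le> Z * (real n * log3 n)" using nl by (simp add: Z_def distrib_right mult.assoc)
    finally show ?thesis .
  qed
  moreover have "Z > 0" using A0 C by (simp add: Z_def add_nonneg_pos)
  ultimately show ?thesis by blast
qed

end

subsection \<open>Statistics of the residuals\<close>

lemma sum_from_1: "(\<Sum>k=1..n. f k) = (\<Sum>k<n. f (Suc k))" for f :: "nat \<Rightarrow> real"
  by (rule sum.reindex_bij_witness[where i=Suc and j="\<lambda>k. k - 1"]) auto

lemma log3_le_linear: "log3 n \<le> real n + 3"
  using ln_le_minus_one[of "real n + 3"] by (simp add: log3_def)

lemma log3_bigo: "(\<lambda>n. log3 n / real n) \<in> O(\<lambda>n. ln (real n) / real n)"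
  unfolding log3_def by real_asymp

lemma bigo_log_rateI:
  fixes f :: "nat \<Rightarrow> real"
  assumes "\<And>n. n \<ge> N \<Longrightarrow> \<bar>f n\<bar> \<le> C * (log3 n / real n)"
  shows "f \<in> O(\<lambda>n. ln (real n) / real n)"
proof -
  have "f \<in> O(\<lambda>n. log3 n / real n)"
    by (rule bigoI[of _ C], rule eventually_sequentiallyI[of N])
      (use assms log3_ge_1 in \<open>auto simp: abs_of_nonneg order_trans[OF zero_le_one]\<close>)
  thus ?thesis using log3_bigo by (rule landau_o.big_trans)
qed

context closed_loop
begin

lemma log3_le_4n: "n \<ge> 1 \<Longrightarrow> log3 n \<le> 4 * real n"
  using log3_le_linear[of n] by (simp add: algebra_simps)

lemma \<epsilon>_square_sum_lower: "\<exists>c>0. \<exists>N. \<forall>n\<ge>N. c * real n \<le> (\<Sum>k<n. (\<epsilon> k)\<^sup>2)"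
proof -
  define \<tau> where "\<tau> = \<sigma>\<^sup>2 / (1 - \<rho>\<^sup>2)"
  have t: "\<tau> > 0" using \<rho>2 \<sigma> by (simp add: \<tau>_def)
  obtain C where C: "\<And>n. \<bar>\<Sum>k<n. (\<epsilon> k)\<^sup>2 - \<tau>\<bar> \<le> \<tau> / 4 * real n + C"
    using small_sumsD[OF \<epsilon>_centered_small[folded \<tau>_def], of "\<tau> / 4"] t by auto
  have "\<tau> / 2 * real n \<le> (\<Sum>k<n. (\<epsilon> k)\<^sup>2)" if n: "n \<ge> nat \<lceil>4 * C / \<tau>\<rceil>" for n
  proof -
    have "4 * C / \<tau> \<le> real n" using n by linarith
    hence "4 * C \<le> \<tau> * real n" using t by (simp add: divide_le_eq mult.commute)
    moreover have "\<tau> * real n - \<tau> / 4 * real n - C \<le> (\<Sum>k<n. (\<epsilon> k)\<^sup>2)"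
      using C[of n] by (simp add: sum_subtractf mult.commute)
    ultimately show ?thesis by linarith
  qed
  moreover have "\<tau> / 2 > 0" using t by simp
  ultimately show ?thesis by blast
qed

definition serial_corr :: "(nat \<Rightarrow> nat \<Rightarrow> real) \<Rightarrow> nat \<Rightarrow> real" where
  "serial_corr res n = (\<Sum>k<n. res n (Suc k) * res n k) / (\<Sum>k<n. (res n k)\<^sup>2)"

definition dw_ratio :: "(nat \<Rightarrow> nat \<Rightarrow> real) \<Rightarrow> nat \<Rightarrow> real" where
  "dw_ratio res n = (\<Sum>k<n. (res n (Suc k) - res n k)\<^sup>2) / (\<Sum>k<Suc n. (res n k)\<^sup>2)"

text \<open>All that the statistics need to know about a triangular array of residuals. The sum
  includes time n because the last residual enters the numerators.\<close>

definition good_residuals :: "(nat \<Rightarrow> nat \<Rightarrow> real) \<Rightarrow> bool" where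
  "good_residuals res \<longleftrightarrow> (\<exists>C>0. \<exists>N. \<forall>n\<ge>N. (\<Sum>k<Suc n. (\<epsilon> k - res n k)\<^sup>2) \<le> C * log3 n)"

text \<open>A logarithmic perturbation cannot destroy the linear growth of the squares of
  \<epsilon>.\<close>

lemma residual_square_sum_lower:
  assumes "good_residuals res"
  shows "\<exists>c>0. \<exists>N. \<forall>n\<ge>N. c * real n \<le> (\<Sum>k<n. (res n k)\<^sup>2)"
proof -
  obtain C N where C: "C > 0" and R: "\<And>n. n \<ge> N \<Longrightarrow> (\<Sum>k<Suc n. (\<epsilon> k - res n k)\<^sup>2) \<le> C * log3 n"
    using assms unfolding good_residuals_def by blast
  obtain c N1 where c: "c > 0" and Q: "\<And>n. n \<ge> N1 \<Longrightarrow> c * real n \<le> (\<Sum>k<n. (\<epsilon> k)\<^sup>2)"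
    using \<epsilon>_square_sum_lower by blast
  have "c / (8 * C) > 0" using c C by simp
  then obtain B where B: "\<And>n. log3 n \<le> c / (8 * C) * real n + B"
    using log3_sublinear unfolding sublinear_def by blast
  define N2 where "N2 = max (max N N1) (nat \<lceil>8 * C * B / c\<rceil>)"
  have "c / 4 * real n \<le> (\<Sum>k<n. (res n k)\<^sup>2)" if n: "n \<ge> N2" for n
  proof -
    have "8 * C * B / c \<le> real n" using n unfolding N2_def by linarith
    hence b: "8 * C * B \<le> c * real n" using c by (simp add: divide_le_eq mult.commute)
    have "C * log3 n \<le> C * (c / (8 * C) * real n + B)" using B[of n] C by (intro mult_left_mono) auto
    also have "\<dots> = c * real n / 8 + C * B" using C by (simp add: distrib_left)
    finally have l: "C * log3 n \<le> c * real n / 4" using b by linarith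
    have "(\<Sum>k<n. (\<epsilon> k)\<^sup>2) \<le> (\<Sum>k<n. 2 * (res n k)\<^sup>2 + 2 * (\<epsilon> k - res n k)\<^sup>2)"
    proof (rule sum_mono)
      fix k show "(\<epsilon> k)\<^sup>2 \<le> 2 * (res n k)\<^sup>2 + 2 * (\<epsilon> k - res n k)\<^sup>2"
        using square_add_le[of "res n k" "\<epsilon> k - res n k"] by simp
    qed
    also have "\<dots> = 2 * (\<Sum>k<n. (res n k)\<^sup>2) + 2 * (\<Sum>k<n. (\<epsilon> k - res n k)\<^sup>2)"
      by (simp only: sum.distrib sum_distrib_left)
    finally have 1: "(\<Sum>k<n. (\<epsilon> k)\<^sup>2) \<le> 2 * (\<Sum>k<n. (res n k)\<^sup>2) + 2 * (\<Sum>k<n. (\<epsilon> k - res n k)\<^sup>2)" .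
    have "(\<Sum>k<n. (\<epsilon> k - res n k)\<^sup>2) \<le> C * log3 n"
      by (rule order_trans[OF _ R]) (use n in \<open>auto simp: N2_def\<close>)
    thus ?thesis using 1 l Q[of n] n unfolding N2_def by simp
  qed
  thus ?thesis using c by (intro exI[of _ "c / 4"]) auto
qed

lemma serial_corr_error:
  assumes "good_residuals res"
  shows "\<exists>C>0. \<exists>N. \<forall>n\<ge>N. (serial_corr res n - \<rho>)\<^sup>2 \<le> C * (log3 n / real n)"
proof -
  obtain C N where C: "C > 0" and R: "\<And>n. n \<ge> N \<Longrightarrow> (\<Sum>k<Suc n. (\<epsilon> k - res n k)\<^sup>2) \<le> C * log3 n"
    using assms unfolding good_residuals_def by blast
  obtain c N1 where c: "c > 0" and J: "\<And>n. n \<ge> N1 \<Longrightarrow> c * real n \<le> (\<Sum>k<n. (res n k)\<^sup>2)"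
    using residual_square_sum_lower[OF assms] by blast
  obtain CM N2 where CM: "CM > 0" and M: "\<And>n. n \<ge> N2 \<Longrightarrow> (\<Sum>k<n. \<epsilon> k * V (Suc k))\<^sup>2 \<le> CM * (real n * log3 n)"
    using \<epsilon>V_rate by blast
  obtain CV where CV: "CV > 0" "\<And>n. (\<Sum>k<n. (V (Suc k))\<^sup>2) \<le> CV * (real n + 1)" using V_square_sum by blast
  obtain CE where CE: "CE > 0" "\<And>n. (\<Sum>k<n. (\<epsilon> k)\<^sup>2) \<le> CE * (real n + 1)" using \<epsilon>_square_sum by blast
  define K where "K = 3 * (CM + C * (2 * CV) + (4 * CE + 8 * C) * (4 * C))"
  have K: "K > 0" using CM C CV CE by (simp add: K_def add_pos_pos)
  have "(serial_corr res n - \<rho>)\<^sup>2 \<le> K / c\<^sup>2 * (log3 n / real n)" if n: "n \<ge> max (max N N1) (max N2 1)" for n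
  proof -
    have n1: "real n \<ge> 1" "n \<ge> 1" using n by auto
    have l1: "log3 n \<ge> 1" by (rule log3_ge_1)
    define r where "r k = \<epsilon> k - res n k" for k
    define Jn where "Jn = (\<Sum>k<n. (res n k)\<^sup>2)"
    define q where "q k = r (Suc k) - \<rho> * r k" for k
    have RS: "(\<Sum>k<Suc n. (r k)\<^sup>2) \<le> C * log3 n" using R[of n] n by (simp add: r_def)
    have R0: "(\<Sum>k<n. (r k)\<^sup>2) \<le> C * log3 n" by (rule order_trans[OF _ RS]) simp
    have R1: "(\<Sum>k<n. (r (Suc k))\<^sup>2) \<le> C * log3 n"
      by (rule order_trans[OF _ RS]) (simp add: sum.lessThan_Suc_shift del: sum.lessThan_Suc)
    have Jpos: "Jn \<ge> c * real n" "Jn > 0" using J[of n] n c n1 unfolding Jn_def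
      by (auto intro: less_le_trans[of 0 "c * real n"])
    \<comment> \<open>The numerator error splits into the noise sum, whose rate is known, and two
      sums containing the perturbation. Cauchy-Schwarz bounds each of these by a linear times a
      logarithmic square sum, so all three squares are O(n ln n).\<close>
    have "(\<Sum>k<n. res n (Suc k) * res n k) - \<rho> * Jn = (\<Sum>k<n. res n k * (res n (Suc k) - \<rho> * res n k))"
      by (simp add: Jn_def right_diff_distrib sum_subtractf sum_distrib_left power2_eq_square ac_simps)
    also have "\<dots> = (\<Sum>k<n. \<epsilon> k * V (Suc k) - r k * V (Suc k) - res n k * q k)"
      by (intro sum.cong) (auto simp: r_def q_def \<epsilon>_Suc algebra_simps)
    also have "\<dots> = (\<Sum>k<n. \<epsilon> k * V (Suc k)) - (\<Sum>k<n. r k * V (Suc k)) - (\<Sum>k<n. res n k * q k)"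
      by (simp add: sum_subtractf)
    finally have dec: "(\<Sum>k<n. res n (Suc k) * res n k) - \<rho> * Jn
      = (\<Sum>k<n. \<epsilon> k * V (Suc k)) - (\<Sum>k<n. r k * V (Suc k)) - (\<Sum>k<n. res n k * q k)" .
    have t1: "(\<Sum>k<n. \<epsilon> k * V (Suc k))\<^sup>2 \<le> CM * (real n * log3 n)" using M[of n] n by simp
    have "(\<Sum>k<n. r k * V (Suc k))\<^sup>2 \<le> (\<Sum>k<n. (r k)\<^sup>2) * (\<Sum>k<n. (V (Suc k))\<^sup>2)" by (rule Cauchy_Schwarz_ineq_sum)
    also have "\<dots> \<le> (C * log3 n) * (CV * (2 * real n))"
    proof (intro mult_mono R0)
      have "CV * (real n + 1) \<le> CV * (2 * real n)" using CV n1 by (intro mult_left_mono) auto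
      thus "(\<Sum>k<n. (V (Suc k))\<^sup>2) \<le> CV * (2 * real n)" using CV(2)[of n] by linarith
    qed (use C l1 in \<open>auto intro: sum_nonneg\<close>)
    also have "\<dots> = C * (2 * CV) * (real n * log3 n)" by simp
    finally have t2: "(\<Sum>k<n. r k * V (Suc k))\<^sup>2 \<le> C * (2 * CV) * (real n * log3 n)" .
    have "(\<Sum>k<n. (res n k)\<^sup>2) \<le> (\<Sum>k<n. 2 * (\<epsilon> k)\<^sup>2 + 2 * (r k)\<^sup>2)"
    proof (rule sum_mono)
      fix k show "(res n k)\<^sup>2 \<le> 2 * (\<epsilon> k)\<^sup>2 + 2 * (r k)\<^sup>2" using square_diff_le[of "\<epsilon> k" "r k"] by (simp add: r_def)
    qed
    also have "\<dots> = 2 * (\<Sum>k<n. (\<epsilon> k)\<^sup>2) + 2 * (\<Sum>k<n. (r k)\<^sup>2)" by (simp only: sum.distrib sum_distrib_left)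
    also have "\<dots> \<le> 2 * (CE * (2 * real n)) + 2 * (C * (4 * real n))"
    proof (intro add_mono mult_left_mono)
      have "CE * (real n + 1) \<le> CE * (2 * real n)" using CE n1 by (intro mult_left_mono) auto
      thus "(\<Sum>k<n. (\<epsilon> k)\<^sup>2) \<le> CE * (2 * real n)" using CE(2)[of n] by linarith
      have "C * log3 n \<le> C * (4 * real n)" using C log3_le_4n[OF n1(2)] by (intro mult_left_mono) auto
      thus "(\<Sum>k<n. (r k)\<^sup>2) \<le> C * (4 * real n)" using R0 by linarith
    qed auto
    also have "\<dots> = (4 * CE + 8 * C) * real n" by (simp add: algebra_simps)
    finally have e2: "(\<Sum>k<n. (res n k)\<^sup>2) \<le> (4 * CE + 8 * C) * real n" .
    have "(\<Sum>k<n. (q k)\<^sup>2) \<le> (\<Sum>k<n. 2 * (r (Suc k))\<^sup>2 + 2 * (r k)\<^sup>2)"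
    proof (rule sum_mono)
      fix k
      have "\<rho>\<^sup>2 * (r k)\<^sup>2 \<le> 1 * (r k)\<^sup>2" using \<rho>2 by (intro mult_right_mono) auto
      thus "(q k)\<^sup>2 \<le> 2 * (r (Suc k))\<^sup>2 + 2 * (r k)\<^sup>2"
        using square_diff_le[of "r (Suc k)" "\<rho> * r k"] by (simp add: q_def power_mult_distrib)
    qed
    also have "\<dots> = 2 * (\<Sum>k<n. (r (Suc k))\<^sup>2) + 2 * (\<Sum>k<n. (r k)\<^sup>2)" by (simp only: sum.distrib sum_distrib_left)
    also have "\<dots> \<le> 4 * C * log3 n" using R0 R1 by simp
    finally have q2: "(\<Sum>k<n. (q k)\<^sup>2) \<le> 4 * C * log3 n" .
    have "(\<Sum>k<n. res n k * q k)\<^sup>2 \<le> (\<Sum>k<n. (res n k)\<^sup>2) * (\<Sum>k<n. (q k)\<^sup>2)" by (rule Cauchy_Schwarz_ineq_sum)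
    also have "\<dots> \<le> ((4 * CE + 8 * C) * real n) * (4 * C * log3 n)"
      using CE C by (intro mult_mono e2 q2) (auto intro: sum_nonneg)
    also have "\<dots> = (4 * CE + 8 * C) * (4 * C) * (real n * log3 n)" by (simp only: ac_simps)
    finally have t3: "(\<Sum>k<n. res n k * q k)\<^sup>2 \<le> (4 * CE + 8 * C) * (4 * C) * (real n * log3 n)" .
    have num: "((\<Sum>k<n. res n (Suc k) * res n k) - \<rho> * Jn)\<^sup>2 \<le> K * (real n * log3 n)"
    proof -
      have "((\<Sum>k<n. res n (Suc k) * res n k) - \<rho> * Jn)\<^sup>2
        \<le> 3 * (CM * (real n * log3 n) + C * (2 * CV) * (real n * log3 n) + (4 * CE + 8 * C) * (4 * C) * (real n * log3 n))"
        unfolding dec by (rule order_trans[OF square_diff3_le]) (intro mult_left_mono add_mono t1 t2 t3; simp)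
      also have "\<dots> = K * (real n * log3 n)" by (simp only: K_def distrib_right mult.assoc)
      finally show ?thesis .
    qed
    have "serial_corr res n - \<rho> = ((\<Sum>k<n. res n (Suc k) * res n k) - \<rho> * Jn) / Jn"
      using Jpos(2) by (simp add: serial_corr_def Jn_def diff_divide_distrib)
    hence "(serial_corr res n - \<rho>)\<^sup>2 = ((\<Sum>k<n. res n (Suc k) * res n k) - \<rho> * Jn)\<^sup>2 / Jn\<^sup>2"
      by (simp add: power_divide)
    also have "\<dots> \<le> K * (real n * log3 n) / (c * real n)\<^sup>2"
      using num Jpos c n1 K l1 by (intro frac_le power_mono) auto
    also have "\<dots> = K / c\<^sup>2 * (log3 n / real n)" using n1 by (simp add: power2_eq_square)
    finally show ?thesis .
  qed
  moreover have "K / c\<^sup>2 > 0" using K c by simp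
  ultimately show ?thesis by blast
qed

lemma serial_corr_bigo:
  assumes "good_residuals res"
  shows "(\<lambda>n. (serial_corr res n - \<rho>)\<^sup>2) \<in> O(\<lambda>n. ln (real n) / real n)"
proof -
  obtain C N where "\<And>n. n \<ge> N \<Longrightarrow> (serial_corr res n - \<rho>)\<^sup>2 \<le> C * (log3 n / real n)"
    using serial_corr_error[OF assms] by blast
  thus ?thesis by (intro bigo_log_rateI[of N _ C]) simp
qed

lemma serial_corr_tendsto:
  assumes "good_residuals res"
  shows "serial_corr res \<longlonglongrightarrow> \<rho>"
proof -
  obtain C N where C: "\<And>n. n \<ge> N \<Longrightarrow> (serial_corr res n - \<rho>)\<^sup>2 \<le> C * (log3 n / real n)"
    using serial_corr_error[OF assms] by blast
  have "(\<lambda>n. log3 n / real n) \<longlonglongrightarrow> 0" unfolding log3_def by real_asymp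
  from tendsto_mult_right_zero[OF this, of C]
  have "(\<lambda>n. (serial_corr res n - \<rho>)\<^sup>2) \<longlonglongrightarrow> 0"
    by (rule Lim_null_comparison[rotated]) (use C in \<open>auto intro!: eventually_sequentiallyI[of N]\<close>)
  hence "(\<lambda>n. sqrt ((serial_corr res n - \<rho>)\<^sup>2)) \<longlonglongrightarrow> sqrt 0" by (rule tendsto_real_sqrt)
  hence "(\<lambda>n. serial_corr res n - \<rho>) \<longlonglongrightarrow> 0" by (simp add: tendsto_rabs_zero_iff)
  thus ?thesis by (simp add: LIM_zero_iff)
qed

text \<open>The Durbin-Watson ratio differs from \<open>2 * (1 - serial_corr)\<close> by boundary terms only.\<close>

lemma dw_ratio_approx:
  assumes g: "good_residuals res"
  shows "\<exists>C>0. \<exists>N. \<forall>n\<ge>N. \<bar>dw_ratio res n - 2 * (1 - serial_corr res n)\<bar> \<le> C * (((\<epsilon> n)\<^sup>2 + log3 n) / real n)"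
proof -
  obtain C N where C: "C > 0" and R: "\<And>n. n \<ge> N \<Longrightarrow> (\<Sum>k<Suc n. (\<epsilon> k - res n k)\<^sup>2) \<le> C * log3 n"
    using g unfolding good_residuals_def by blast
  obtain c N1 where c: "c > 0" and J: "\<And>n. n \<ge> N1 \<Longrightarrow> c * real n \<le> (\<Sum>k<n. (res n k)\<^sup>2)"
    using residual_square_sum_lower[OF g] by blast
  obtain N2 where "\<forall>n\<ge>N2. norm (serial_corr res n - \<rho>) < 1"
    using LIMSEQ_D[OF serial_corr_tendsto[OF g], of 1] by auto
  hence N2: "\<bar>serial_corr res n\<bar> \<le> 2" if "n \<ge> N2" for n using that \<rho>(1) by (fastforce simp: abs_if split: if_splits)
  define K where "K = 5 * (2 + 4 * C + 2 * (\<epsilon> 0)\<^sup>2) / c"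
  have K: "K > 0" using C c by (simp add: K_def add_pos_nonneg)
  have "\<bar>dw_ratio res n - 2 * (1 - serial_corr res n)\<bar> \<le> K * (((\<epsilon> n)\<^sup>2 + log3 n) / real n)"
    if n: "n \<ge> max (max N N1) (max N2 1)" for n
  proof -
    have n1: "real n \<ge> 1" using n by auto
    have l1: "log3 n \<ge> 1" by (rule log3_ge_1)
    define Jn where "Jn = (\<Sum>k<n. (res n k)\<^sup>2)"
    define b where "b = serial_corr res n"
    have Jpos: "Jn \<ge> c * real n" "Jn > 0" using J[of n] n c n1 unfolding Jn_def
      by (auto intro: less_le_trans[of 0 "c * real n"])
    have num: "(\<Sum>k<n. res n (Suc k) * res n k) = b * Jn" using Jpos by (simp add: b_def serial_corr_def Jn_def)
    define a where "a = (res n n)\<^sup>2"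
    define a0 where "a0 = (res n 0)\<^sup>2"
    have a: "a \<ge> 0" "a0 \<ge> 0" by (auto simp: a_def a0_def)
    have sh: "(\<Sum>k<n. (res n (Suc k))\<^sup>2) = Jn + a - a0"
    proof -
      have "(\<Sum>k<Suc n. (res n k)\<^sup>2) = a0 + (\<Sum>k<n. (res n (Suc k))\<^sup>2)"
        unfolding a0_def by (rule sum.lessThan_Suc_shift)
      thus ?thesis by (simp add: Jn_def a_def)
    qed
    have "(\<Sum>k<n. (res n (Suc k) - res n k)\<^sup>2) = (\<Sum>k<n. (res n (Suc k))\<^sup>2 + (res n k)\<^sup>2 - 2 * (res n (Suc k) * res n k))"
      by (intro sum.cong) (auto simp: power2_eq_square algebra_simps)
    also have "\<dots> = 2 * (1 - b) * Jn + a - a0"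
      by (simp only: sum_subtractf sum.distrib sum_distrib_left[symmetric] sh num Jn_def[symmetric]) (simp add: algebra_simps)
    finally have top: "(\<Sum>k<n. (res n (Suc k) - res n k)\<^sup>2) = 2 * (1 - b) * Jn + a - a0" .
    have bot: "(\<Sum>k<Suc n. (res n k)\<^sup>2) = Jn + a" by (simp add: Jn_def a_def)
    have I0: "Jn + a > 0" using Jpos a by simp
    \<comment> \<open>Shifting the sum of squares by one index creates the boundary squares
      \<open>a\<close> and \<open>a0\<close>; the denominator also contains
      \<open>a\<close>.\<close>
    have "dw_ratio res n - 2 * (1 - b) = ((2 * b - 1) * a - a0) / (Jn + a)"
      using I0 unfolding dw_ratio_def top bot by (simp add: field_simps)
    hence "\<bar>dw_ratio res n - 2 * (1 - b)\<bar> = \<bar>(2 * b - 1) * a - a0\<bar> / (Jn + a)" using I0 by simp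
    also have "\<dots> \<le> (5 * (a + a0)) / (c * real n)"
    proof (rule frac_le)
      \<comment> \<open>Eventually |b| is at most 2, because b tends to \<rho> and |\<rho>| is below
        1.\<close>
      have "\<bar>2 * b - 1\<bar> \<le> 5" using N2[of n] n unfolding b_def by simp
      hence "\<bar>(2 * b - 1) * a\<bar> \<le> 5 * a" using a by (simp add: abs_mult mult_right_mono)
      moreover have "\<bar>y - a0\<bar> \<le> 5 * (a + a0)" if "\<bar>y\<bar> \<le> 5 * a" for y using that a by (auto simp: abs_le_iff)
      ultimately show "\<bar>(2 * b - 1) * a - a0\<bar> \<le> 5 * (a + a0)" by blast
    qed (use Jpos a c n1 in auto)
    also have "5 * (a + a0) \<le> 5 * ((2 + 4 * C + 2 * (\<epsilon> 0)\<^sup>2) * ((\<epsilon> n)\<^sup>2 + log3 n))"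
    proof -
      have r: "(\<epsilon> k - res n k)\<^sup>2 \<le> C * log3 n" if "k \<le> n" for k
        using R[of n] n that member_le_sum[of k "{..<Suc n}" "\<lambda>k. (\<epsilon> k - res n k)\<^sup>2"] by auto
      have "a \<le> 2 * (\<epsilon> n)\<^sup>2 + 2 * (C * log3 n)"
        using square_diff_le[of "\<epsilon> n" "\<epsilon> n - res n n"] r[of n] by (simp add: a_def)
      moreover have "a0 \<le> 2 * (\<epsilon> 0)\<^sup>2 + 2 * (C * log3 n)"
        using square_diff_le[of "\<epsilon> 0" "\<epsilon> 0 - res n 0"] r[of 0] by (simp add: a0_def)
      moreover have "2 * (\<epsilon> 0)\<^sup>2 \<le> 2 * (\<epsilon> 0)\<^sup>2 * log3 n" using mult_left_mono[OF l1, of "2 * (\<epsilon> 0)\<^sup>2"] by simp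
      moreover have "0 \<le> 4 * C * (\<epsilon> n)\<^sup>2" "0 \<le> 2 * (\<epsilon> 0)\<^sup>2 * (\<epsilon> n)\<^sup>2" "0 \<le> 2 * log3 n" using C l1 by auto
      ultimately have "a + a0 \<le> 2 * (\<epsilon> n)\<^sup>2 + 4 * C * (\<epsilon> n)\<^sup>2 + 2 * (\<epsilon> 0)\<^sup>2 * (\<epsilon> n)\<^sup>2 + 2 * log3 n + 4 * (C * log3 n) + 2 * (\<epsilon> 0)\<^sup>2 * log3 n"
        by linarith
      also have "\<dots> = (2 + 4 * C + 2 * (\<epsilon> 0)\<^sup>2) * ((\<epsilon> n)\<^sup>2 + log3 n)" by (simp add: algebra_simps)
      finally show ?thesis by simp
    qed
    hence "5 * (a + a0) / (c * real n) \<le> 5 * ((2 + 4 * C + 2 * (\<epsilon> 0)\<^sup>2) * ((\<epsilon> n)\<^sup>2 + log3 n)) / (c * real n)"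
      using c n1 by (intro divide_right_mono) auto
    also have "\<dots> = K * (((\<epsilon> n)\<^sup>2 + log3 n) / real n)" by (simp add: K_def)
    finally show ?thesis by (simp add: b_def)
  qed
  thus ?thesis using K by blast
qed

lemma dw_ratio_tendsto:
  assumes g: "good_residuals res"
  shows "dw_ratio res \<longlonglongrightarrow> 2 * (1 - \<rho>)"
proof -
  obtain C N where C: "C > 0" and A: "\<And>n. n \<ge> N \<Longrightarrow>
      \<bar>dw_ratio res n - 2 * (1 - serial_corr res n)\<bar> \<le> C * (((\<epsilon> n)\<^sup>2 + log3 n) / real n)"
    using dw_ratio_approx[OF g] by blast
  obtain CV where CV: "\<And>k. (V (Suc k))\<^sup>2 \<le> CV * (real (Suc k)) powr \<gamma>" using V_growth by blast
  obtain D where D: "\<And>n. (\<epsilon> n)\<^sup>2 \<le> D * (real n + 1) powr \<gamma>" using \<epsilon>_growth[OF _ CV] \<gamma> by auto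
  have "(\<lambda>n. C * ((D * (real n + 1) powr \<gamma> + log3 n) / real n)) \<longlonglongrightarrow> 0"
  proof -
    have "(\<lambda>n. (real n + 1) powr \<gamma> / real n) \<longlonglongrightarrow> 0" using \<gamma> by real_asymp
    moreover have "(\<lambda>n. log3 n / real n) \<longlonglongrightarrow> 0" unfolding log3_def by real_asymp
    ultimately have "(\<lambda>n. C * (D * ((real n + 1) powr \<gamma> / real n) + log3 n / real n)) \<longlonglongrightarrow> C * (D * 0 + 0)"
      by (intro tendsto_intros)
    thus ?thesis by (simp add: add_divide_distrib)
  qed
  moreover have "eventually (\<lambda>n. norm (dw_ratio res n - 2 * (1 - serial_corr res n))
      \<le> C * ((D * (real n + 1) powr \<gamma> + log3 n) / real n)) sequentially"
  proof (rule eventually_sequentiallyI[of N])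
    fix n assume "n \<ge> N"
    hence "\<bar>dw_ratio res n - 2 * (1 - serial_corr res n)\<bar> \<le> C * (((\<epsilon> n)\<^sup>2 + log3 n) / real n)" by (rule A)
    also have "\<dots> \<le> C * ((D * (real n + 1) powr \<gamma> + log3 n) / real n)"
      using C D[of n] by (intro mult_left_mono divide_right_mono) auto
    finally show "norm (dw_ratio res n - 2 * (1 - serial_corr res n)) \<le> C * ((D * (real n + 1) powr \<gamma> + log3 n) / real n)" by simp
  qed
  ultimately have "(\<lambda>n. dw_ratio res n - 2 * (1 - serial_corr res n)) \<longlonglongrightarrow> 0" by (rule Lim_null_comparison[rotated])
  moreover have "(\<lambda>n. 2 * (1 - serial_corr res n)) \<longlonglongrightarrow> 2 * (1 - \<rho>)"
    by (intro tendsto_intros serial_corr_tendsto[OF g])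
  ultimately show ?thesis using tendsto_add by fastforce
qed

text \<open>With the noise growth exponent 1/2, the squared \<epsilon> at time n is O(sqrt n), so
  the squared boundary term is O(1/n), and the serial correlation dictates the rate.\<close>

lemma dw_ratio_bigo:
  assumes g: "good_residuals res" and V: "\<And>k. (V (Suc k))\<^sup>2 \<le> CV * (real (Suc k)) powr (1/2)"
  shows "(\<lambda>n. (dw_ratio res n - 2 * (1 - \<rho>))\<^sup>2) \<in> O(\<lambda>n. ln (real n) / real n)"
proof -
  obtain C N where C: "C > 0" and A: "\<And>n. n \<ge> N \<Longrightarrow>
      \<bar>dw_ratio res n - 2 * (1 - serial_corr res n)\<bar> \<le> C * (((\<epsilon> n)\<^sup>2 + log3 n) / real n)"
    using dw_ratio_approx[OF g] by blast
  obtain K M where K: "K > 0" and B: "\<And>n. n \<ge> M \<Longrightarrow> (serial_corr res n - \<rho>)\<^sup>2 \<le> K * (log3 n / real n)"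
    using serial_corr_error[OF g] by blast
  obtain D where D: "\<And>n. (\<epsilon> n)\<^sup>2 \<le> D * (real n + 1) powr (1/2)" using \<epsilon>_growth[OF _ V] by auto
  have D0: "D \<ge> 0" using order_trans[OF zero_le_power2 D[of 0]] by simp
  have "\<bar>(dw_ratio res n - 2 * (1 - \<rho>))\<^sup>2\<bar> \<le> (2 * (C\<^sup>2 * (4 * D\<^sup>2 + 8)) + 8 * K) * (log3 n / real n)"
    if n: "n \<ge> max (max N M) 1" for n
  proof -
    have n1: "real n \<ge> 1" "n \<ge> 1" using n by auto
    have l1: "log3 n \<ge> 1" by (rule log3_ge_1)
    have d: "dw_ratio res n - 2 * (1 - \<rho>) = (dw_ratio res n - 2 * (1 - serial_corr res n)) - 2 * (serial_corr res n - \<rho>)"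
      by simp
    have "(dw_ratio res n - 2 * (1 - serial_corr res n))\<^sup>2 \<le> (C * (((\<epsilon> n)\<^sup>2 + log3 n) / real n))\<^sup>2"
      using A[of n] n power_mono[of "\<bar>dw_ratio res n - 2 * (1 - serial_corr res n)\<bar>" _ 2] by simp
    also have "\<dots> = C\<^sup>2 * (((\<epsilon> n)\<^sup>2 + log3 n)\<^sup>2 / (real n)\<^sup>2)" by (simp add: power_mult_distrib power_divide)
    also have "((\<epsilon> n)\<^sup>2 + log3 n)\<^sup>2 \<le> (4 * D\<^sup>2 + 8) * (real n * log3 n)"
    proof -
      have "((\<epsilon> n)\<^sup>2)\<^sup>2 \<le> (D * (real n + 1) powr (1/2))\<^sup>2" using D[of n] by (intro power_mono) auto
      also have "\<dots> = D\<^sup>2 * (real n + 1)" by (simp add: power_mult_distrib powr_half_sqrt)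
      also have "\<dots> \<le> D\<^sup>2 * (2 * (real n * log3 n))"
      proof (intro mult_left_mono)
        have "real n * 1 \<le> real n * log3 n" using l1 by (intro mult_left_mono) auto
        thus "real n + 1 \<le> 2 * (real n * log3 n)" using n1 by linarith
      qed simp
      finally have 1: "((\<epsilon> n)\<^sup>2)\<^sup>2 \<le> D\<^sup>2 * (2 * (real n * log3 n))" .
      have "(log3 n)\<^sup>2 \<le> 4 * real n * log3 n"
        unfolding power2_eq_square using log3_le_4n[OF n1(2)] l1 by (intro mult_right_mono) auto
      thus ?thesis using 1 square_add_le[of "(\<epsilon> n)\<^sup>2" "log3 n"] by (simp add: algebra_simps)
    qed
    hence "C\<^sup>2 * (((\<epsilon> n)\<^sup>2 + log3 n)\<^sup>2 / (real n)\<^sup>2) \<le> C\<^sup>2 * ((4 * D\<^sup>2 + 8) * (real n * log3 n) / (real n)\<^sup>2)"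
      by (intro mult_left_mono divide_right_mono) auto
    also have "\<dots> = C\<^sup>2 * (4 * D\<^sup>2 + 8) * (log3 n / real n)" using n1 by (simp add: power2_eq_square)
    finally have 1: "(dw_ratio res n - 2 * (1 - serial_corr res n))\<^sup>2 \<le> C\<^sup>2 * (4 * D\<^sup>2 + 8) * (log3 n / real n)" .
    have "(2 * (serial_corr res n - \<rho>))\<^sup>2 \<le> 4 * (K * (log3 n / real n))"
      unfolding power_mult_distrib using B[of n] n by simp
    hence "(dw_ratio res n - 2 * (1 - \<rho>))\<^sup>2 \<le> 2 * (C\<^sup>2 * (4 * D\<^sup>2 + 8) * (log3 n / real n)) + 2 * (4 * (K * (log3 n / real n)))"
      unfolding d using 1 square_diff_le[of "dw_ratio res n - 2 * (1 - serial_corr res n)" "2 * (serial_corr res n - \<rho>)"] by linarith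
    also have "\<dots> = (2 * (C\<^sup>2 * (4 * D\<^sup>2 + 8)) + 8 * K) * (log3 n / real n)" by (simp add: algebra_simps)
    finally show ?thesis by simp
  qed
  thus ?thesis by (rule bigo_log_rateI)
qed

end

section \<open>Recovering the autoregressive parameters\<close>

definition arx_param :: "nat \<Rightarrow> (nat \<Rightarrow> real) \<Rightarrow> real \<Rightarrow> nat \<Rightarrow> real" where
  "arx_param p \<theta> \<rho> i = (if i < p then \<theta> i else 0) - \<rho> * (case i of 0 \<Rightarrow> -1 | Suc j \<Rightarrow> if j < p then \<theta> j else 1)"

definition theta_of :: "nat \<Rightarrow> (nat \<Rightarrow> real) \<Rightarrow> nat \<Rightarrow> real" where
  "theta_of p t j = (\<Sum>i=0..j. (- t (p + 1)) ^ (j - i) * t i) + (- t (p + 1)) ^ j * t (p + 1)"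

context closed_loop
begin

abbreviation "true_param \<equiv> arx_param p \<theta> \<rho>"

text \<open>The second part of the parameter makes the geometric sum telescope: what remains is
  \<theta> at j plus \<rho>^(j + 1), and the last summand of the formula removes this power.\<close>

lemma theta_of_true: "j < p \<Longrightarrow> theta_of p true_param j = \<theta> j"
proof -
  assume j: "j < p"
  have r: "true_param (p + 1) = - \<rho>" by (simp add: arx_param_def)
  have "j < p \<Longrightarrow> (\<Sum>i=0..j. \<rho> ^ (j - i) * true_param i) = \<theta> j + \<rho> ^ Suc j" for j
  proof (induction j)
    case 0
    thus ?case by (simp add: arx_param_def)
  next
    case (Suc j)
    have "(\<Sum>i=0..Suc j. \<rho> ^ (Suc j - i) * true_param i) = (\<Sum>i=0..j. \<rho> * (\<rho> ^ (j - i) * true_param i)) + true_param (Suc j)"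
      by (simp add: Suc_diff_le mult.assoc)
    also have "\<dots> = \<rho> * (\<theta> j + \<rho> ^ Suc j) + true_param (Suc j)"
      using Suc by (simp flip: sum_distrib_left)
    also have "true_param (Suc j) = \<theta> (Suc j) - \<rho> * \<theta> j" using Suc.prems by (simp add: arx_param_def)
    finally show ?case by (simp add: algebra_simps)
  qed
  from this[OF j] show ?thesis unfolding theta_of_def r by simp
qed

text \<open>A Lipschitz estimate at the origin only, on the unit cube. Sums and products preserve
  it, so it passes to the polynomials of \<open>theta_of\<close> without derivatives.\<close>

definition lip_at_0 :: "((nat \<Rightarrow> real) \<Rightarrow> real) \<Rightarrow> bool" where
  "lip_at_0 g \<longleftrightarrow> (\<exists>K\<ge>0. \<forall>u. (\<forall>i<d. \<bar>u i\<bar> \<le> 1) \<longrightarrow> \<bar>g u - g (\<lambda>_. 0)\<bar> \<le> K * (\<Sum>i<d. \<bar>u i\<bar>))"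

lemma lip_at_0_const: "lip_at_0 (\<lambda>_. c)"
  unfolding lip_at_0_def by (intro exI[of _ 0]) auto

lemma lip_at_0_coord: "i < d \<Longrightarrow> lip_at_0 (\<lambda>u. c + u i)"
  unfolding lip_at_0_def by (intro exI[of _ 1]) (auto intro: member_le_sum)

lemma lip_at_0_add:
  assumes "lip_at_0 g" "lip_at_0 h"
  shows "lip_at_0 (\<lambda>u. g u + h u)"
proof -
  obtain K L where K: "K \<ge> 0" "\<And>u. (\<forall>i<d. \<bar>u i\<bar> \<le> 1) \<Longrightarrow> \<bar>g u - g (\<lambda>_. 0)\<bar> \<le> K * (\<Sum>i<d. \<bar>u i\<bar>)"
    and L: "L \<ge> 0" "\<And>u. (\<forall>i<d. \<bar>u i\<bar> \<le> 1) \<Longrightarrow> \<bar>h u - h (\<lambda>_. 0)\<bar> \<le> L * (\<Sum>i<d. \<bar>u i\<bar>)"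
    using assms unfolding lip_at_0_def by blast
  have "\<bar>g u + h u - (g (\<lambda>_. 0) + h (\<lambda>_. 0))\<bar> \<le> (K + L) * (\<Sum>i<d. \<bar>u i\<bar>)" if "\<forall>i<d. \<bar>u i\<bar> \<le> 1" for u
    using K(2)[OF that] L(2)[OF that] unfolding distrib_right by linarith
  thus ?thesis using K L unfolding lip_at_0_def by (intro exI[of _ "K + L"]) auto
qed

lemma lip_at_0_mult:
  assumes "lip_at_0 g" "lip_at_0 h"
  shows "lip_at_0 (\<lambda>u. g u * h u)"
proof -
  let ?o = "\<lambda>_. 0 :: real"
  obtain K L where K: "K \<ge> 0" "\<And>u. (\<forall>i<d. \<bar>u i\<bar> \<le> 1) \<Longrightarrow> \<bar>g u - g ?o\<bar> \<le> K * (\<Sum>i<d. \<bar>u i\<bar>)"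
    and L: "L \<ge> 0" "\<And>u. (\<forall>i<d. \<bar>u i\<bar> \<le> 1) \<Longrightarrow> \<bar>h u - h ?o\<bar> \<le> L * (\<Sum>i<d. \<bar>u i\<bar>)"
    using assms unfolding lip_at_0_def by blast
  define H where "H = \<bar>h ?o\<bar> + L * real d"
  have H: "H \<ge> 0" using L by (simp add: H_def)
  have "\<bar>g u * h u - g ?o * h ?o\<bar> \<le> (K * H + \<bar>g ?o\<bar> * L) * (\<Sum>i<d. \<bar>u i\<bar>)" if u: "\<forall>i<d. \<bar>u i\<bar> \<le> 1" for u
  proof -
    have s: "(\<Sum>i<d. \<bar>u i\<bar>) \<le> real d" using sum_mono[of "{..<d}" "\<lambda>i. \<bar>u i\<bar>" "\<lambda>_. 1"] u by simp
    have s0: "(\<Sum>i<d. \<bar>u i\<bar>) \<ge> 0" by (simp add: sum_nonneg)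
    have "L * (\<Sum>i<d. \<bar>u i\<bar>) \<le> L * real d" using L s by (intro mult_left_mono)
    hence hu: "\<bar>h u\<bar> \<le> H" using L(2)[OF u] unfolding H_def by linarith
    have "g u * h u - g ?o * h ?o = (g u - g ?o) * h u + g ?o * (h u - h ?o)" by (simp add: algebra_simps)
    also have "\<bar>\<dots>\<bar> \<le> \<bar>g u - g ?o\<bar> * \<bar>h u\<bar> + \<bar>g ?o\<bar> * \<bar>h u - h ?o\<bar>"
      by (rule order_trans[OF abs_triangle_ineq]) (simp add: abs_mult)
    also have "\<dots> \<le> (K * (\<Sum>i<d. \<bar>u i\<bar>)) * H + \<bar>g ?o\<bar> * (L * (\<Sum>i<d. \<bar>u i\<bar>))"
      using K L hu s0 u by (intro add_mono mult_mono mult_left_mono) auto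
    finally show ?thesis by (simp add: algebra_simps)
  qed
  moreover have "K * H + \<bar>g ?o\<bar> * L \<ge> 0" using K L H by simp
  ultimately show ?thesis unfolding lip_at_0_def by blast
qed

lemma lip_at_0_power: "lip_at_0 g \<Longrightarrow> lip_at_0 (\<lambda>u. g u ^ k)"
  by (induction k) (auto intro: lip_at_0_const lip_at_0_mult)

lemma lip_at_0_sum: "(\<And>i. i \<in> A \<Longrightarrow> lip_at_0 (g i)) \<Longrightarrow> lip_at_0 (\<lambda>u. \<Sum>i\<in>A. g i u)"
  by (induction A rule: infinite_finite_induct) (auto intro: lip_at_0_const lip_at_0_add)

lemma theta_of_lipschitz:
  "\<exists>K\<ge>0. \<forall>u. (\<forall>i<d. \<bar>u i\<bar> \<le> 1) \<longrightarrow> (\<forall>j<p. \<bar>theta_of p (\<lambda>i. true_param i + u i) j - \<theta> j\<bar> \<le> K * (\<Sum>i<d. \<bar>u i\<bar>))"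
proof -
  have lip: "lip_at_0 (\<lambda>u. theta_of p (\<lambda>i. true_param i + u i) j)" if "j < p" for j
  proof -
    have c: "lip_at_0 (\<lambda>u. true_param i + u i)" if "i \<le> p + 1" for i
      using that d by (intro lip_at_0_coord) simp
    have "lip_at_0 (\<lambda>u. -1 * (true_param (p+1) + u (p+1)))" by (intro lip_at_0_mult lip_at_0_const c) simp
    hence m: "lip_at_0 (\<lambda>u. - (true_param (p+1) + u (p+1)))" by simp
    show ?thesis unfolding theta_of_def
      using that by (intro lip_at_0_add lip_at_0_sum lip_at_0_mult lip_at_0_power m c) auto
  qed
  have "\<exists>K\<ge>0. j < p \<longrightarrow> (\<forall>u. (\<forall>i<d. \<bar>u i\<bar> \<le> 1) \<longrightarrow>
      \<bar>theta_of p (\<lambda>i. true_param i + u i) j - \<theta> j\<bar> \<le> K * (\<Sum>i<d. \<bar>u i\<bar>))" for j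
  proof (cases "j < p")
    case True
    show ?thesis using lip[OF True] True unfolding lip_at_0_def by (simp add: theta_of_true)
  qed (use order_refl in blast)
  then obtain K where K: "\<And>j. K j \<ge> 0" "\<And>j u. j < p \<Longrightarrow> (\<forall>i<d. \<bar>u i\<bar> \<le> 1) \<Longrightarrow>
      \<bar>theta_of p (\<lambda>i. true_param i + u i) j - \<theta> j\<bar> \<le> K j * (\<Sum>i<d. \<bar>u i\<bar>)" by metis
  have "\<bar>theta_of p (\<lambda>i. true_param i + u i) j - \<theta> j\<bar> \<le> (\<Sum>j<p. K j) * (\<Sum>i<d. \<bar>u i\<bar>)"
    if "\<forall>i<d. \<bar>u i\<bar> \<le> 1" "j < p" for u j
  proof -
    have "K j \<le> (\<Sum>j<p. K j)" using that K by (intro member_le_sum) auto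
    hence "K j * (\<Sum>i<d. \<bar>u i\<bar>) \<le> (\<Sum>j<p. K j) * (\<Sum>i<d. \<bar>u i\<bar>)" by (intro mult_right_mono) (auto intro: sum_nonneg)
    thus ?thesis using K(2)[OF that(2,1)] by linarith
  qed
  moreover have "(\<Sum>j<p. K j) \<ge> 0" using K by (intro sum_nonneg) auto
  ultimately show ?thesis by blast
qed

text \<open>The residual after inserting the model equation: \<epsilon> minus the error of the
  estimated \<theta> applied to the preceding outputs.\<close>

definition path_residual :: "nat \<Rightarrow> nat \<Rightarrow> real" where
  "path_residual n k = (if k = 0 then X 0 else
     \<epsilon> k - (\<Sum>i<p. (theta_of p (\<lambda>i. true_param i + e n i) i - \<theta> i) * X (int (k - 1) - int i)))"

text \<open>The squared parameter error is O(ln n / n) and the energy is O(n), so the square sum of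
  the perturbation is O(ln n).\<close>

lemma path_residual_good: "good_residuals path_residual"
proof -
  obtain K where K: "K \<ge> 0" "\<And>u j. (\<forall>i<d. \<bar>u i\<bar> \<le> 1) \<Longrightarrow> j < p \<Longrightarrow>
     \<bar>theta_of p (\<lambda>i. true_param i + u i) j - \<theta> j\<bar> \<le> K * (\<Sum>i<d. \<bar>u i\<bar>)"
    using theta_of_lipschitz by blast
  obtain C N where C: "C > 0" and er: "\<And>n. n \<ge> N \<Longrightarrow> dot (e n) (e n) \<le> C * log3 n / real n"
    using estimation_error_rate by blast
  obtain CE where CE: "CE > 0" "\<And>n. energy n \<le> CE * (real n + 1)" using energy_linear by blast
  \<comment> \<open>Consistency eventually brings the error into the unit cube, where the Lipschitz
    estimate holds.\<close>
  have "(\<lambda>n. C * log3 n / real n) \<longlonglongrightarrow> 0" unfolding log3_def by real_asymp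
  from LIMSEQ_D[OF this, of 1] have "\<exists>N1. \<forall>n\<ge>N1. norm (C * log3 n / real n - 0) < 1" by simp
  then obtain N1 where N1: "\<forall>n\<ge>N1. norm (C * log3 n / real n - 0) < 1" by blast
  define A where "A = real p * (K\<^sup>2 * real d) * (C * (2 * CE))"
  have A: "A \<ge> 0" using C CE by (simp add: A_def)
  define D where "D = (\<epsilon> 0 - X 0)\<^sup>2 + A + 1"
  have D: "D > 0" using A by (simp add: D_def add_nonneg_pos)
  have "(\<Sum>k<Suc n. (\<epsilon> k - path_residual n k)\<^sup>2) \<le> D * log3 n" if n: "n \<ge> max (max N N1) 1" for n
  proof -
    have n1: "real n \<ge> 1" using n by simp
    have l1: "log3 n \<ge> 1" by (rule log3_ge_1)
    have ee: "dot (e n) (e n) \<le> C * log3 n / real n" using er n by simp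
    have "C * log3 n / real n < 1" using N1 n by (auto simp: abs_less_iff)
    hence e1: "dot (e n) (e n) \<le> 1" using ee by linarith
    define \<delta> where "\<delta> i = theta_of p (\<lambda>i. true_param i + e n i) i - \<theta> i" for i
    have d2: "(\<delta> i)\<^sup>2 \<le> K\<^sup>2 * real d * dot (e n) (e n)" if "i < p" for i
    proof -
      have "\<bar>e n i\<bar> \<le> 1" if "i < d" for i
      proof -
        have "(e n i)\<^sup>2 \<le> dot (e n) (e n)"
          using that member_le_sum[of i "{..<d}" "\<lambda>i. (e n i)\<^sup>2"] by (simp add: dot_def power2_eq_square)
        thus ?thesis using e1 abs_square_le_1[of "e n i"] by simp
      qed
      hence "\<bar>\<delta> i\<bar> \<le> K * (\<Sum>i<d. \<bar>e n i\<bar>)" unfolding \<delta>_def using K(2)[of "e n" i] that by blast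
      hence "(\<delta> i)\<^sup>2 \<le> (K * (\<Sum>i<d. \<bar>e n i\<bar>))\<^sup>2" using power_mono[of "\<bar>\<delta> i\<bar>" _ 2] by simp
      also have "\<dots> = K\<^sup>2 * (\<Sum>i<d. 1 * \<bar>e n i\<bar>)\<^sup>2" by (simp add: power_mult_distrib)
      also have "\<dots> \<le> K\<^sup>2 * ((\<Sum>i<d. 1\<^sup>2) * (\<Sum>i<d. \<bar>e n i\<bar>\<^sup>2))"
        by (intro mult_left_mono Cauchy_Schwarz_ineq_sum) simp
      also have "\<dots> = K\<^sup>2 * real d * dot (e n) (e n)" by (simp add: dot_def power2_eq_square)
      finally show ?thesis .
    qed
    have tail: "(\<epsilon> (Suc k) - path_residual n (Suc k))\<^sup>2 \<le> real p * (K\<^sup>2 * real d) * dot (e n) (e n) * dot (\<Phi> k) (\<Phi> k)" for k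
    proof -
      have "(\<epsilon> (Suc k) - path_residual n (Suc k))\<^sup>2 = (\<Sum>i<p. \<delta> i * X (int k - int i))\<^sup>2"
        by (simp add: path_residual_def \<delta>_def)
      also have "\<dots> \<le> (\<Sum>i<p. (\<delta> i)\<^sup>2) * (\<Sum>i<p. (X (int k - int i))\<^sup>2)" by (rule Cauchy_Schwarz_ineq_sum)
      also have "\<dots> \<le> (\<Sum>i<p. K\<^sup>2 * real d * dot (e n) (e n)) * dot (\<Phi> k) (\<Phi> k)"
      proof (intro mult_mono sum_mono d2)
        have "(\<Sum>i<p. (X (int k - int i))\<^sup>2) = (\<Sum>i<p. \<Phi> k i * \<Phi> k i)"
          by (intro sum.cong) (auto simp: \<Phi>_def power2_eq_square)
        also have "\<dots> \<le> dot (\<Phi> k) (\<Phi> k)" unfolding dot_def using d by (intro sum_mono2) auto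
        finally show "(\<Sum>i<p. (X (int k - int i))\<^sup>2) \<le> dot (\<Phi> k) (\<Phi> k)" .
      qed (auto intro!: sum_nonneg mult_nonneg_nonneg dot_self_nonneg)
      finally show ?thesis by (simp add: mult.assoc)
    qed
    have "(\<Sum>k<Suc n. (\<epsilon> k - path_residual n k)\<^sup>2)
      = (\<epsilon> 0 - X 0)\<^sup>2 + (\<Sum>k<n. (\<epsilon> (Suc k) - path_residual n (Suc k))\<^sup>2)"
      by (subst sum.lessThan_Suc_shift) (simp add: path_residual_def)
    also have "\<dots> \<le> (\<epsilon> 0 - X 0)\<^sup>2 + (\<Sum>k<n. real p * (K\<^sup>2 * real d) * dot (e n) (e n) * dot (\<Phi> k) (\<Phi> k))"
      by (intro add_left_mono sum_mono tail)
    also have "(\<Sum>k<n. real p * (K\<^sup>2 * real d) * dot (e n) (e n) * dot (\<Phi> k) (\<Phi> k))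
        = real p * (K\<^sup>2 * real d) * (dot (e n) (e n) * (energy n - 1))"
      by (simp add: energy_def sum_distrib_left mult.assoc)
    also have "\<dots> \<le> real p * (K\<^sup>2 * real d) * ((C * log3 n / real n) * (CE * (2 * real n)))"
    proof (intro mult_left_mono mult_mono ee)
      have "CE * (real n + 1) \<le> CE * (2 * real n)" using CE n1 by (intro mult_left_mono) auto
      thus "energy n - 1 \<le> CE * (2 * real n)" using CE(2)[of n] by linarith
    qed (use C l1 n1 energy_ge_1[of n] in auto)
    also have "\<dots> = A * log3 n" using n1 by (simp add: A_def)
    also have "(\<epsilon> 0 - X 0)\<^sup>2 + A * log3 n \<le> (\<epsilon> 0 - X 0)\<^sup>2 * log3 n + A * log3 n + 1 * log3 n"
      using mult_left_mono[OF l1, of "(\<epsilon> 0 - X 0)\<^sup>2"] l1 by simp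
    also have "\<dots> = D * log3 n" by (simp only: D_def distrib_right)
    finally show ?thesis by simp
  qed
  thus ?thesis using D unfolding good_residuals_def by blast
qed

end

section \<open>From matrices to coordinate functions\<close>

definition regressor_fun :: "nat \<Rightarrow> (int \<Rightarrow> 'a \<Rightarrow> real) \<Rightarrow> (int \<Rightarrow> 'a \<Rightarrow> real) \<Rightarrow> 'a \<Rightarrow> nat \<Rightarrow> nat \<Rightarrow> real" where
  "regressor_fun p X U \<omega> k i = (if i \<le> p then X (int k - int i) \<omega> else U (int k - 1) \<omega>)"

lemma ext_regressor_carrier: "ext_regressor p X U k \<omega> \<in> carrier_vec (p + 2)"
  by (simp add: ext_regressor_def)

lemma ext_regressor_index: "i < p + 2 \<Longrightarrow> ext_regressor p X U k \<omega> $ i = regressor_fun p X U \<omega> k i"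
  by (simp add: ext_regressor_def regressor_fun_def)

text \<open>The matrix of the problem contains the regressor at time n, hence the successor on the
  right.\<close>

lemma gram_matrix_eq:
  assumes d: "d = p + 2"
  shows "gram_matrix p X U n \<omega> = regression.gram_mat d (regressor_fun p X U \<omega>) (Suc n)"
  unfolding gram_matrix_def regression.gram_mat_def d[symmetric]
  by (intro eq_matI) (auto simp: regression.gram_def ext_regressor_index[of _ p, folded d] atLeast0AtMost lessThan_Suc_atMost)

text \<open>Brings the gain, given by a matrix inverse, into the form that the abstract error
  recursion expects.\<close>

lemma ls_gain_eq:
  assumes d: "d = p + 2"
  shows "ls_gain p X U n \<omega> \<in> carrier_vec d"
    "i < d \<Longrightarrow> ls_gain p X U n \<omega> $ i = regression.gdir d (regressor_fun p X U \<omega>) n i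
        / (1 + regression.leverage d (regressor_fun p X U \<omega>) n)"
proof -
  let ?\<Phi> = "regressor_fun p X U \<omega>"
  have g: "ls_gain p X U n \<omega> = mat d d (\<lambda>(i, j). regression.inv_gram d ?\<Phi> (Suc n) i j) *\<^sub>v ext_regressor p X U n \<omega>"
    unfolding ls_gain_def gram_matrix_eq[OF d] by (simp only: regression.the_inverse_gram_mat)
  show "ls_gain p X U n \<omega> \<in> carrier_vec d" unfolding g
    by (intro mult_mat_vec_carrier[of _ d d] ext_regressor_carrier[of p X U n \<omega>, folded d]) simp
  assume i: "i < d"
  have "ls_gain p X U n \<omega> $ i = (\<Sum>j<d. regression.inv_gram d ?\<Phi> (Suc n) i j * ?\<Phi> n j)"
    unfolding g using i ext_regressor_carrier[of p X U n \<omega>, folded d]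
    by (simp add: scalar_prod_def atLeast0LessThan ext_regressor_index[of _ p, folded d] del: regression.inv_gram.simps)
  thus "ls_gain p X U n \<omega> $ i = regression.gdir d ?\<Phi> n i / (1 + regression.leverage d ?\<Phi> n)"
    by (simp only: regression.inv_gram_Suc_apply)
qed

lemma scalar_prod_ext_regressor:
  assumes d: "d = p + 2"
  shows "t \<bullet> ext_regressor p X U n \<omega> = regression.dot d (regressor_fun p X U \<omega> n) (\<lambda>i. t $ i)"
  unfolding regression.dot_def scalar_prod_def using ext_regressor_carrier[of p X U n \<omega>, folded d]
  by (simp add: atLeast0LessThan ext_regressor_index[of _ p, folded d] mult.commute)

subsection \<open>The controlled process\<close>

locale arx_tracking = mart_diff_noise M F V \<sigma>
  for M :: "'a measure" and F V \<sigma> +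
  fixes p :: nat and \<theta> :: "real vec" and \<rho> :: real and X U :: "int \<Rightarrow> 'a \<Rightarrow> real"
    and \<epsilon> x :: "nat \<Rightarrow> 'a \<Rightarrow> real" and T :: "nat \<Rightarrow> 'a \<Rightarrow> real vec"
  assumes \<rho>: "\<bar>\<rho>\<bar> < 1" "\<rho> \<noteq> 0"
    and X0: "\<And>k. k \<le> 0 \<Longrightarrow> X k \<in> borel_measurable (F 0)"
    and \<epsilon>0: "\<epsilon> 0 \<in> borel_measurable (F 0)"
    and U0: "U 0 \<in> borel_measurable (F 0)" "U (-1) \<in> borel_measurable (F 0)"
    and T0: "\<And>\<omega>. \<omega> \<in> space M \<Longrightarrow> T 0 \<omega> \<in> carrier_vec (p + 2)"
      "\<And>i. i < p + 2 \<Longrightarrow> (\<lambda>\<omega>. T 0 \<omega> $ i) \<in> borel_measurable (F 0)"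
    and model: "\<And>n \<omega>. \<omega> \<in> space M \<Longrightarrow> X (int n + 1) \<omega> =
      (\<Sum>k=1..p. \<theta> $ (k - 1) * X (int n - int k + 1) \<omega>) + U (int n) \<omega> + \<epsilon> (Suc n) \<omega>"
    and noise: "\<And>n \<omega>. \<omega> \<in> space M \<Longrightarrow> \<epsilon> (Suc n) \<omega> = \<rho> * \<epsilon> n \<omega> + V (Suc n) \<omega>"
    and estim: "\<And>n \<omega>. \<omega> \<in> space M \<Longrightarrow> T (Suc n) \<omega> = T n \<omega> +
      (X (int n + 1) \<omega> - U (int n) \<omega> - T n \<omega> \<bullet> ext_regressor p X U n \<omega>) \<cdot>\<^sub>v ls_gain p X U n \<omega>"
    and ref_meas: "\<And>n. x (Suc n) \<in> borel_measurable (F n)"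
    and ref_small: "AE \<omega> in M. (\<lambda>n. \<Sum>k=1..n. (x k \<omega>)\<^sup>2) \<in> o(\<lambda>n. real n)"
    and control: "\<And>n \<omega>. n \<ge> 1 \<Longrightarrow> \<omega> \<in> space M \<Longrightarrow>
      U (int n) \<omega> = x (Suc n) \<omega> - T n \<omega> \<bullet> ext_regressor p X U n \<omega>"
    and mom2: "finite_cond_moment_gt M F V 2"
begin

definition d :: nat where "d = p + 2"

abbreviation \<Phi> :: "'a \<Rightarrow> nat \<Rightarrow> nat \<Rightarrow> real" where "\<Phi> \<equiv> regressor_fun p X U"

abbreviation "par \<equiv> arx_param p (\<lambda>i. \<theta> $ i) \<rho>"

definition err :: "'a \<Rightarrow> nat \<Rightarrow> nat \<Rightarrow> real" where
  "err \<omega> n i = T n \<omega> $ i - par i"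

text \<open>Defined by the regression equation itself, so that the error recursion holds from time 0
  on, whatever the initial values are.\<close>

definition inno :: "'a \<Rightarrow> nat \<Rightarrow> real" where
  "inno \<omega> n = X (int n + 1) \<omega> - U (int n) \<omega> - regression.dot d (\<Phi> \<omega> n) par"

abbreviation "lev \<omega> \<equiv> regression.leverage d (\<Phi> \<omega>)"
abbreviation "gd \<omega> \<equiv> regression.gdir d (\<Phi> \<omega>)"

lemma T_carrier: "\<omega> \<in> space M \<Longrightarrow> T n \<omega> \<in> carrier_vec d"
  using T0(1)[folded d_def] by (induction n) (auto simp: estim ls_gain_eq(1)[OF d_def])

lemma T_Suc_index:
  assumes "\<omega> \<in> space M" "i < d"
  shows "T (Suc n) \<omega> $ i = T n \<omega> $ i + (X (int n + 1) \<omega> - U (int n) \<omega> - regression.dot d (\<Phi> \<omega> n) (\<lambda>i. T n \<omega> $ i))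
    * (gd \<omega> n i / (1 + lev \<omega> n))"
  using assms T_carrier[OF assms(1), of n] ls_gain_eq[OF d_def, where X=X and U=U and n=n and \<omega>=\<omega>]
  by (simp add: estim scalar_prod_ext_regressor[OF d_def])

lemma control': "n \<ge> 1 \<Longrightarrow> \<omega> \<in> space M \<Longrightarrow>
    U (int n) \<omega> = x (Suc n) \<omega> - regression.dot d (\<Phi> \<omega> n) (\<lambda>i. T n \<omega> $ i)"
  by (simp add: control scalar_prod_ext_regressor[OF d_def])

lemma least_squares_path:
  assumes "\<omega> \<in> space M"
  shows "least_squares d (\<Phi> \<omega>) (err \<omega>) (inno \<omega>)"
proof
  fix n i assume "i < d"
  have "regression.dot d (\<Phi> \<omega> n) (err \<omega> n) = regression.dot d (\<Phi> \<omega> n) (\<lambda>i. T n \<omega> $ i) - regression.dot d (\<Phi> \<omega> n) par"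
    by (simp add: regression.dot_def err_def right_diff_distrib sum_subtractf)
  thus "err \<omega> (Suc n) i = err \<omega> n i + (inno \<omega> n - regression.dot d (\<Phi> \<omega> n) (err \<omega> n)) * (gd \<omega> n i / (1 + lev \<omega> n))"
    using T_Suc_index[OF assms \<open>i < d\<close>, of n] by (simp add: err_def inno_def)
qed

lemma model':
  assumes "\<omega> \<in> space M"
  shows "X (int n + 1) \<omega> = (\<Sum>i<p. \<theta> $ i * X (int n - int i) \<omega>) + U (int n) \<omega> + \<epsilon> (Suc n) \<omega>"
proof -
  have "(\<Sum>k=1..p. \<theta> $ (k - 1) * X (int n - int k + 1) \<omega>) = (\<Sum>i<p. \<theta> $ i * X (int n - int i) \<omega>)"
    unfolding sum_from_1 by (intro sum.cong) (auto simp: algebra_simps)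
  thus ?thesis using model[OF assms, of n] by simp
qed

text \<open>The part of the regression that carries \<rho> is \<rho> times X(n) minus U(n - 1) minus
  the autoregression at time n - 1. By the model equation this is \<rho> times \<epsilon> at time n;
  the model at time n - 1 is what requires n to be at least 1.\<close>

lemma inno_eq:
  assumes w: "\<omega> \<in> space M" and n: "n \<ge> 1"
  shows "inno \<omega> n = V (Suc n) \<omega>"
proof -
  obtain m where m: "n = Suc m" using n by (cases n) auto
  have "regression.dot d (\<Phi> \<omega> n) par = (\<Sum>i<Suc (Suc p). \<Phi> \<omega> n i * par i)"
    by (simp only: regression.dot_def d_def add_2_eq_Suc')
  also have "\<dots> = (\<Sum>i<Suc p. X (int n - int i) \<omega> * par i) - \<rho> * U (int n - 1) \<omega>"
    by (simp add: regressor_fun_def arx_param_def)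
  also have "(\<Sum>i<Suc p. X (int n - int i) \<omega> * par i) = (\<Sum>i<Suc p. if i < p then \<theta> $ i * X (int n - int i) \<omega> else 0)
      - \<rho> * (\<Sum>i<Suc p. (case i of 0 \<Rightarrow> -1 | Suc j \<Rightarrow> if j < p then \<theta> $ j else 1) * X (int n - int i) \<omega>)"
    unfolding sum_distrib_left sum_subtractf[symmetric]
    by (intro sum.cong) (auto simp: arx_param_def algebra_simps split: nat.split)
  also have "(\<Sum>i<Suc p. if i < p then \<theta> $ i * X (int n - int i) \<omega> else 0) = (\<Sum>i<p. \<theta> $ i * X (int n - int i) \<omega>)"
    by simp
  also have "(\<Sum>i<Suc p. (case i of 0 \<Rightarrow> -1 | Suc j \<Rightarrow> if j < p then \<theta> $ j else 1) * X (int n - int i) \<omega>)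
      = - X (int n) \<omega> + (\<Sum>i<p. \<theta> $ i * X (int m - int i) \<omega>)"
    unfolding sum.lessThan_Suc_shift by (simp add: m)
  finally have "regression.dot d (\<Phi> \<omega> n) par = (\<Sum>i<p. \<theta> $ i * X (int n - int i) \<omega>) + \<rho> * \<epsilon> n \<omega>"
    using model'[OF w, of m] by (simp add: m algebra_simps)
  thus ?thesis using model'[OF w, of n] noise[OF w, of n] by (simp add: inno_def)
qed

lemma borel_measurable_F_cong:
  "(\<And>\<omega>. \<omega> \<in> space M \<Longrightarrow> f \<omega> = g \<omega>) \<Longrightarrow> g \<in> borel_measurable (F n) \<Longrightarrow> f \<in> borel_measurable (F n)"
  by (subst measurable_cong[of "F n" f g]) (auto simp: space_F_eq)

text \<open>A simultaneous induction: output, estimate and control feed one another. Measurability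
  of the matrix inverse comes from its Sherman-Morrison recursion.\<close>

lemma adapted:
  "(\<forall>k\<le>int n. X k \<in> borel_measurable (F n)) \<and> (\<forall>k. -1 \<le> k \<longrightarrow> k \<le> int n \<longrightarrow> U k \<in> borel_measurable (F n))
   \<and> \<epsilon> n \<in> borel_measurable (F n) \<and> (\<forall>i<d. (\<lambda>\<omega>. T n \<omega> $ i) \<in> borel_measurable (F n))
   \<and> (\<forall>i j. (\<lambda>\<omega>. regression.inv_gram d (\<Phi> \<omega>) n i j) \<in> borel_measurable (F n))"
proof (induction n)
  case 0
  have "k = 0 \<or> k = -1" if "-1 \<le> k" "k \<le> 0" for k :: int using that by auto
  thus ?case using X0 U0 \<epsilon>0 T0(2) by (auto simp: d_def regression.inv_gram.simps(1))
next
  case (Suc n)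
  hence X: "\<And>k. k \<le> int n \<Longrightarrow> X k \<in> borel_measurable (F n)"
    and U: "\<And>k. -1 \<le> k \<Longrightarrow> k \<le> int n \<Longrightarrow> U k \<in> borel_measurable (F n)"
    and e: "\<epsilon> n \<in> borel_measurable (F n)" and T: "\<And>i. i < d \<Longrightarrow> (\<lambda>\<omega>. T n \<omega> $ i) \<in> borel_measurable (F n)"
    and P: "\<And>i j. (\<lambda>\<omega>. regression.inv_gram d (\<Phi> \<omega>) n i j) \<in> borel_measurable (F n)" by auto
  note up = measurable_F_mono[OF le_SucI[OF order_refl]]
  have Ph: "(\<lambda>\<omega>. \<Phi> \<omega> n i) \<in> borel_measurable (F n)" for i
    using X[of "int n - int i"] U[of "int n - 1"] by (cases "i \<le> p") (simp_all add: regressor_fun_def)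
  have g: "(\<lambda>\<omega>. gd \<omega> n i) \<in> borel_measurable (F n)" for i
    unfolding regression.gdir_def by (intro borel_measurable_sum borel_measurable_times P Ph)
  have l: "(\<lambda>\<omega>. lev \<omega> n) \<in> borel_measurable (F n)"
    unfolding regression.leverage_def regression.dot_def by (intro borel_measurable_sum borel_measurable_times g Ph)
  have e': "\<epsilon> (Suc n) \<in> borel_measurable (F (Suc n))"
    by (rule borel_measurable_F_cong[OF noise])
      (auto intro!: borel_measurable_add borel_measurable_times V_measurable up[OF e])
  have X': "X (int n + 1) \<in> borel_measurable (F (Suc n))"
    by (rule borel_measurable_F_cong[OF model'])
      (auto intro!: borel_measurable_add borel_measurable_sum borel_measurable_times e' up[OF X] up[OF U])
  have Xa: "X k \<in> borel_measurable (F (Suc n))" if "k \<le> int (Suc n)" for k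
  proof (cases "k \<le> int n")
    case False
    hence "k = int n + 1" using that by simp
    thus ?thesis using X' by simp
  qed (rule up[OF X])
  have P': "(\<lambda>\<omega>. regression.inv_gram d (\<Phi> \<omega>) (Suc n) i j) \<in> borel_measurable (F (Suc n))" for i j
    unfolding regression.inv_gram_Suc
    by (rule up) (intro borel_measurable_diff borel_measurable_divide borel_measurable_times borel_measurable_add
        borel_measurable_const P g l)
  have T': "(\<lambda>\<omega>. T (Suc n) \<omega> $ i) \<in> borel_measurable (F (Suc n))" if i: "i < d" for i
  proof (rule borel_measurable_F_cong[OF T_Suc_index[OF _ i]])
    show "(\<lambda>\<omega>. T n \<omega> $ i + (X (int n + 1) \<omega> - U (int n) \<omega> - regression.dot d (\<Phi> \<omega> n) (\<lambda>i. T n \<omega> $ i))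
        * (gd \<omega> n i / (1 + lev \<omega> n))) \<in> borel_measurable (F (Suc n))"
      unfolding regression.dot_def
      by (intro borel_measurable_add borel_measurable_times borel_measurable_diff borel_measurable_divide
          borel_measurable_const borel_measurable_sum X' up[OF U] up[OF Ph] up[OF T] up[OF g] up[OF l])
        (use i in auto)
  qed
  have Ph': "(\<lambda>\<omega>. \<Phi> \<omega> (Suc n) i) \<in> borel_measurable (F (Suc n))" for i
    using Xa[of "int (Suc n) - int i"] up[OF U[of "int n"]] by (cases "i \<le> p") (simp_all add: regressor_fun_def)
  \<comment> \<open>The reference for the next output is known now, and the new estimate and
    regressor have just been shown to be.\<close>
  have U': "U (int (Suc n)) \<in> borel_measurable (F (Suc n))"
  proof (rule borel_measurable_F_cong[OF control'])
    show "(\<lambda>\<omega>. x (Suc (Suc n)) \<omega> - regression.dot d (\<Phi> \<omega> (Suc n)) (\<lambda>i. T (Suc n) \<omega> $ i)) \<in> borel_measurable (F (Suc n))"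
      unfolding regression.dot_def
      by (intro borel_measurable_diff borel_measurable_sum borel_measurable_times ref_meas Ph' T') auto
  qed simp_all
  have Ua: "U k \<in> borel_measurable (F (Suc n))" if "-1 \<le> k" "k \<le> int (Suc n)" for k
  proof (cases "k \<le> int n")
    case False
    hence "k = int (Suc n)" using that by simp
    thus ?thesis using U' by simp
  next
    case True
    thus ?thesis by (intro up[OF U] that(1))
  qed
  show ?case using Xa Ua e' T' P' by blast
qed

lemma regressor_measurable: "(\<lambda>\<omega>. \<Phi> \<omega> n i) \<in> borel_measurable (F n)"
  using adapted[of n] by (cases "i \<le> p") (simp_all add: regressor_fun_def)

lemma lev_measurable: "(\<lambda>\<omega>. lev \<omega> n) \<in> borel_measurable (F n)"
  unfolding regression.leverage_def regression.dot_def regression.gdir_def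
  using adapted[of n] by (intro borel_measurable_sum borel_measurable_times regressor_measurable) auto

lemma pred_measurable: "(\<lambda>\<omega>. - regression.dot d (\<Phi> \<omega> n) (err \<omega> n) / (1 + lev \<omega> n)) \<in> borel_measurable (F n)"
  unfolding regression.dot_def err_def using adapted[of n]
  by (intro borel_measurable_divide borel_measurable_uminus borel_measurable_sum borel_measurable_times
      borel_measurable_diff borel_measurable_add borel_measurable_const regressor_measurable lev_measurable) auto

abbreviation "path_loop \<gamma> \<omega> \<equiv> closed_loop d (\<Phi> \<omega>) (err \<omega>) (inno \<omega>) p (\<lambda>i. \<theta> $ i) \<rho> \<sigma> \<gamma>
  (\<lambda>k. X k \<omega>) (\<lambda>k. U k \<omega>) (\<lambda>n. \<epsilon> n \<omega>) (\<lambda>n. V n \<omega>) (\<lambda>n. x n \<omega>)"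

text \<open>All the probability is spent here: each noise condition is a martingale limit theorem
  with predictable weights, and the families over j are countable. The exponent \<gamma> is 2/b with
  b above 2, the same for all paths.\<close>

lemma AE_closed_loop: "\<exists>\<gamma>. AE \<omega> in M. path_loop \<gamma> \<omega>"
proof -
  obtain b where b: "b > 2" and gr: "AE \<omega> in M. \<exists>C. \<forall>k. (V (Suc k) \<omega>)\<^sup>2 \<le> C * (real (Suc k)) powr (2 / b)"
    using noise_growth[OF mom2] by auto
  have f01: "0 \<le> lev \<omega> k / (1 + lev \<omega> k) \<and> lev \<omega> k / (1 + lev \<omega> k) \<le> 1" for k \<omega>
    using regression.leverage_nonneg[of d "\<Phi> \<omega>" k] by simp
  have fm: "(\<lambda>\<omega>. lev \<omega> k / (1 + lev \<omega> k)) \<in> borel_measurable (F k)" for k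
    using lev_measurable by (intro borel_measurable_divide borel_measurable_add borel_measurable_const)
  have a4: "AE \<omega> in M. \<forall>j\<ge>1. small_sums (\<lambda>k. (if j \<le> k then V (Suc k - j) \<omega> else 0) * V (Suc k) \<omega>)
                (\<lambda>k. (if j \<le> k then V (Suc k - j) \<omega> else 0)\<^sup>2)"
    unfolding AE_all_countable
  proof
    fix j show "AE \<omega> in M. 1 \<le> j \<longrightarrow> small_sums (\<lambda>k. (if j \<le> k then V (Suc k - j) \<omega> else 0) * V (Suc k) \<omega>)
                (\<lambda>k. (if j \<le> k then V (Suc k - j) \<omega> else 0)\<^sup>2)"
    proof (cases "1 \<le> j")
      case True
      have "(\<lambda>\<omega>. if j \<le> k then V (Suc k - j) \<omega> else 0) \<in> borel_measurable (F k)" for k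
      proof (cases "j \<le> k")
        case jk: True
        hence "V (Suc k - j) \<in> borel_measurable (F k)"
          using measurable_F_mono[OF _ V_measurable, of "k - j" k] True by (simp add: Suc_diff_le)
        thus ?thesis using jk by simp
      qed simp
      from martingale_transform_small_sums[OF this] show ?thesis by eventually_elim simp
    qed simp
  qed
  have a5: "AE \<omega> in M. \<forall>j. small_sums (\<lambda>k. (if j \<le> k then \<epsilon> (k - j) \<omega> else 0) * V (Suc k) \<omega>)
                (\<lambda>k. (if j \<le> k then \<epsilon> (k - j) \<omega> else 0)\<^sup>2)"
    unfolding AE_all_countable
  proof
    fix j
    have "(\<lambda>\<omega>. if j \<le> k then \<epsilon> (k - j) \<omega> else 0) \<in> borel_measurable (F k)" for k
    proof (cases "j \<le> k")
      case True
      have "\<epsilon> (k - j) \<in> borel_measurable (F (k - j))" using adapted by blast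
      hence "\<epsilon> (k - j) \<in> borel_measurable (F k)" by (rule measurable_F_mono[rotated]) simp
      thus ?thesis using True by simp
    qed simp
    from martingale_transform_small_sums[OF this]
    show "AE \<omega> in M. small_sums (\<lambda>k. (if j \<le> k then \<epsilon> (k - j) \<omega> else 0) * V (Suc k) \<omega>)
                (\<lambda>k. (if j \<le> k then \<epsilon> (k - j) \<omega> else 0)\<^sup>2)" .
  qed
  have a3: "AE \<omega> in M. small_sums (\<lambda>k. 1 * ((V (Suc k) \<omega>)\<^sup>2 - \<sigma>\<^sup>2)) (\<lambda>k. 1)"
    by (rule weighted_squares_small_sums[OF mom2, of "\<lambda>_ _. 1"]) auto
  note a1 = martingale_transform_small_sums[OF pred_measurable]
  note a2 = weighted_squares_small_sums[OF mom2 fm f01]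
  have "AE \<omega> in M. path_loop (2 / b) \<omega>"
    using a1 a2 a3 a4 a5 gr ref_small AE_space
  proof eventually_elim
    case (elim \<omega>)
    note w = elim(8)
    interpret L: least_squares d "\<Phi> \<omega>" "err \<omega>" "inno \<omega>" by (rule least_squares_path[OF w])
    have tr: "X (int n + 1) \<omega> = x (Suc n) \<omega> + L.pred_err n + V (Suc n) \<omega>" if "n \<ge> 1" for n
    proof -
      have "L.dot (\<Phi> \<omega> n) (err \<omega> n) = L.dot (\<Phi> \<omega> n) (\<lambda>i. T n \<omega> $ i) - L.dot (\<Phi> \<omega> n) par"
        by (simp add: L.dot_def err_def right_diff_distrib sum_subtractf)
      thus ?thesis using inno_eq[OF w that] control'[OF that w] by (simp add: inno_def L.pred_err_def)
    qed
    show "path_loop (2 / b) \<omega>"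
    proof
      show "\<exists>C. \<forall>k. (V (Suc k) \<omega>)\<^sup>2 \<le> C * real (Suc k) powr (2 / b)" by (rule elim(6))
      show "sublinear (\<lambda>n. \<Sum>k = 1..n. (x k \<omega>)\<^sup>2)" by (rule smallo_imp_sublinear[OF elim(7)])
      show "small_sums (\<lambda>k. L.pred_err k / (1 + L.leverage k) * V (Suc k) \<omega>) (\<lambda>k. (L.pred_err k / (1 + L.leverage k))\<^sup>2)"
        using elim(1) by (simp add: L.pred_err_def)
      show "small_sums (\<lambda>k. L.leverage k / (1 + L.leverage k) * ((V (Suc k) \<omega>)\<^sup>2 - \<sigma>\<^sup>2)) (\<lambda>k. L.leverage k / (1 + L.leverage k))"
        by (rule elim(2))
      show "small_sums (\<lambda>k. (V (Suc k) \<omega>)\<^sup>2 - \<sigma>\<^sup>2) (\<lambda>_. 1)" using elim(3) by simp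
    qed (use elim(4,5) b w \<rho> \<sigma> tr inno_eq[OF w] model'[OF w] noise[OF w] in \<open>auto simp: d_def regressor_fun_def\<close>)
  qed
  thus ?thesis by blast
qed

lemma path_statistics:
  assumes loop: "path_loop \<gamma> \<omega>" and w: "\<omega> \<in> space M"
  shows "(\<lambda>n. rho_bar p X U T n \<omega>) \<longlonglongrightarrow> \<rho>"
    "(\<lambda>n. (rho_bar p X U T n \<omega> - \<rho>)\<^sup>2) \<in> O(\<lambda>n. ln (real n) / real n)"
    "(\<lambda>n. durbin_watson p X U T n \<omega>) \<longlonglongrightarrow> 2 * (1 - \<rho>)"
    "(\<And>k. (V (Suc k) \<omega>)\<^sup>2 \<le> C * (real (Suc k)) powr (1/2)) \<Longrightarrow>
      (\<lambda>n. (durbin_watson p X U T n \<omega> - 2 * (1 - \<rho>))\<^sup>2) \<in> O(\<lambda>n. ln (real n) / real n)"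
proof -
  interpret C: closed_loop d "\<Phi> \<omega>" "err \<omega>" "inno \<omega>" p "\<lambda>i. \<theta> $ i" \<rho> \<sigma> \<gamma>
    "\<lambda>k. X k \<omega>" "\<lambda>k. U k \<omega>" "\<lambda>n. \<epsilon> n \<omega>" "\<lambda>n. V n \<omega>" "\<lambda>n. x n \<omega>" by (rule loop)
  have th: "theta_hat p T n \<omega> $ j = theta_of p (\<lambda>i. par i + err \<omega> n i) j" if "j < p" for n j
    using that by (simp add: theta_hat_def rho_hat_def theta_of_def err_def)
  have res: "residual p X U T n k \<omega> = C.path_residual n k" for n k
  proof (cases k)
    case (Suc m)
    have "theta_hat p T n \<omega> \<bullet> regressor p X m \<omega> = (\<Sum>i<p. theta_hat p T n \<omega> $ i * X (int m - int i) \<omega>)"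
      by (simp add: scalar_prod_def regressor_def atLeast0LessThan)
    also have "\<dots> = (\<Sum>i<p. theta_of p (\<lambda>i. par i + err \<omega> n i) i * X (int m - int i) \<omega>)"
      by (intro sum.cong) (auto simp: th)
    finally show ?thesis using model'[OF w, of m]
      by (simp add: residual_def C.path_residual_def Suc left_diff_distrib sum_subtractf add.commute)
  qed (simp add: residual_def C.path_residual_def)
  have rb: "rho_bar p X U T n \<omega> = C.serial_corr C.path_residual n" for n
    unfolding rho_bar_def C.serial_corr_def sum_from_1 by (simp add: res)
  have dw: "durbin_watson p X U T n \<omega> = C.dw_ratio C.path_residual n" for n
    unfolding durbin_watson_def C.dw_ratio_def sum_from_1 by (simp add: res atLeast0AtMost lessThan_Suc_atMost)
  show "(\<lambda>n. rho_bar p X U T n \<omega>) \<longlonglongrightarrow> \<rho>"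
    "(\<lambda>n. (rho_bar p X U T n \<omega> - \<rho>)\<^sup>2) \<in> O(\<lambda>n. ln (real n) / real n)"
    "(\<lambda>n. durbin_watson p X U T n \<omega>) \<longlonglongrightarrow> 2 * (1 - \<rho>)"
    unfolding rb dw using C.serial_corr_tendsto[OF C.path_residual_good]
      C.serial_corr_bigo[OF C.path_residual_good] C.dw_ratio_tendsto[OF C.path_residual_good] by auto
  show "(\<lambda>n. (durbin_watson p X U T n \<omega> - 2 * (1 - \<rho>))\<^sup>2) \<in> O(\<lambda>n. ln (real n) / real n)"
    if "\<And>k. (V (Suc k) \<omega>)\<^sup>2 \<le> C * (real (Suc k)) powr (1/2)"
    unfolding dw by (rule C.dw_ratio_bigo[OF C.path_residual_good that])
qed

lemma AE_statistics:
  "(AE \<omega> in M. (\<lambda>n. rho_bar p X U T n \<omega>) \<longlonglongrightarrow> \<rho>)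
    \<and> (AE \<omega> in M. (\<lambda>n. (rho_bar p X U T n \<omega> - \<rho>)\<^sup>2) \<in> O(\<lambda>n. ln (real n) / real n))
    \<and> (AE \<omega> in M. (\<lambda>n. durbin_watson p X U T n \<omega>) \<longlonglongrightarrow> 2 * (1 - \<rho>))
    \<and> (finite_cond_moment_gt M F V 4 \<longrightarrow>
        (AE \<omega> in M. (\<lambda>n. (durbin_watson p X U T n \<omega> - 2 * (1 - \<rho>))\<^sup>2)
           \<in> O(\<lambda>n. ln (real n) / real n)))"
proof -
  obtain \<gamma> where g: "AE \<omega> in M. path_loop \<gamma> \<omega>" using AE_closed_loop by blast
  have "AE \<omega> in M. (\<lambda>n. (durbin_watson p X U T n \<omega> - 2 * (1 - \<rho>))\<^sup>2) \<in> O(\<lambda>n. ln (real n) / real n)"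
    if m4: "finite_cond_moment_gt M F V 4"
  proof -
    \<comment> \<open>A growth exponent 2/b with b above 4 is below 1/2, which the sharp
      Durbin-Watson rate asks for.\<close>
    obtain b where b: "b > 4" and "AE \<omega> in M. \<exists>C. \<forall>k. (V (Suc k) \<omega>)\<^sup>2 \<le> C * (real (Suc k)) powr (2 / b)"
      using noise_growth[OF m4] by auto
    from this(2) g AE_space show ?thesis
    proof eventually_elim
      case (elim \<omega>)
      then obtain C where C: "\<And>k. (V (Suc k) \<omega>)\<^sup>2 \<le> C * (real (Suc k)) powr (2 / b)" by blast
      have C0: "C \<ge> 0" using order_trans[OF zero_le_power2 C[of 0]] by simp
      have "(V (Suc k) \<omega>)\<^sup>2 \<le> C * (real (Suc k)) powr (1/2)" for k
        using b C0 by (intro order_trans[OF C] mult_left_mono powr_mono) auto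
      thus ?case by (rule path_statistics(4)[OF elim(2,3)])
    qed
  qed
  moreover have "AE \<omega> in M. (\<lambda>n. rho_bar p X U T n \<omega>) \<longlonglongrightarrow> \<rho>"
    using g AE_space by eventually_elim (rule path_statistics(1))
  moreover have "AE \<omega> in M. (\<lambda>n. (rho_bar p X U T n \<omega> - \<rho>)\<^sup>2) \<in> O(\<lambda>n. ln (real n) / real n)"
    using g AE_space by eventually_elim (rule path_statistics(2))
  moreover have "AE \<omega> in M. (\<lambda>n. durbin_watson p X U T n \<omega>) \<longlonglongrightarrow> 2 * (1 - \<rho>)"
    using g AE_space by eventually_elim (rule path_statistics(3))
  ultimately show ?thesis by blast
qed

end

theorem theorem5p1:
  fixes M :: "'a measure" and F :: "nat \<Rightarrow> 'a measure"
    and p :: nat and \<theta> :: "real vec" and \<rho> \<sigma> :: real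
    and X U :: "int \<Rightarrow> 'a \<Rightarrow> real"
    and \<epsilon> V x :: "nat \<Rightarrow> 'a \<Rightarrow> real"
    and T :: "nat \<Rightarrow> 'a \<Rightarrow> real vec"
  assumes "prob_space M"
    and "filtration (space M) F" and "\<And>n. subalgebra M (F n)"
    and "p \<ge> 1" and "\<theta> \<in> carrier_vec p" and "\<bar>\<rho>\<bar> < 1"
    \<comment> \<open>driving noise\<close>
    and "martingale_difference M F V"
    and "\<sigma> > 0"
    and "\<And>n. AE \<omega> in M.
           nn_cond_exp M (F n) (\<lambda>\<omega>. ennreal ((V (Suc n) \<omega>)\<^sup>2)) \<omega> = ennreal (\<sigma>\<^sup>2)"
    \<comment> \<open>initial values\<close>
    and "\<And>k. k \<le> 0 \<Longrightarrow> X k \<in> borel_measurable (F 0)"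
    and "\<epsilon> 0 \<in> borel_measurable (F 0)"
    and "U 0 \<in> borel_measurable (F 0)" and "U (-1) \<in> borel_measurable (F 0)"
    and "\<And>\<omega>. \<omega> \<in> space M \<Longrightarrow> T 0 \<omega> \<in> carrier_vec (p + 2)"
    and "\<And>i. i < p + 2 \<Longrightarrow> (\<lambda>\<omega>. T 0 \<omega> $ i) \<in> borel_measurable (F 0)"
    \<comment> \<open>ARX model with autoregressive noise\<close>
    and "\<And>n \<omega>. \<omega> \<in> space M \<Longrightarrow>
           X (int n + 1) \<omega> =
             (\<Sum>k=1..p. \<theta> $ (k - 1) * X (int n - int k + 1) \<omega>) + U (int n) \<omega> + \<epsilon> (Suc n) \<omega>"
    and "\<And>n \<omega>. \<omega> \<in> space M \<Longrightarrow> \<epsilon> (Suc n) \<omega> = \<rho> * \<epsilon> n \<omega> + V (Suc n) \<omega>"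
    \<comment> \<open>least squares estimator\<close>
    and "\<And>n \<omega>. \<omega> \<in> space M \<Longrightarrow>
           T (Suc n) \<omega> = T n \<omega> +
             (X (int n + 1) \<omega> - U (int n) \<omega> - T n \<omega> \<bullet> ext_regressor p X U n \<omega>)
               \<cdot>\<^sub>v ls_gain p X U n \<omega>"
    \<comment> \<open>reference trajectory and adaptive tracking control\<close>
    and "\<And>n. x (Suc n) \<in> borel_measurable (F n)"
    and "AE \<omega> in M. (\<lambda>n. \<Sum>k=1..n. (x k \<omega>)\<^sup>2) \<in> o(\<lambda>n. real n)"
    and "\<And>n \<omega>. n \<ge> 1 \<Longrightarrow> \<omega> \<in> space M \<Longrightarrow>
           U (int n) \<omega> = x (Suc n) \<omega> - T n \<omega> \<bullet> ext_regressor p X U n \<omega>"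
    and "\<rho> \<noteq> 0"
    and "finite_cond_moment_gt M F V 2"
  shows "(AE \<omega> in M. (\<lambda>n. rho_bar p X U T n \<omega>) \<longlonglongrightarrow> \<rho>)
    \<and> (AE \<omega> in M. (\<lambda>n. (rho_bar p X U T n \<omega> - \<rho>)\<^sup>2) \<in> O(\<lambda>n. ln (real n) / real n))
    \<and> (AE \<omega> in M. (\<lambda>n. durbin_watson p X U T n \<omega>) \<longlonglongrightarrow> 2 * (1 - \<rho>))
    \<and> (finite_cond_moment_gt M F V 4 \<longrightarrow>
        (AE \<omega> in M. (\<lambda>n. (durbin_watson p X U T n \<omega> - 2 * (1 - \<rho>))\<^sup>2)
           \<in> O(\<lambda>n. ln (real n) / real n)))"
proof -
  interpret arx_tracking M F V \<sigma> p \<theta> \<rho> X U \<epsilon> x T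
    unfolding arx_tracking_def arx_tracking_axioms_def mart_diff_noise_def mart_diff_noise_axioms_def
      filtered_prob_space_def filtered_prob_space_axioms_def
    by (intro conjI allI impI assms; assumption)
  show ?thesis by (rule AE_statistics)
qed

end
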